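(* There exist a constant $C\in[\tfrac12,1]$ and an absolute constant $K>0$ such that the following holds. Let $n\ge 1$ be an integer, $\varepsilon>0$, and let $z_0,\ldots,z_n\in\mathbb{S}^1$ satisfy $\min_{j\neq k} d_{\mathbb{S}^1}(z_j,z_k)\ge\varepsilon$. Then $$\frac{\log\|V(z_0,\ldots,z_n)^{-1}\|}{n}\le \frac{4}{n\varepsilon}\int_0^{\frac{\varepsilon n}{4}}\log\cot\phi\,d\phi-\frac{C\log n}{n}+\frac{K\left(1+\left|\log\left(n\varepsilon(2\pi-n\varepsilon)\right)\right|\right)}{n}.$$ Furthermore, equality is achieved up to the error term, with $C=1$, for equispaced nodes: if $(n+1)\varepsilon\le 2\pi$ and $z_j=e^{ij\varepsilon}$ for $j\in\{0,\ldots,n\}$, then $$\left|\frac{\log\|V(z_0,\ldots,z_n)^{-1}\|}{n}-\left(\frac{4}{n\varepsilon}\int_0^{\frac{\varepsilon n}{4}}\log\cot\phi\,d\phi-\frac{\log n}{n}\right)\right|\le\frac{K\left(1+\left|\log\left(n\varepsilon(2\pi-n\varepsilon)\right)\right|\right)}{n}.$$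
   Context: $\mathbb{S}^1\subset\mathbb{C}$ is the unit circle and $d_{\mathbb{S}^1}(z,w)$ is the (shorter) arc length between $z,w\in\mathbb{S}^1$. $V(z_0,\ldots,z_n)=(z_k^j)_{j,k=0}^n$ is the $(n+1)\times(n+1)$ Vandermonde matrix, and $\|\cdot\|$ is the $\ell_2$ operator (spectral) norm. $i$ is the imaginary unit and $\log$ is the natural logarithm. *)

theory Defs
  imports
    "HOL-Analysis.Analysis"
    "Jordan_Normal_Form.Gauss_Jordan_Elimination"
begin

text \<open>
  For unimodular \<open>z\<close>, \<open>w\<close> the principal argument of the quotient lies in \<open>(-pi, pi]\<close>, so its
  absolute value is the length of the shorter of the two arcs joining them.
\<close>

definition arc_dist :: "complex \<Rightarrow> complex \<Rightarrow> real" where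
  "arc_dist z w = \<bar>Arg (z / w)\<bar>"

text \<open>The \<open>(n+1) \<times> (n+1)\<close> matrix whose columns correspond to the nodes \<open>z 0, \<dots>, z n\<close>.\<close>

definition vandermonde_mat :: "nat \<Rightarrow> (nat \<Rightarrow> complex) \<Rightarrow> complex mat" where
  "vandermonde_mat n z = mat (n + 1) (n + 1) (\<lambda>(j, k). z k ^ j)"

definition l2_norm_vec :: "complex vec \<Rightarrow> real" where
  "l2_norm_vec v = L2_set (\<lambda>i. cmod (vec_index v i)) {..<dim_vec v}"

definition l2_op_norm :: "complex mat \<Rightarrow> real" where
  "l2_op_norm A =
     (SUP v \<in> {v \<in> carrier_vec (dim_col A). l2_norm_vec v \<le> 1}. l2_norm_vec (A *\<^sub>v v))"

text \<open>
  \<^const>\<open>mat_inverse\<close> returns an option. For distinct nodes the Vandermonde matrix is invertible,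
  so the value below is then its actual inverse.
\<close>

definition norm_inv_vandermonde :: "nat \<Rightarrow> (nat \<Rightarrow> complex) \<Rightarrow> real" where
  "norm_inv_vandermonde n z = l2_op_norm (the (mat_inverse (vandermonde_mat n z)))"

text \<open>
  The integrand is singular at \<open>0\<close>, where HOL's conventions give it the value \<open>0\<close>; a single point
  does not affect the integral.
\<close>

definition main_term :: "nat \<Rightarrow> real \<Rightarrow> real" where
  "main_term n \<epsilon> = 4 / (real n * \<epsilon>) * integral {0..\<epsilon> * real n / 4} (\<lambda>\<phi>. ln (cot \<phi>))"

definition error_term :: "nat \<Rightarrow> real \<Rightarrow> real" where
  "error_term n \<epsilon> = (1 + \<bar>ln (real n * \<epsilon> * (2 * pi - real n * \<epsilon>))\<bar>) / real n"

end

theory Submission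
  imports Defs "HOL-Real_Asymp.Real_Asymp" "Jordan_Normal_Form.Determinant"
begin

text \<open>
  The rows of the inverse Vandermonde matrix are the coefficient vectors of the Lagrange basis
  polynomials \<open>L\<^sub>k\<close>, so by Parseval a row has the norm of \<open>L\<^sub>k\<close> in \<open>L\<^sup>2\<close> of the unit circle. There
  \<open>\<bar>L\<^sub>k(x)\<bar> = (\<Prod>j\<noteq>k. \<bar>x - z\<^sub>j\<bar>) / (\<Prod>j\<noteq>k. \<bar>z\<^sub>k - z\<^sub>j\<bar>)\<close>. Among nodes that are \<open>\<epsilon>\<close>-separated
  the denominator is smallest when the other nodes are packed evenly on both sides of \<open>z\<^sub>k\<close>, and
  the numerator is largest when they are packed evenly around the antipode of \<open>x\<close>
  (\<open>packed_enumeration\<close>). Call the resulting bounds \<open>D\<close> and \<open>M\<close>. They are products of values of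
  \<open>2 sin\<close> and of \<open>2 cos\<close> at evenly spaced points of \<open>[0, n\<epsilon>/4]\<close>, each point taken about twice, so
  their logarithms are Riemann sums. The cosine is monotone and loses only powers of
  \<open>c = cos (n\<epsilon>/4)\<close>, which measures how far \<open>n\<epsilon>/4\<close> is from the singularity at \<open>\<pi>/2\<close>. The sine vanishes at \<open>0\<close>; split
  off \<open>ln x\<close>, whose sums are logarithms of factorials, and Stirling's formula gives an extra
  \<open>ln n\<close>. Hence \<open>ln (M/D)\<close> is \<open>n\<close> times the main term minus \<open>ln n\<close>, up to \<open>O(1 + \<bar>ln c\<bar>)\<close>
  (\<open>ln_paired_ratio_le\<close>, \<open>ln_centred_ratio_ge\<close>), and \<open>\<bar>ln c\<bar>\<close> is covered by the error term
  (\<open>minus_ln_cos_le\<close>). Bounding the operator norm by the Frobenius norm of \<open>n + 1\<close> rows costs a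
  factor \<open>\<surd>(n + 1)\<close>, which gives \<open>C = 1/2\<close>.

  For equispaced nodes nothing is lost, because the inverse is close to a matrix of rank one
  whose entries decay like a Gaussian away from the middle row and column. The \<open>q\<close>-binomial
  theorem makes this exact (\<open>coeff_nodal_poly\<close>): the polynomial with \<open>n\<close> consecutive nodes as
  zeros has coefficients \<open>b\<^sub>j\<close> (a positive \<open>q\<close>-binomial coefficient) times a geometric sequence of
  unit complex numbers, and the factor \<open>1 / (\<Prod>j\<noteq>k. \<bar>z\<^sub>k - z\<^sub>j\<bar>)\<close> in \<open>L\<^sub>k\<close> is \<open>b\<^sub>k / P\<close> with one
  constant \<open>P\<close>. Since \<open>b\<close> is unimodal, exchanging one linear factor changes the coefficients by
  at most a factor \<open>O(1/c)\<close>, so the Frobenius norm is \<open>O(1/c)\<close> times \<open>(\<Sum>j. b\<^sub>j\<^sup>2) / P\<close>. This is at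
  most \<open>max b \<cdot> (\<Sum>j. b\<^sub>j) / P\<close>, where \<open>max b / P = 1/D\<close>, and \<open>\<Sum>j. b\<^sub>j\<close> is the modulus of the
  polynomial at the antipode of the arc of nodes, so it is at most \<open>M\<close>.

  For the matching lower bound, combine the \<open>L\<^sub>k\<close> with weights \<open>b\<^sub>k\<close> and with phases that make all
  of them point in the same direction on the whole gap between the last and the first node
  (\<open>coherent_poly_ge\<close>). At distance at most \<open>c/\<surd>n\<close> from the antipode this combination keeps a
  fixed fraction of its size, which costs a factor \<open>n\<^bsup>1/4\<^esup>\<close> in the \<open>L\<^sup>2\<close> norm. On the other hand
  \<open>b\<^sub>j / max b\<close> is at least the quotient of the ordinary binomial coefficients, so
  \<open>\<Sum>j. b\<^sub>j\<^sup>2\<close> exceeds \<open>(max b)\<^sup>2\<close> by a factor of order \<open>\<surd>n\<close>. The two powers of \<open>n\<close> cancel and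
  leave \<open>M/D\<close> again.
\<close>

section \<open>Riemann sums of antitone functions\<close>

lemma sum_diff_pred_Suc:
  fixes g :: "nat \<Rightarrow> real"
  shows "(\<Sum>i<n. g (i - 1) - g (i + 1)) = 2 * g 0 - g (n - 1) - g n"
proof (induction n)
  case (Suc n)
  then show ?case by (cases n) auto
qed simp

lemma sum_diff_two_steps:
  fixes g :: "nat \<Rightarrow> real"
  shows "(\<Sum>i<n. g i - g (i + 2)) = g 0 + g 1 - g n - g (n + 1)"
  by (induction n) auto

locale antitone_riemann =
  fixes f :: "real \<Rightarrow> real" and \<delta> :: real and n :: nat
  assumes step_pos: "\<delta> > 0"
    and antitone: "\<And>x y. 0 \<le> x \<Longrightarrow> x \<le> y \<Longrightarrow> y \<le> real n * \<delta> \<Longrightarrow> f y \<le> f x"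
begin

lemma integrable: "0 \<le> a \<Longrightarrow> b \<le> real n * \<delta> \<Longrightarrow> f integrable_on {a..b}"
proof -
  assume ab: "0 \<le> a" "b \<le> real n * \<delta>"
  have "mono_on {a..b} (\<lambda>x. - f x)"
    using ab by (auto intro!: mono_onI antitone)
  then have "(\<lambda>x. - f x) integrable_on {a..b}" by (rule integrable_on_mono_on)
  then show ?thesis using integrable_neg_iff by blast
qed

lemma integral_step:
  assumes "i < n"
  shows "f (real (i + 1) * \<delta>) * \<delta> \<le> integral {real i * \<delta>..real (i + 1) * \<delta>} f"
    and "integral {real i * \<delta>..real (i + 1) * \<delta>} f \<le> f (real i * \<delta>) * \<delta>"
proof -
  have le: "real (i + 1) * \<delta> \<le> real n * \<delta>"
    using assms step_pos by (intro mult_right_mono) auto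
  have ge: "0 \<le> real i * \<delta>" using step_pos by simp
  have len: "real (i + 1) * \<delta> - real i * \<delta> = \<delta>" by (simp add: algebra_simps)
  have order: "real i * \<delta> \<le> real (i + 1) * \<delta>" using step_pos by (simp add: algebra_simps)
  have int: "f integrable_on {real i * \<delta>..real (i + 1) * \<delta>}"
    by (rule integrable[OF ge le])
  have c: "integral {real i * \<delta>..real (i + 1) * \<delta>} (\<lambda>_. v) = v * \<delta>" for v :: real
    using order len by (simp add: mult.commute)
  have "f (real (i + 1) * \<delta>) \<le> f x" "f x \<le> f (real i * \<delta>)"
    if "x \<in> {real i * \<delta>..real (i + 1) * \<delta>}" for x
    using that ge le by (meson antitone atLeastAtMost_iff order_trans)+
  then have "integral {real i * \<delta>..real (i + 1) * \<delta>} (\<lambda>_. f (real (i + 1) * \<delta>))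
      \<le> integral {real i * \<delta>..real (i + 1) * \<delta>} f"
    and "integral {real i * \<delta>..real (i + 1) * \<delta>} f
      \<le> integral {real i * \<delta>..real (i + 1) * \<delta>} (\<lambda>_. f (real i * \<delta>))"
    by (intro integral_le int integrable_const_ivl; blast)+
  then show "f (real (i + 1) * \<delta>) * \<delta> \<le> integral {real i * \<delta>..real (i + 1) * \<delta>} f"
    and "integral {real i * \<delta>..real (i + 1) * \<delta>} f \<le> f (real i * \<delta>) * \<delta>"
    unfolding c by blast+
qed

lemma integral_split:
  "m \<le> n \<Longrightarrow> integral {0..real m * \<delta>} f
     = (\<Sum>i<m. integral {real i * \<delta>..real (i + 1) * \<delta>} f)"
proof (induction m)
  case (Suc m)
  have "integral {0..real m * \<delta>} f + integral {real m * \<delta>..real (Suc m) * \<delta>} f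
      = integral {0..real (Suc m) * \<delta>} f"
  proof (rule Henstock_Kurzweil_Integration.integral_combine)
    show "f integrable_on {0..real (Suc m) * \<delta>}"
      using Suc.prems step_pos by (intro integrable mult_right_mono) auto
  qed (use step_pos in \<open>auto simp: algebra_simps\<close>)
  then show ?case using Suc by simp
qed simp

definition mean where "mean = integral {0..real n * \<delta>} f / \<delta>"

lemma sum_right_le_mean: "(\<Sum>i<n. f (real (i + 1) * \<delta>)) \<le> mean"
proof -
  have "(\<Sum>i<n. f (real (i + 1) * \<delta>)) * \<delta> \<le> integral {0..real n * \<delta>} f"
    unfolding integral_split[OF order_refl] sum_distrib_right
    by (intro sum_mono integral_step(1)) auto
  then show ?thesis using step_pos by (simp add: mean_def pos_le_divide_eq)
qed

lemma mean_le_sum_left: "mean \<le> (\<Sum>i<n. f (real i * \<delta>))"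
proof -
  have "integral {0..real n * \<delta>} f \<le> (\<Sum>i<n. f (real i * \<delta>)) * \<delta>"
    unfolding integral_split[OF order_refl] sum_distrib_right
    by (intro sum_mono integral_step(2)) auto
  then show ?thesis using step_pos by (simp add: mean_def pos_divide_le_eq)
qed

lemma mean_le_sum_right:
  "mean - (f 0 - f (real n * \<delta>)) \<le> (\<Sum>i<n. f (real (i + 1) * \<delta>))"
proof -
  have "(\<Sum>i<n. f (real i * \<delta>) - f (real (Suc i) * \<delta>)) = f (real 0 * \<delta>) - f (real n * \<delta>)"
    by (rule sum_lessThan_telescope')
  then show ?thesis using mean_le_sum_left by (simp add: sum_subtractf)
qed

text \<open>
  Sampling one step too early, and the point \<open>0\<close> twice, still costs only a multiple of the total
  drop of \<open>f\<close>, by telescoping. This slack absorbs the rounding in the paired products below.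
\<close>
lemma sum_pred_le_mean:
  "(\<Sum>i<n. f (real (i - 1) * \<delta>)) \<le> mean + 2 * (f 0 - f (real n * \<delta>))"
proof -
  have "(\<Sum>i<n. f (real (i - 1) * \<delta>) - f (real (i + 1) * \<delta>))
      = 2 * f (real 0 * \<delta>) - f (real (n - 1) * \<delta>) - f (real n * \<delta>)"
    by (rule sum_diff_pred_Suc)
  moreover have "f (real n * \<delta>) \<le> f (real (n - 1) * \<delta>)"
    using step_pos by (intro antitone mult_right_mono) auto
  ultimately show ?thesis using sum_right_le_mean by (simp add: sum_subtractf)
qed

end

section \<open>Stirling's formula and central binomial coefficients\<close>

text \<open>
  The midpoint and the trapezoidal rule for the convex function \<open>1/x\<close> bound \<open>ln (m + 1) - ln m\<close>
  from below and from above. This shows that Stirling's error decreases, by a telescoping amount.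
\<close>
lemma stirling_defect:
  assumes "m \<ge> 1"
  defines "d \<equiv> \<lambda>m::nat. ln (fact m) - (real m + 1/2) * ln (real m) + real m"
  shows "d m - d (Suc m) \<in> {0..1/4 * (1 / real m - 1 / real (Suc m))}"
proof -
  define x where "x = real m"
  have x: "x \<ge> 1" using assms by (simp add: x_def)
  define L where "L = ln (x + 1) - ln x"
  have eq: "d m - d (Suc m) = (x + 1/2) * L - 1"
  proof -
    have "ln (fact (Suc m) :: real) = ln (x + 1) + ln (fact m)"
      using x by (simp add: ln_mult x_def add.commute)
    moreover have "real (Suc m) = x + 1" by (simp add: x_def)
    ultimately show ?thesis unfolding d_def L_def x_def[symmetric]
      by (simp add: algebra_simps)
  qed
  have "2 / (2 * x + 1) \<le> L"
    using ln_inverse_approx_ge[of x "x + 1"] x by (simp add: L_def algebra_simps)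
  then have lo: "(x + 1/2) * L \<ge> 1"
    using x by (simp add: field_simps)
  have "L \<le> (inverse x + inverse (x + 1)) / 2"
    using ln_inverse_approx_le[of x 1] x by (simp add: L_def)
  then have "(x + 1/2) * L \<le> (x + 1/2) * ((inverse x + inverse (x + 1)) / 2)"
    using x by (intro mult_left_mono) auto
  also have "\<dots> = 1 + 1/4 * (1 / x - 1 / (x + 1))"
  proof -
    have "1 / (x * (x + 1)) = 1 / x - 1 / (x + 1)" using x by (simp add: field_simps)
    moreover have "(x + 1/2) * ((inverse x + inverse (x + 1)) / 2)
        = 1 + 1/4 * (1 / (x * (x + 1)))"
      using x by (simp add: divide_simps) (simp add: algebra_simps)
    ultimately show ?thesis by simp
  qed
  finally have hi: "(x + 1/2) * L \<le> 1 + 1/4 * (1 / x - 1 / (x + 1))" .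
  have "real (Suc m) = x + 1" by (simp add: x_def)
  then show ?thesis
    unfolding eq atLeastAtMost_iff x_def[symmetric] using lo hi by (auto simp only:)
qed

lemma stirling_bounds:
  assumes "m \<ge> 1"
  shows "ln (fact m) - ((real m + 1/2) * ln (real m) - real m) \<in> {3/4..1}"
proof -
  define d where "d = (\<lambda>m::nat. ln (fact m) - (real m + 1/2) * ln (real m) + real m)"
  have "d m \<le> 1 \<and> d m \<ge> 3/4 + 1/4 * (1 / real m)"
    using assms
  proof (induction m rule: dec_induct)
    case (step m)
    have "d m - d (Suc m) \<in> {0..1/4 * (1 / real m - 1 / real (Suc m))}"
      unfolding d_def using step by (intro stirling_defect)
    then show ?case using step by (simp only: atLeastAtMost_iff right_diff_distrib) linarith
  qed (simp add: d_def)
  moreover have "1 / real m \<ge> 0" by simp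
  ultimately have "d m \<in> {3/4..1}" unfolding atLeastAtMost_iff by linarith
  then show ?thesis by (simp add: d_def algebra_simps)
qed

lemma sum_ln_halves:
  "(\<Sum>i<2 * m. ln (real (i div 2 + 1))) = 2 * ln (fact m)"
proof (induction m)
  case (Suc m)
  then show ?case by (simp add: ln_mult add.commute)
qed simp

text \<open>
  The sum is \<open>ln (\<lfloor>n/2\<rfloor>! \<lceil>n/2\<rceil>!)\<close>. The two factorials contribute a square root of \<open>n\<close> each, and
  this is where the term \<open>ln n\<close> of the theorem comes from.
\<close>
lemma sum_ln_halves_bounds:
  assumes "n \<ge> 1"
  shows "\<bar>(\<Sum>i<n. ln (real (i div 2 + 1))) - (real n * (ln (real n / 2) - 1) + ln (real n))\<bar> \<le> 4"
proof (cases "even n")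
  case True
  then obtain m where n: "n = 2 * m" by blast
  then have m: "m \<ge> 1" using assms by simp
  have l: "ln (real (2 * m)) = ln 2 + ln (real m)" using m by (simp add: ln_mult)
  define t where "t = ln (2::real)"
  have "t \<ge> 0" "t \<le> 1" using ln_2_less_1 by (simp_all add: t_def)
  then show ?thesis
    using stirling_bounds[OF m] m unfolding n sum_ln_halves l t_def[symmetric]
    by (simp add: algebra_simps abs_le_iff)
next
  case False
  then obtain m where n: "n = 2 * m + 1" using oddE by blast
  show ?thesis
  proof (cases "m = 0")
    case True
    have "ln (2::real) \<in> {0..1}" using ln_2_less_1 by simp
    then show ?thesis unfolding n True by (auto simp: ln_div)
  next
    case False
    then have m: "m \<ge> 1" by simp
    define x where "x = real m"
    have x: "x \<ge> 1" using m by (simp add: x_def)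
    define l where "l = ln (x + 1/2) - ln x"
    have "ln (x + 1/2) - ln x = ln ((x + 1/2) / x)" using x
      by (subst ln_div) auto
    also have "(x + 1/2) / x = 1 + 1/(2 * x)" using x by (simp add: field_simps)
    also have "ln (1 + 1/(2 * x)) \<le> 1/(2 * x)" using x by (intro ln_add_one_self_le_self) auto
    finally have l1: "l \<le> 1/(2 * x)" by (simp add: l_def)
    have l0: "l \<ge> 0" using x by (simp add: l_def)
    have xl: "x * l \<le> 1/2" using l1 x by (simp add: field_simps)
    have "1/(2 * x) \<le> 1" using x by (simp add: field_simps)
    then have l2: "l \<le> 1" using l1 by linarith
    define k where "k = ln (x + 1) - ln x"
    have "ln (x + 1) \<le> ln (2 * x)" using x by simp
    also have "\<dots> = ln 2 + ln x" using x by (simp add: ln_mult)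
    finally have "k \<le> 1" using ln_2_less_1 by (simp add: k_def)
    have "k \<ge> 0" using x by (simp add: k_def)
    define F where "F = ln (fact m :: real)"
    define t where "t = ln (2::real)"
    define u where "u = ln x"
    have t: "t \<ge> 0" "t \<le> 1" using ln_2_less_1 by (simp_all add: t_def)
    have F: "F - (x * u + u / 2 - x) \<in> {3/4..1}"
      using stirling_bounds[OF m] by (simp add: F_def u_def x_def algebra_simps)
    have lhs: "(\<Sum>i<n. ln (real (i div 2 + 1))) = 2 * F + u + k"
      unfolding n using sum_ln_halves[of m] by (simp add: F_def u_def k_def x_def add.commute)
    have n2: "real n / 2 = x + 1/2" and n1: "real n = 2 * x + 1" by (auto simp: n x_def)
    have "ln (real n / 2) = u + l" unfolding n2 by (simp add: l_def u_def)
    moreover have "ln (real n) = t + ln (real n / 2)"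
      using x n1 by (simp add: t_def ln_div)
    ultimately have rhs: "real n * (ln (real n / 2) - 1) + ln (real n)
        = 2 * (x * u) + 2 * u + 2 * (x * l) + 2 * l - 2 * x - 1 + t"
      unfolding n1 by (simp add: algebra_simps)
    have "x * l \<ge> 0" using x l0 by simp
    then show ?thesis
      unfolding lhs rhs abs_le_iff using F t xl l0 l2 \<open>k \<le> 1\<close> \<open>k \<ge> 0\<close>
      unfolding atLeastAtMost_iff by linarith
  qed
qed

lemma prod_halves_eq_fact: "(\<Prod>i<n. real (i div 2 + 1)) = fact (n div 2) * fact (n - n div 2)"
proof (induction n)
  case (Suc n)
  show ?case
  proof (cases "even n")
    case True
    then have "Suc n div 2 = n div 2" "Suc n - n div 2 = Suc (n - n div 2)" "n - n div 2 = n div 2" by auto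
    then show ?thesis using Suc by (simp del: of_nat_Suc add: algebra_simps)
  next
    case False
    then have "Suc n div 2 = Suc (n div 2)" "Suc n - Suc (n div 2) = n - n div 2" by presburger+
    then show ?thesis using Suc by (simp add: algebra_simps)
  qed
qed simp

text \<open>
  By Vandermonde's identity the left-hand side is \<open>\<Sum>k. (n choose k)\<^sup>2\<close> relative to its largest
  term: about \<open>\<surd>n\<close> of the terms have the size of the largest one. The constant collects the error
  bounds of Stirling's formula.
\<close>
lemma sum_binomial_squares_lower:
  assumes "n \<ge> 1"
  shows "real ((2 * n) choose n) / (real (n choose (n div 2)))\<^sup>2 \<ge> exp (-14) * sqrt (real n)"
proof -
  define l where "l = ln (real n)"
  define G where "G = (\<Sum>i<n. ln (real (i div 2 + 1)))"
  define F where "F = ln (fact n :: real)"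
  define F2 where "F2 = ln (fact (2*n) :: real)"
  have G: "\<bar>G - (real n * (l - ln 2 - 1) + l)\<bar> \<le> 4"
    using sum_ln_halves_bounds[OF assms] assms by (simp add: G_def l_def ln_div)
  have F: "F - ((real n + 1/2) * l - real n) \<in> {3/4..1}"
    using stirling_bounds[OF assms] by (simp add: F_def l_def)
  have F2: "F2 - ((2 * real n + 1/2) * (ln 2 + l) - 2 * real n) \<in> {3/4..1}"
    using stirling_bounds[of "2*n"] assms by (simp add: F2_def l_def ln_mult)
  define t where "t = ln (2::real)"
  have t: "t \<ge> 0" "t \<le> 1" using ln_2_less_1 by (simp_all add: t_def)
  have "exp G = (\<Prod>i<n. exp (ln (real (i div 2 + 1))))" unfolding G_def by (rule exp_sum) simp
  also have "\<dots> = (\<Prod>i<n. real (i div 2 + 1))" by (intro prod.cong) auto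
  finally have eG: "exp G = fact (n div 2) * fact (n - n div 2)"
    by (simp only: prod_halves_eq_fact)
  have c: "real (n choose (n div 2)) = exp F / exp G"
    unfolding eG F_def by (simp add: binomial_fact)
  have c2: "real ((2 * n) choose n) = exp F2 / (exp F * exp F)"
    unfolding F_def F2_def by (simp add: binomial_fact)
  have "real (n choose (n div 2)) = exp (F - G)" using c by (simp add: exp_diff)
  moreover have "real ((2 * n) choose n) = exp (F2 - F - F)"
    using c2 by (simp only: exp_diff divide_divide_eq_left)
  ultimately have "real ((2 * n) choose n) / (real (n choose (n div 2)))\<^sup>2
      = exp (F2 - F - F) / exp (2 * (F - G))"
    by (simp only: exp_double)
  also have "\<dots> = exp (F2 - 4 * F + 2 * G)"
    unfolding exp_diff[symmetric] by (simp add: algebra_simps)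
  finally have eq: "real ((2 * n) choose n) / (real (n choose (n div 2)))\<^sup>2 = exp (F2 - 4 * F + 2 * G)" .
  have "exp (-14) * sqrt (real n) = exp (-14 + l / 2)"
    using assms unfolding exp_add l_def by (simp flip: ln_sqrt)
  also have "-14 + l / 2 \<le> F2 - 4 * F + 2 * G"
    using G F F2 t unfolding t_def[symmetric]
    by (simp only: abs_le_iff atLeastAtMost_iff algebra_simps) linarith
  finally show ?thesis unfolding eq by simp
qed

section \<open>The main term as a difference of means\<close>

lemma sin_ratio_antitone:
  fixes x y :: real
  assumes "0 \<le> x" "x \<le> y" "y \<le> pi"
  shows "x * sin y \<le> y * sin x"
proof (cases "x = 0")
  case False
  then have x: "x > 0" using assms by simp
  have key: "t * cos t \<le> sin t" if "0 \<le> t" "t \<le> pi" for t :: real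
  proof -
    have "(\<lambda>t. sin t - t * cos t) 0 \<le> (\<lambda>t. sin t - t * cos t) t"
    proof (rule DERIV_nonneg_imp_nondecreasing[OF that(1)], intro exI conjI)
      fix u assume "0 \<le> u" "u \<le> t"
      show "((\<lambda>t. sin t - t * cos t) has_real_derivative u * sin u) (at u)"
        by (auto intro!: derivative_eq_intros)
      show "0 \<le> u * sin u" using \<open>0 \<le> u\<close> \<open>u \<le> t\<close> that by (simp add: sin_ge_zero)
    qed
    then show ?thesis by simp
  qed
  have "(\<lambda>t. sin t / t) y \<le> (\<lambda>t. sin t / t) x"
  proof (rule DERIV_nonpos_imp_nonincreasing[OF assms(2)], intro exI conjI)
    fix u assume u: "x \<le> u" "u \<le> y"
    show "((\<lambda>t. sin t / t) has_real_derivative (u * cos u - sin u) / u\<^sup>2) (at u)"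
      using u x by (auto intro!: derivative_eq_intros simp: power2_eq_square mult.commute)
    show "(u * cos u - sin u) / u\<^sup>2 \<le> 0"
      using key[of u] u assms by (simp add: divide_nonpos_nonneg)
  qed
  then show ?thesis using x assms by (simp add: field_simps)
qed (use assms in simp)

lemma sin_ge_linear:
  fixes x :: real
  assumes "0 \<le> x" "x \<le> pi / 2"
  shows "2 / pi * x \<le> sin x"
  using sin_ratio_antitone[of x "pi / 2"] assms by (simp add: field_simps)

text \<open>At \<open>0\<close> this function has the value \<open>ln (0 / 0) = 0\<close>, which is its limit there.\<close>
definition ln_sinc :: "real \<Rightarrow> real" where "ln_sinc x = ln (sin x / x)"

lemma ln_sinc_antitone:
  assumes "0 \<le> x" "x \<le> y" "y \<le> pi / 2"
  shows "ln_sinc y \<le> ln_sinc x"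
proof (cases "y = 0")
  case False
  then have y: "y > 0" "y < pi" using assms pi_gt_zero by linarith+
  then have sy: "sin y > 0" by (simp add: sin_gt_zero)
  show ?thesis
  proof (cases "x = 0")
    case True
    then show ?thesis using y sy sin_x_le_x[of y] by (simp add: ln_sinc_def)
  next
    case False
    then have "sin y / y \<le> sin x / x"
      using sin_ratio_antitone[of x y] assms y by (simp add: field_simps)
    moreover have "sin y / y > 0" using sy y by simp
    ultimately show ?thesis unfolding ln_sinc_def
      by (subst ln_le_cancel_iff) (auto intro: less_le_trans)
  qed
qed (use assms in simp)

lemma ln_sinc_bounds:
  assumes "0 \<le> x" "x \<le> pi / 2"
  shows "ln_sinc x \<in> {-1..0}"
proof -
  have "exp (-1) = 1 / exp (1::real)" by (simp add: exp_minus field_simps)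
  also have "\<dots> \<le> 1 / 2" using exp_ge_add_one_self[of 1] by (intro divide_left_mono) auto
  also have "1 / 2 \<le> 2 / pi" using pi_less_4 by (simp add: field_simps)
  finally have "ln (exp (-1)) \<le> ln (2 / pi)" by (subst ln_le_cancel_iff) auto
  then have "-1 \<le> ln_sinc (pi / 2)" by (simp add: ln_sinc_def)
  then show ?thesis
    using ln_sinc_antitone[of x "pi / 2"] ln_sinc_antitone[of 0 x] assms
    by (auto simp: ln_sinc_def)
qed

lemma has_integral_ln_double:
  fixes X :: real
  assumes "X \<ge> 0"
  shows "((\<lambda>x. ln (2 * x)) has_integral X * (ln (2 * X) - 1)) {0..X}"
proof -
  have "((\<lambda>x::real. ln (2 * x)) has_integral
      (\<lambda>x. x * (ln (2 * x) - 1)) X - (\<lambda>x. x * (ln (2 * x) - 1)) 0) {0..X}"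
  proof (rule fundamental_theorem_of_calculus_interior[OF assms])
    show "continuous_on {0..X} (\<lambda>x. x * (ln (2 * x) - 1))"
    proof (rule continuous_on_eq_continuous_within[THEN iffD2], rule ballI)
      fix x assume x: "x \<in> {0..X}"
      show "continuous (at x within {0..X}) (\<lambda>x. x * (ln (2 * x) - 1))"
      proof (cases "x = 0")
        case True
        have "((\<lambda>x::real. x * (ln (2 * x) - 1)) \<longlongrightarrow> 0) (at_right 0)" by real_asymp
        moreover have "at 0 within {0..X} \<le> at_right (0::real)"
          unfolding at_within_def by (intro inf_mono) auto
        ultimately show ?thesis
          unfolding True continuous_within by (auto intro: tendsto_mono)
      qed (use x in \<open>auto intro!: continuous_intros\<close>)
    qed
  next
    fix x assume "x \<in> {0<..<X}"
    then show "((\<lambda>x. x * (ln (2 * x) - 1)) has_vector_derivative ln (2 * x)) (at x)"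
      unfolding has_real_derivative_iff_has_vector_derivative[symmetric]
      by (auto intro!: derivative_eq_intros)
  qed
  then show ?thesis by simp
qed

text \<open>
  The step \<open>\<epsilon>/4\<close> makes the interval of integration \<open>[0, n\<epsilon>/4]\<close>, so each half-angle \<open>i\<epsilon>/2\<close> below
  stands for two consecutive cells, one for a node on either side.
\<close>
definition cos_mean :: "nat \<Rightarrow> real \<Rightarrow> real" where
  "cos_mean n \<epsilon> = antitone_riemann.mean (\<lambda>x. ln (2 * cos x)) (\<epsilon> / 4) n"

definition sinc_mean :: "nat \<Rightarrow> real \<Rightarrow> real" where
  "sinc_mean n \<epsilon> = antitone_riemann.mean ln_sinc (\<epsilon> / 4) n"

context
  fixes n :: nat and \<epsilon> :: real
  assumes n: "n \<ge> 1" and eps: "\<epsilon> > 0" and short: "(real n + 1) * \<epsilon> \<le> 2 * pi"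
begin

lemma half_arc_bounds: "0 < real n * \<epsilon> / 4" "real n * \<epsilon> / 4 < pi / 2"
  "0 < cos (real n * \<epsilon> / 4)" "cos (real n * \<epsilon> / 4) \<le> 1"
proof -
  show a: "0 < real n * \<epsilon> / 4" using n eps by simp
  show b: "real n * \<epsilon> / 4 < pi / 2" using short eps by (simp add: algebra_simps)
  show "0 < cos (real n * \<epsilon> / 4)" using a b by (intro cos_gt_zero_pi) linarith+
qed simp

lemma cos_riemann: "antitone_riemann (\<lambda>x. ln (2 * cos x)) (\<epsilon> / 4) n"
proof
  fix x y assume xy: "0 \<le> x" "x \<le> y" "y \<le> real n * (\<epsilon> / 4)"
  then have "y < pi / 2" using half_arc_bounds unfolding times_divide_eq_right by linarith
  then have "cos y > 0" "cos y \<le> cos x" using xy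
    by (auto intro!: cos_gt_zero_pi cos_monotone_0_pi_le)
  then show "ln (2 * cos y) \<le> ln (2 * cos x)" by simp
qed (use eps in simp)

lemma sinc_riemann: "antitone_riemann ln_sinc (\<epsilon> / 4) n"
proof
  fix x y assume "0 \<le> x" "x \<le> y" "y \<le> real n * (\<epsilon> / 4)"
  then show "ln_sinc y \<le> ln_sinc x"
    using half_arc_bounds unfolding times_divide_eq_right by (intro ln_sinc_antitone) linarith+
qed (use eps in simp)

text \<open>
  \<open>ln cot x = ln (2 cos x) - ln (2x) - ln (sin x / x)\<close>, and the middle term has an elementary
  antiderivative.
\<close>
lemma main_term_eq_means:
  "real n * main_term n \<epsilon> = cos_mean n \<epsilon> - real n * (ln (real n * \<epsilon> / 2) - 1) - sinc_mean n \<epsilon>"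
proof -
  interpret c: antitone_riemann "\<lambda>x. ln (2 * cos x)" "\<epsilon> / 4" n by (rule cos_riemann)
  interpret s: antitone_riemann ln_sinc "\<epsilon> / 4" n by (rule sinc_riemann)
  define X where "X = real n * (\<epsilon> / 4)"
  have X: "X > 0" "X < pi / 2" using half_arc_bounds unfolding X_def times_divide_eq_right by auto
  have int: "((\<lambda>x. ln (2 * cos x) - ln (2 * x) - ln_sinc x) has_integral
      integral {0..X} (\<lambda>x. ln (2 * cos x)) - X * (ln (2 * X) - 1) - integral {0..X} ln_sinc) {0..X}"
    using X c.integrable[of 0 X] s.integrable[of 0 X]
    by (intro has_integral_diff has_integral_ln_double integrable_integral) (auto simp: X_def)
  have eq: "ln (cot x) = ln (2 * cos x) - ln (2 * x) - ln_sinc x" if "x \<in> {0..X} - {0}" for x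
  proof -
    have x: "x > 0" "x < pi / 2" using that X by auto
    then have "sin x > 0" "cos x > 0" by (auto intro!: sin_gt_zero cos_gt_zero_pi)
    then show ?thesis using x by (simp add: ln_sinc_def cot_def ln_div ln_mult)
  qed
  have "((\<lambda>x. ln (cot x)) has_integral
      integral {0..X} (\<lambda>x. ln (2 * cos x)) - X * (ln (2 * X) - 1) - integral {0..X} ln_sinc) {0..X}"
    by (rule has_integral_spike_finite[OF finite.insertI[OF finite.emptyI] eq int])
  then have "integral {0..X} (\<lambda>x. ln (cot x)) =
      integral {0..X} (\<lambda>x. ln (2 * cos x)) - X * (ln (2 * X) - 1) - integral {0..X} ln_sinc"
    by (rule integral_unique)
  moreover have "2 * X = real n * \<epsilon> / 2" "\<epsilon> * real n / 4 = X" by (simp_all add: X_def)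
  ultimately have "real n * main_term n \<epsilon> = (integral {0..X} (\<lambda>x. ln (2 * cos x))
      - X * (ln (real n * \<epsilon> / 2) - 1) - integral {0..X} ln_sinc) / (\<epsilon> / 4)"
  proof -
    assume eqs: "integral {0..X} (\<lambda>x. ln (cot x)) = integral {0..X} (\<lambda>x. ln (2 * cos x))
        - X * (ln (2 * X) - 1) - integral {0..X} ln_sinc"
      "2 * X = real n * \<epsilon> / 2" "\<epsilon> * real n / 4 = X"
    have scale: "real n * (4 / (real n * \<epsilon>) * I) = I / (\<epsilon> / 4)" for I
      using n eps by simp
    show ?thesis unfolding main_term_def eqs(3) scale eqs(1) eqs(2) by (rule refl)
  qed
  also have "\<dots> = integral {0..X} (\<lambda>x. ln (2 * cos x)) / (\<epsilon> / 4)
      - X / (\<epsilon> / 4) * (ln (real n * \<epsilon> / 2) - 1) - integral {0..X} ln_sinc / (\<epsilon> / 4)"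
    by (simp only: diff_divide_distrib times_divide_eq_left)
  also have "X / (\<epsilon> / 4) = real n" using eps by (simp add: X_def)
  finally show ?thesis
    unfolding cos_mean_def sinc_mean_def c.mean_def s.mean_def X_def .
qed

end

text \<open>
  Three extremal products. The first is the least possible product of distances from a node to
  \<open>n\<close> others, the second bounds the product of distances from any point of the circle to \<open>n\<close>
  separated nodes, and the third is the product of distances from \<open>n + 1\<close> equispaced nodes to the
  antipode of their centre. The division by two puts consecutive indices on opposite sides.
\<close>
definition paired_sin_prod :: "nat \<Rightarrow> real \<Rightarrow> real" where
  "paired_sin_prod n \<epsilon> = (\<Prod>i<n. 2 * sin (real (i div 2 + 1) * \<epsilon> / 2))"

definition paired_cos_prod :: "nat \<Rightarrow> real \<Rightarrow> real" where
  "paired_cos_prod n \<epsilon> = (\<Prod>i<n. 2 * cos (real (i div 2) * \<epsilon> / 2))"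

definition centred_cos_prod :: "nat \<Rightarrow> real \<Rightarrow> real" where
  "centred_cos_prod n \<epsilon> = (\<Prod>j\<le>n. 2 * cos ((real j - real n / 2) * \<epsilon> / 2))"

text \<open>
  Induction in steps of two, because the outermost pair of summands is what distinguishes \<open>n + 2\<close>
  from \<open>n\<close>. The last sample is \<open>n/2\<close> and not \<open>(n + 1)/2\<close>, since \<open>f\<close> will be \<open>ln (2 cos _)\<close>, which may
  be singular at the latter.
\<close>
lemma centred_sum_ge:
  fixes f :: "real \<Rightarrow> real"
  assumes "\<And>x y. 0 \<le> x \<Longrightarrow> x \<le> y \<Longrightarrow> y \<le> real n / 2 \<Longrightarrow> f y \<le> f x"
  shows "(\<Sum>i<n. f (real (i + 1) / 2)) + f (real n / 2) \<le> (\<Sum>j\<le>n. f \<bar>real j - real n / 2\<bar>)"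
  using assms
proof (induction n rule: induct_nat_012)
  case 1
  then show ?case by simp
next
  case (ge2 n)
  have "(\<Sum>j\<le>Suc (Suc n). f \<bar>real j - real (Suc (Suc n)) / 2\<bar>)
      = f \<bar>real 0 - real (Suc (Suc n)) / 2\<bar>
        + (\<Sum>j\<le>Suc n. f \<bar>real (Suc j) - real (Suc (Suc n)) / 2\<bar>)"
    by (rule sum.atMost_Suc_shift)
  also have "\<dots> = 2 * f (real (Suc (Suc n)) / 2) + (\<Sum>j\<le>n. f \<bar>real j - real n / 2\<bar>)"
  proof -
    have "\<bar>real (Suc j) - real (Suc (Suc n)) / 2\<bar> = \<bar>real j - real n / 2\<bar>" for j
      by (simp add: add_divide_distrib)
    moreover have "\<bar>real (Suc n) - real n / 2\<bar> = real (Suc (Suc n)) / 2"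
      "\<bar>real 0 - real (Suc (Suc n)) / 2\<bar> = real (Suc (Suc n)) / 2"
      by (simp_all add: add_divide_distrib)
    ultimately show ?thesis by (simp only: sum.atMost_Suc)
  qed
  finally have eq: "(\<Sum>j\<le>Suc (Suc n). f \<bar>real j - real (Suc (Suc n)) / 2\<bar>)
      = 2 * f (real (Suc (Suc n)) / 2) + (\<Sum>j\<le>n. f \<bar>real j - real n / 2\<bar>)" .
  have "(\<Sum>i<n. f (real (i + 1) / 2)) + f (real n / 2) \<le> (\<Sum>j\<le>n. f \<bar>real j - real n / 2\<bar>)"
    by (rule ge2.IH(1)) (rule ge2.prems, auto)
  moreover have "f (real (n + 1) / 2) \<le> f (real n / 2)"
    by (rule ge2.prems) auto
  ultimately show ?case unfolding eq by simp
qed simp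

context
  fixes n :: nat and \<epsilon> :: real
  assumes n: "n \<ge> 1" and eps: "\<epsilon> > 0" and short: "(real n + 1) * \<epsilon> \<le> 2 * pi"
begin

lemma paired_cos_pos: "i < n \<Longrightarrow> 2 * cos (real (i div 2) * \<epsilon> / 2) > 0"
proof -
  assume "i < n"
  then have "2 * real (i div 2) \<le> real n" by linarith
  then have "2 * real (i div 2) * (\<epsilon> / 4) \<le> real n * (\<epsilon> / 4)"
    using eps by (intro mult_right_mono) auto
  moreover have "2 * real (i div 2) * (\<epsilon> / 4) = real (i div 2) * \<epsilon> / 2" by simp
  ultimately have "real (i div 2) * \<epsilon> / 2 < pi / 2"
    using half_arc_bounds(2)[OF n eps short] unfolding times_divide_eq_right by linarith
  then show ?thesis using eps
    by (intro mult_pos_pos cos_gt_zero_pi) (auto intro: less_le_trans[of _ 0])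
qed

lemma paired_cos_prod_pos: "paired_cos_prod n \<epsilon> > 0"
  unfolding paired_cos_prod_def using paired_cos_pos by (intro prod_pos) auto

lemma ln_paired_cos_prod_le:
  "ln (paired_cos_prod n \<epsilon>) \<le> cos_mean n \<epsilon> - 2 * ln (cos (real n * \<epsilon> / 4))"
proof -
  interpret c: antitone_riemann "\<lambda>x. ln (2 * cos x)" "\<epsilon> / 4" n
    by (rule cos_riemann[OF n eps short])
  have "ln (paired_cos_prod n \<epsilon>) = (\<Sum>i<n. ln (2 * cos (real (i div 2) * \<epsilon> / 2)))"
    unfolding paired_cos_prod_def
    by (intro ln_prod finite_lessThan less_imp_neq[OF paired_cos_pos, symmetric]) simp
  also have "\<dots> \<le> (\<Sum>i<n. ln (2 * cos (real (i - 1) * (\<epsilon> / 4))))"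
  proof (intro sum_mono c.antitone)
    fix i assume i: "i \<in> {..<n}"
    have "real (i - 1) \<le> 2 * real (i div 2)" by linarith
    then have "real (i - 1) * (\<epsilon> / 4) \<le> 2 * real (i div 2) * (\<epsilon> / 4)"
      using eps by (intro mult_right_mono) auto
    then show "real (i - 1) * (\<epsilon> / 4) \<le> real (i div 2) * \<epsilon> / 2" by (simp add: mult.commute)
    have "2 * real (i div 2) \<le> real n" using i by auto
    then have "2 * real (i div 2) * (\<epsilon> / 4) \<le> real n * (\<epsilon> / 4)"
      using eps by (intro mult_right_mono) auto
    then show "real (i div 2) * \<epsilon> / 2 \<le> real n * (\<epsilon> / 4)" by simp
  qed (use eps in auto)
  also have "\<dots> \<le> cos_mean n \<epsilon> + 2 * (ln (2 * cos 0) - ln (2 * cos (real n * (\<epsilon> / 4))))"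
    unfolding cos_mean_def by (rule c.sum_pred_le_mean)
  also have "\<dots> = cos_mean n \<epsilon> - 2 * ln (cos (real n * \<epsilon> / 4))"
    using half_arc_bounds(3)[OF n eps short] by (simp add: ln_mult)
  finally show ?thesis .
qed

lemma centred_cos_pos: "j \<le> n \<Longrightarrow> cos ((real j - real n / 2) * \<epsilon> / 2) \<ge> cos (real n * \<epsilon> / 4)"
proof -
  assume j: "j \<le> n"
  have "\<bar>(real j - real n / 2) * \<epsilon> / 2\<bar> = \<bar>real j - real n / 2\<bar> * (\<epsilon> / 2)"
    using eps by (simp add: abs_mult)
  also have "\<dots> \<le> real n / 2 * (\<epsilon> / 2)"
  proof (intro mult_right_mono)
    have "real j \<le> real n" using j by simp
    then show "\<bar>real j - real n / 2\<bar> \<le> real n / 2" unfolding abs_le_iff by linarith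
  qed (use eps in simp)
  also have "\<dots> = real n * \<epsilon> / 4" by simp
  finally have "cos (real n * \<epsilon> / 4) \<le> cos \<bar>(real j - real n / 2) * \<epsilon> / 2\<bar>"
    using half_arc_bounds[OF n eps short] by (intro cos_monotone_0_pi_le) linarith+
  then show ?thesis by (simp only: cos_abs_real)
qed

lemma centred_cos_prod_pos: "centred_cos_prod n \<epsilon> > 0"
  unfolding centred_cos_prod_def
  using centred_cos_pos half_arc_bounds(3)[OF n eps short] by (intro prod_pos) (auto intro: less_le_trans)

lemma ln_centred_cos_prod_ge:
  "cos_mean n \<epsilon> + 2 * ln (cos (real n * \<epsilon> / 4)) \<le> ln (centred_cos_prod n \<epsilon>)"
proof -
  interpret c: antitone_riemann "\<lambda>x. ln (2 * cos x)" "\<epsilon> / 4" n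
    by (rule cos_riemann[OF n eps short])
  define f where "f = (\<lambda>x. ln (2 * cos (x * (\<epsilon> / 2))))"
  have "cos_mean n \<epsilon> + 2 * ln (cos (real n * \<epsilon> / 4))
      \<le> cos_mean n \<epsilon> - (ln (2 * cos 0) - ln (2 * cos (real n * (\<epsilon> / 4))))
          + ln (2 * cos (real n * (\<epsilon> / 4)))"
    using half_arc_bounds(3)[OF n eps short] by (simp add: ln_mult)
  also have "\<dots> \<le> (\<Sum>i<n. ln (2 * cos (real (i + 1) * (\<epsilon> / 4)))) + ln (2 * cos (real n * (\<epsilon> / 4)))"
    using c.mean_le_sum_right by (simp add: cos_mean_def)
  also have "\<dots> = (\<Sum>i<n. f (real (i + 1) / 2)) + f (real n / 2)" by (simp add: f_def)
  also have "\<dots> \<le> (\<Sum>j\<le>n. f \<bar>real j - real n / 2\<bar>)"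
  proof (rule centred_sum_ge)
    fix x y assume xy: "0 \<le> x" "x \<le> y" "y \<le> real n / 2"
    have "y * (\<epsilon> / 2) \<le> real n / 2 * (\<epsilon> / 2)" "x * (\<epsilon> / 2) \<le> y * (\<epsilon> / 2)"
      using xy eps by (intro mult_right_mono; simp)+
    then show "f y \<le> f x" unfolding f_def using xy eps by (intro c.antitone) auto
  qed
  also have "\<dots> = ln (centred_cos_prod n \<epsilon>)"
  proof -
    have "f \<bar>real j - real n / 2\<bar> = ln (2 * cos ((real j - real n / 2) * \<epsilon> / 2))" for j
    proof -
      have "\<bar>real j - real n / 2\<bar> * (\<epsilon> / 2) = \<bar>(real j - real n / 2) * \<epsilon> / 2\<bar>"
        using eps by (simp add: abs_mult)
      then show ?thesis unfolding f_def by (simp only: cos_abs_real)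
    qed
    moreover have "ln (centred_cos_prod n \<epsilon>) = (\<Sum>j\<le>n. ln (2 * cos ((real j - real n / 2) * \<epsilon> / 2)))"
      unfolding centred_cos_prod_def
      using less_le_trans[OF half_arc_bounds(3)[OF n eps short] centred_cos_pos]
      by (intro ln_prod) force+
    ultimately show ?thesis by simp
  qed
  finally show ?thesis .
qed

lemma paired_sin_arg: "i < n \<Longrightarrow> real (i div 2 + 1) * \<epsilon> / 2 \<in> {real (i + 1) * (\<epsilon> / 4)..real (i + 2) * (\<epsilon> / 4)}"
  "i < n \<Longrightarrow> real (i + 2) * (\<epsilon> / 4) \<le> pi / 2"
proof -
  assume i: "i < n"
  have "real (i + 1) \<le> real (2 * (i div 2 + 1))" "real (2 * (i div 2 + 1)) \<le> real (i + 2)"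
    by (intro of_nat_mono, presburger)+
  then have "real (i + 1) \<le> 2 * real (i div 2 + 1)" "2 * real (i div 2 + 1) \<le> real (i + 2)"
    by (simp_all only: of_nat_mult of_nat_numeral)
  then have "real (i + 1) * (\<epsilon> / 4) \<le> 2 * real (i div 2 + 1) * (\<epsilon> / 4)"
    "2 * real (i div 2 + 1) * (\<epsilon> / 4) \<le> real (i + 2) * (\<epsilon> / 4)"
    using eps by (intro mult_right_mono; simp)+
  then show "real (i div 2 + 1) * \<epsilon> / 2 \<in> {real (i + 1) * (\<epsilon> / 4)..real (i + 2) * (\<epsilon> / 4)}"
    by (simp add: algebra_simps)
  have "real (i + 2) * (\<epsilon> / 4) \<le> (real n + 1) * (\<epsilon> / 4)"
    using eps i by (intro mult_right_mono) auto
  then show "real (i + 2) * (\<epsilon> / 4) \<le> pi / 2" using short by (simp add: mult.commute)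
qed

lemma paired_sin_pos: "i < n \<Longrightarrow> 2 * sin (real (i div 2 + 1) * \<epsilon> / 2) > 0"
proof -
  assume i: "i < n"
  have "real (i div 2 + 1) * \<epsilon> / 2 > 0" using eps by simp
  moreover have "real (i div 2 + 1) * \<epsilon> / 2 \<le> pi / 2"
    using paired_sin_arg[OF i] unfolding atLeastAtMost_iff by linarith
  ultimately have "sin (real (i div 2 + 1) * \<epsilon> / 2) > 0"
    using pi_gt_zero by (intro sin_gt_zero) linarith+
  then show ?thesis by simp
qed

lemma paired_sin_prod_pos: "paired_sin_prod n \<epsilon> > 0"
  unfolding paired_sin_prod_def using paired_sin_pos by (intro prod_pos) auto

text \<open>
  Splitting \<open>ln (2 sin x) = ln (2x) + ln (sin x / x)\<close> leaves a sum of logarithms of integers, which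
  is Stirling's formula, and a Riemann sum of a function with values in \<open>[-1, 0]\<close>.
\<close>
lemma ln_paired_sin_prod:
  "\<bar>ln (paired_sin_prod n \<epsilon>)
     - (real n * (ln (real n * \<epsilon> / 2) - 1) + ln (real n) + sinc_mean n \<epsilon>)\<bar> \<le> 6"
proof -
  interpret s: antitone_riemann ln_sinc "\<epsilon> / 4" n by (rule sinc_riemann[OF n eps short])
  define S where "S = (\<Sum>i<n. ln_sinc (real (i div 2 + 1) * \<epsilon> / 2))"
  have "ln (paired_sin_prod n \<epsilon>) = (\<Sum>i<n. ln (2 * sin (real (i div 2 + 1) * \<epsilon> / 2)))"
    unfolding paired_sin_prod_def
    by (intro ln_prod finite_lessThan less_imp_neq[OF paired_sin_pos, symmetric]) simp
  also have "\<dots> = (\<Sum>i<n. ln \<epsilon> + ln (real (i div 2 + 1)) + ln_sinc (real (i div 2 + 1) * \<epsilon> / 2))"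
  proof (intro sum.cong refl)
    fix i assume i: "i \<in> {..<n}"
    define a where "a = real (i div 2 + 1)"
    have "a > 0" by (simp add: a_def)
    moreover have "sin (a * \<epsilon> / 2) > 0" using paired_sin_pos[of i] i by (simp add: a_def)
    ultimately have "ln (2 * sin (a * \<epsilon> / 2)) = ln \<epsilon> + ln a + ln_sinc (a * \<epsilon> / 2)"
      unfolding ln_sinc_def using eps by (subst ln_div) (auto simp: ln_mult ln_div)
    then show "ln (2 * sin (real (i div 2 + 1) * \<epsilon> / 2))
        = ln \<epsilon> + ln (real (i div 2 + 1)) + ln_sinc (real (i div 2 + 1) * \<epsilon> / 2)"
      by (simp only: a_def)
  qed
  also have "\<dots> = real n * ln \<epsilon> + (\<Sum>i<n. ln (real (i div 2 + 1))) + S"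
    by (simp add: sum.distrib S_def)
  finally have eq: "ln (paired_sin_prod n \<epsilon>)
      = real n * ln \<epsilon> + (\<Sum>i<n. ln (real (i div 2 + 1))) + S" .
  have scale: "real n * ln \<epsilon> + real n * (ln (real n / 2) - 1) = real n * (ln (real n * \<epsilon> / 2) - 1)"
    using n eps by (simp add: ln_mult ln_div algebra_simps)
  have S_le: "S \<le> sinc_mean n \<epsilon>"
  proof -
    have "S \<le> (\<Sum>i<n. ln_sinc (real (i + 1) * (\<epsilon> / 4)))"
      unfolding S_def
    proof (intro sum_mono ln_sinc_antitone)
      fix i assume "i \<in> {..<n}"
      then show "real (i + 1) * (\<epsilon> / 4) \<le> real (i div 2 + 1) * \<epsilon> / 2"
        "real (i div 2 + 1) * \<epsilon> / 2 \<le> pi / 2"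
        using paired_sin_arg[of i] unfolding atLeastAtMost_iff lessThan_iff by linarith+
    qed (use eps in auto)
    also have "\<dots> \<le> sinc_mean n \<epsilon>" unfolding sinc_mean_def by (rule s.sum_right_le_mean)
    finally show ?thesis .
  qed
  have S_ge: "S \<ge> sinc_mean n \<epsilon> - 2"
  proof -
    define g where "g = (\<lambda>i. ln_sinc (real i * (\<epsilon> / 4)))"
    have "sinc_mean n \<epsilon> \<le> (\<Sum>i<n. g i)"
      unfolding sinc_mean_def g_def by (rule s.mean_le_sum_left)
    also have "\<dots> = (\<Sum>i<n. g (i + 2)) + (g 0 + g 1 - g n - g (n + 1))"
      using sum_diff_two_steps[of g n] by (simp add: sum_subtractf)
    also have "(\<Sum>i<n. g (i + 2)) \<le> S"
      unfolding S_def g_def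
    proof (intro sum_mono ln_sinc_antitone)
      fix i assume "i \<in> {..<n}"
      then show "real (i div 2 + 1) * \<epsilon> / 2 \<le> real (i + 2) * (\<epsilon> / 4)"
        "real (i + 2) * (\<epsilon> / 4) \<le> pi / 2"
        using paired_sin_arg[of i] by auto
    qed (use eps in auto)
    also have "g 0 + g 1 - g n - g (n + 1) \<le> 2"
    proof -
      have "g i \<in> {-1..0}" if "i \<le> n + 1" for i
      proof -
        have "real i * (\<epsilon> / 4) \<le> real (n + 1) * (\<epsilon> / 4)"
          using eps that by (intro mult_right_mono) auto
        also have "\<dots> \<le> pi / 2" using short by (simp add: algebra_simps)
        finally show ?thesis unfolding g_def using eps by (intro ln_sinc_bounds) simp
      qed
      from this[of 0] this[of 1] this[of n] this[of "n + 1"] show ?thesis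
        unfolding atLeastAtMost_iff by linarith
    qed
    finally show ?thesis by simp
  qed
  have "\<bar>L + G + S - (A + l + s)\<bar> \<le> 6"
    if "L + B = A" "S \<le> s" "S \<ge> s - 2" "\<bar>G - (B + l)\<bar> \<le> 4" for L G S A l s B :: real
    using that unfolding abs_le_iff by linarith
  from this[OF scale S_le S_ge sum_ln_halves_bounds[OF n]] show ?thesis unfolding eq .
qed

lemma ln_paired_ratio_le:
  "ln (paired_cos_prod n \<epsilon> / paired_sin_prod n \<epsilon>)
     \<le> real n * main_term n \<epsilon> - ln (real n) + 6 - 2 * ln (cos (real n * \<epsilon> / 4))"
proof -
  have "P - L \<le> m - l + 6 - 2 * k"
    if "P \<le> c - 2 * k" "\<bar>L - (A + l + s)\<bar> \<le> 6" "m = c - A - s" for P L m l k c A s :: real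
    using that unfolding abs_le_iff by linarith
  from this[OF ln_paired_cos_prod_le ln_paired_sin_prod main_term_eq_means[OF n eps short]]
  show ?thesis unfolding ln_divide_pos[OF paired_cos_prod_pos paired_sin_prod_pos] .
qed

lemma ln_centred_ratio_ge:
  "real n * main_term n \<epsilon> - ln (real n) - 6 + 2 * ln (cos (real n * \<epsilon> / 4))
     \<le> ln (centred_cos_prod n \<epsilon> / paired_sin_prod n \<epsilon>)"
proof -
  have "m - l - 6 + 2 * k \<le> P - L"
    if "c + 2 * k \<le> P" "\<bar>L - (A + l + s)\<bar> \<le> 6" "m = c - A - s" for P L m l k c A s :: real
    using that unfolding abs_le_iff by linarith
  from this[OF ln_centred_cos_prod_ge ln_paired_sin_prod main_term_eq_means[OF n eps short]]
  show ?thesis unfolding ln_divide_pos[OF centred_cos_prod_pos paired_sin_prod_pos] .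
qed

text \<open>
  \<open>cos (n\<epsilon>/4)\<close> is the sine of a quarter of \<open>2\<pi> - n\<epsilon>\<close>, so it is of the same order. The factor
  \<open>n\<epsilon>\<close> under the logarithm on the right is harmless because it is at most \<open>2\<pi>\<close>.
\<close>
lemma minus_ln_cos_le:
  "- ln (cos (real n * \<epsilon> / 4)) \<le> 14 + \<bar>ln (real n * \<epsilon> * (2 * pi - real n * \<epsilon>))\<bar>"
proof -
  define a where "a = real n * \<epsilon>"
  have a: "0 < a" "a < 2 * pi"
    using n eps short by (simp_all add: a_def algebra_simps)
  have "2 / pi * (pi / 2 - a / 4) \<le> sin (pi / 2 - a / 4)"
    using a by (intro sin_ge_linear; simp)
  then have "(2 * pi - a) / (2 * pi) \<le> cos (a / 4)"
    unfolding cos_sin_eq[of "a / 4"] by (simp add: field_simps)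
  then have "ln ((2 * pi - a) / (2 * pi)) \<le> ln (cos (a / 4))"
    using a by (subst ln_le_cancel_iff) (auto intro!: divide_pos_pos cos_gt_zero_pi)
  then have "- ln (cos (a / 4)) \<le> ln (2 * pi) - ln (2 * pi - a)"
    using a by (simp add: ln_div)
  also have "\<dots> = ln (2 * pi) + ln a - ln (a * (2 * pi - a))"
    using a by (simp add: ln_mult)
  finally have "- ln (cos (a / 4)) \<le> ln (2 * pi) + ln a - ln (a * (2 * pi - a))" .
  moreover have "ln a \<le> ln (2 * pi)" using a by simp
  moreover have "ln (2 * pi) \<le> 2 * pi - 1" by (rule ln_le_minus_one) simp
  moreover have "- ln (a * (2 * pi - a)) \<le> \<bar>ln (a * (2 * pi - a))\<bar>" by simp
  ultimately have "- ln (cos (a / 4)) \<le> 14 + \<bar>ln (a * (2 * pi - a))\<bar>"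
    using pi_less_4 by linarith
  then show ?thesis unfolding a_def .
qed

end

section \<open>Packing separated points on the circle\<close>

lemma separated_max_ge:
  fixes t :: "'a \<Rightarrow> real"
  assumes "card J = Suc m"
    and "\<And>i j. i \<in> J \<Longrightarrow> j \<in> J \<Longrightarrow> i \<noteq> j \<Longrightarrow> \<epsilon> \<le> \<bar>t i - t j\<bar>"
    and "\<And>j. j \<in> J \<Longrightarrow> a \<le> t j"
  shows "\<exists>j\<in>J. a + real m * \<epsilon> \<le> t j"
  using assms
proof (induction m arbitrary: J)
  case 0
  then show ?case by (auto simp: card_Suc_eq)
next
  case (Suc m)
  have fin: "finite J" "J \<noteq> {}" using Suc.prems(1) card.infinite by fastforce+
  have "Max (t ` J) \<in> t ` J" using fin by simp
  then obtain j where j: "j \<in> J" "t j = Max (t ` J)" by auto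
  have max: "t i \<le> t j" if "i \<in> J" for i using that fin j by simp
  have "\<exists>i\<in>J - {j}. a + real m * \<epsilon> \<le> t i"
    by (rule Suc.IH) (use Suc.prems j fin in auto)
  then obtain i where i: "i \<in> J" "i \<noteq> j" "a + real m * \<epsilon> \<le> t i" by blast
  have "\<epsilon> \<le> \<bar>t j - t i\<bar>" using Suc.prems(2)[of j i] i j by simp
  then have "t i + \<epsilon> \<le> t j" using max[OF i(1)] by simp
  then have "a + real (Suc m) * \<epsilon> \<le> t j" using i(3) by (simp add: algebra_simps)
  then show ?case using j by blast
qed

text \<open>One of the two sides of \<open>0\<close> contains at least half of the points.\<close>
lemma separated_max_abs_ge:
  fixes t :: "'a \<Rightarrow> real"
  assumes "card J = Suc m" "\<epsilon> \<ge> 0"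
    and sep: "\<And>i j. i \<in> J \<Longrightarrow> j \<in> J \<Longrightarrow> i \<noteq> j \<Longrightarrow> \<epsilon> \<le> \<bar>t i - t j\<bar>"
    and far: "\<And>j. j \<in> J \<Longrightarrow> a \<le> \<bar>t j\<bar>"
  shows "\<exists>j\<in>J. a + real (m div 2) * \<epsilon> \<le> \<bar>t j\<bar>"
proof -
  define P where "P = {j \<in> J. t j \<ge> 0}"
  define N where "N = {j \<in> J. t j < 0}"
  have fin: "finite J" using assms(1) card.infinite by fastforce
  have "J = P \<union> N" "P \<inter> N = {}" by (auto simp: P_def N_def)
  then have "card P + card N = Suc m"
    using assms(1) fin by (metis card_Un_disjoint finite_Un)
  then consider "card P \<ge> Suc (m div 2)" | "card N \<ge> Suc (m div 2)" by linarith
  then show ?thesis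
  proof cases
    case 1
    then obtain k where k: "card P = Suc k" "m div 2 \<le> k" by (metis Suc_le_D Suc_le_mono)
    have "\<exists>j\<in>P. a + real k * \<epsilon> \<le> t j"
      by (rule separated_max_ge[OF k(1)]) (use sep far in \<open>force simp: P_def\<close>)+
    moreover have "real (m div 2) * \<epsilon> \<le> real k * \<epsilon>"
      using k(2) assms(2) by (intro mult_right_mono) auto
    ultimately show ?thesis unfolding P_def by force
  next
    case 2
    then obtain k where k: "card N = Suc k" "m div 2 \<le> k" by (metis Suc_le_D Suc_le_mono)
    have "\<exists>j\<in>N. a + real k * \<epsilon> \<le> - t j"
    proof (rule separated_max_ge[OF k(1)])
      fix i j assume "i \<in> N" "j \<in> N" "i \<noteq> j"
      then show "\<epsilon> \<le> \<bar>- t i - - t j\<bar>" using sep[of j i] by (auto simp: N_def)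
    next
      fix j assume "j \<in> N"
      then show "a \<le> - t j" using far[of j] by (auto simp: N_def)
    qed
    moreover have "real (m div 2) * \<epsilon> \<le> real k * \<epsilon>"
      using k(2) assms(2) by (intro mult_right_mono) auto
    ultimately show ?thesis unfolding N_def by force
  qed
qed

text \<open>
  Removing a point of large modulus repeatedly lists the points so that the \<open>i\<close>-th is at least as far
  from \<open>0\<close> as in the packing that alternates between the two sides. Monotone functions of the
  modulus can then be compared factor by factor.
\<close>
lemma packed_enumeration:
  fixes t :: "'a \<Rightarrow> real"
  assumes "finite J" "card J = n" "\<epsilon> \<ge> 0"
    and "\<And>i j. i \<in> J \<Longrightarrow> j \<in> J \<Longrightarrow> i \<noteq> j \<Longrightarrow> \<epsilon> \<le> \<bar>t i - t j\<bar>"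
    and "\<And>j. j \<in> J \<Longrightarrow> a \<le> \<bar>t j\<bar>"
  shows "\<exists>\<sigma>. bij_betw \<sigma> {..<n} J \<and> (\<forall>i<n. a + real (i div 2) * \<epsilon> \<le> \<bar>t (\<sigma> i)\<bar>)"
  using assms
proof (induction n arbitrary: J)
  case 0
  then show ?case by (auto simp: bij_betw_def)
next
  case (Suc m)
  obtain j where j: "j \<in> J" "a + real (m div 2) * \<epsilon> \<le> \<bar>t j\<bar>"
    using separated_max_abs_ge[of J m \<epsilon> t a] Suc.prems by blast
  have "\<exists>\<sigma>. bij_betw \<sigma> {..<m} (J - {j}) \<and> (\<forall>i<m. a + real (i div 2) * \<epsilon> \<le> \<bar>t (\<sigma> i)\<bar>)"
    by (rule Suc.IH) (use Suc.prems j in auto)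
  then obtain \<sigma> where s: "bij_betw \<sigma> {..<m} (J - {j})"
    "\<And>i. i < m \<Longrightarrow> a + real (i div 2) * \<epsilon> \<le> \<bar>t (\<sigma> i)\<bar>" by blast
  have "bij_betw (\<sigma>(m := j)) {..<m} (J - {j})"
    using s(1) by (rule bij_betw_cong[THEN iffD1, rotated]) simp
  moreover have "bij_betw (\<sigma>(m := j)) {m} {j}" by (simp add: bij_betw_def)
  ultimately have "bij_betw (\<sigma>(m := j)) ({..<m} \<union> {m}) ((J - {j}) \<union> {j})"
    by (rule bij_betw_combine) auto
  moreover have "{..<m} \<union> {m} = {..<Suc m}" "(J - {j}) \<union> {j} = J" using j by auto
  ultimately have "bij_betw (\<sigma>(m := j)) {..<Suc m} J" by simp
  moreover have "\<forall>i<Suc m. a + real (i div 2) * \<epsilon> \<le> \<bar>t ((\<sigma>(m := j)) i)\<bar>"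
    using s(2) j(2) by (auto simp: less_Suc_eq)
  ultimately show ?case by blast
qed

lemma abs_Arg_cis_le: "\<bar>Arg (cis x)\<bar> \<le> \<bar>x\<bar>"
proof (cases "\<bar>x\<bar> < pi")
  case True
  then have "Arg (cis x) = x" by (intro Arg_cis) auto
  then show ?thesis by simp
next
  case False
  then show ?thesis using Arg_bounded[of "cis x"] by (auto simp: abs_le_iff)
qed

lemma unit_eq_cis_Arg: "cmod z = 1 \<Longrightarrow> cis (Arg z) = z"
  by (cases "z = 0") (auto simp: cis_Arg sgn_eq)

lemma arc_dist_le_angle_diff:
  assumes "cmod u = 1" "z = u * cis x" "w = u * cis y"
  shows "arc_dist z w \<le> \<bar>x - y\<bar>"
proof -
  have "z / w = cis (x - y)" using assms by (auto simp: cis_divide[symmetric])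
  then show ?thesis using abs_Arg_cis_le by (simp add: arc_dist_def)
qed

lemma cmod_cis_minus_one: "cmod (cis x - 1) = 2 * \<bar>sin (x / 2)\<bar>"
proof -
  have "cis x - 1 = cis (x / 2) * (cis (x / 2) - cis (- (x / 2)))"
    by (simp add: algebra_simps cis_mult)
  also have "cis (x / 2) - cis (- (x / 2)) = complex_of_real (2 * sin (x / 2)) * \<i>"
    by (simp add: complex_eq_iff)
  finally show ?thesis by (simp add: norm_mult)
qed

lemma cmod_cis_plus_one: "cmod (cis x + 1) = 2 * \<bar>cos (x / 2)\<bar>"
proof -
  have "cis x + 1 = cis (x / 2) * (cis (x / 2) + cis (- (x / 2)))"
    by (simp add: algebra_simps cis_mult)
  also have "cis (x / 2) + cis (- (x / 2)) = complex_of_real (2 * cos (x / 2))"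
    by (simp add: complex_eq_iff)
  finally show ?thesis by (simp add: norm_mult)
qed

context
  fixes J :: "'a set" and z :: "'a \<Rightarrow> complex" and \<epsilon> :: real and n :: nat
  assumes J: "finite J" "card J = n" and eps: "\<epsilon> > 0"
    and unit: "\<And>j. j \<in> J \<Longrightarrow> cmod (z j) = 1"
    and sep: "\<And>i j. i \<in> J \<Longrightarrow> j \<in> J \<Longrightarrow> i \<noteq> j \<Longrightarrow> \<epsilon> \<le> arc_dist (z i) (z j)"
begin

text \<open>Angles are measured from an arbitrary base point \<open>u\<close>; an arc is never longer than the
  difference of the angles of its ends.\<close>
lemma angles_separated:
  assumes "cmod u = 1" "i \<in> J" "j \<in> J" "i \<noteq> j"
  shows "\<epsilon> \<le> \<bar>Arg (z i / u) - Arg (z j / u)\<bar>"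
proof -
  have "u * cis (Arg (z k / u)) = z k" if "k \<in> J" for k
    using unit_eq_cis_Arg[of "z k / u"] unit[OF that] assms(1) by (auto simp: norm_divide)
  then have "arc_dist (z i) (z j) \<le> \<bar>Arg (z i / u) - Arg (z j / u)\<bar>"
    using assms by (intro arc_dist_le_angle_diff[of u]) auto
  then show ?thesis using sep assms by fastforce
qed

lemma paired_sin_prod_le:
  assumes w: "cmod w = 1" and far: "\<And>j. j \<in> J \<Longrightarrow> \<epsilon> \<le> arc_dist (z j) w"
  shows "paired_sin_prod n \<epsilon> \<le> (\<Prod>j\<in>J. cmod (w - z j))"
proof -
  define t where "t = (\<lambda>j. Arg (z j / w))"
  obtain \<sigma> where s: "bij_betw \<sigma> {..<n} J"
    "\<And>i. i < n \<Longrightarrow> \<epsilon> + real (i div 2) * \<epsilon> \<le> \<bar>t (\<sigma> i)\<bar>"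
    using packed_enumeration[OF J, of \<epsilon> t \<epsilon>] eps angles_separated[OF w] far
    unfolding t_def arc_dist_def by (metis less_imp_le)
  have "paired_sin_prod n \<epsilon> \<le> (\<Prod>i<n. cmod (w - z (\<sigma> i)))"
    unfolding paired_sin_prod_def
  proof (intro prod_mono conjI)
    fix i assume "i \<in> {..<n}"
    then have i: "i < n" and "\<sigma> i \<in> J" using s(1) by (auto simp: bij_betw_def)
    define x where "x = t (\<sigma> i)"
    have x: "\<bar>x\<bar> \<le> pi" using Arg_bounded[of "z (\<sigma> i) / w"] by (auto simp: x_def t_def abs_le_iff)
    have "w * cis x = z (\<sigma> i)"
      using unit_eq_cis_Arg[of "z (\<sigma> i) / w"] unit[OF \<open>\<sigma> i \<in> J\<close>] w by (auto simp: norm_divide x_def t_def)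
    then have "cmod (w - z (\<sigma> i)) = cmod (w * (cis x - 1))"
      by (metis mult.right_neutral norm_minus_commute right_diff_distrib)
    also have "\<dots> = 2 * \<bar>sin (x / 2)\<bar>" using w by (simp add: norm_mult cmod_cis_minus_one)
    also have "\<bar>sin (x / 2)\<bar> = sin (\<bar>x\<bar> / 2)"
    proof -
      have "\<bar>sin (x / 2)\<bar> = \<bar>sin (\<bar>x\<bar> / 2)\<bar>" by (cases "x \<ge> 0") auto
      also have "\<dots> = sin (\<bar>x\<bar> / 2)" using x by (intro abs_of_nonneg sin_ge_zero) auto
      finally show ?thesis .
    qed
    finally have eq: "cmod (w - z (\<sigma> i)) = 2 * sin (\<bar>x\<bar> / 2)" .
    have low: "real (i div 2 + 1) * \<epsilon> / 2 \<le> \<bar>x\<bar> / 2"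
      using s(2)[OF i] by (simp add: x_def algebra_simps)
    have pos: "real (i div 2 + 1) * \<epsilon> / 2 \<ge> 0" using eps by simp
    show "0 \<le> 2 * sin (real (i div 2 + 1) * \<epsilon> / 2)"
      using low pos x by (intro mult_nonneg_nonneg sin_ge_zero) linarith+
    show "2 * sin (real (i div 2 + 1) * \<epsilon> / 2) \<le> cmod (w - z (\<sigma> i))"
      unfolding eq using low pos x by (intro mult_left_mono sin_monotone_2pi_le) linarith+
  qed
  also have "\<dots> = (\<Prod>j\<in>J. cmod (w - z j))" by (rule prod.reindex_bij_betw[OF s(1)])
  finally show ?thesis .
qed

text \<open>
  Measured from the antipode of \<open>w\<close>, the distance to a node is \<open>2 cos\<close> of half its angle. A node may
  lie at the antipode itself, so here the packing starts at angle \<open>0\<close>.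
\<close>
lemma prod_dist_le_paired_cos_prod:
  assumes w: "cmod w = 1"
  shows "(\<Prod>j\<in>J. cmod (w - z j)) \<le> paired_cos_prod n \<epsilon>"
proof -
  define t where "t = (\<lambda>j. Arg (z j / - w))"
  have w': "cmod (- w) = 1" using w by simp
  obtain \<sigma> where s: "bij_betw \<sigma> {..<n} J"
    "\<And>i. i < n \<Longrightarrow> 0 + real (i div 2) * \<epsilon> \<le> \<bar>t (\<sigma> i)\<bar>"
    using packed_enumeration[OF J, of \<epsilon> t 0] eps angles_separated[OF w']
    unfolding t_def by (metis abs_ge_zero less_imp_le)
  have "(\<Prod>j\<in>J. cmod (w - z j)) = (\<Prod>i<n. cmod (w - z (\<sigma> i)))"
    by (rule prod.reindex_bij_betw[OF s(1), symmetric])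
  also have "\<dots> \<le> paired_cos_prod n \<epsilon>"
    unfolding paired_cos_prod_def
  proof (intro prod_mono conjI)
    fix i assume "i \<in> {..<n}"
    then have i: "i < n" and "\<sigma> i \<in> J" using s(1) by (auto simp: bij_betw_def)
    define x where "x = t (\<sigma> i)"
    have x: "\<bar>x\<bar> \<le> pi" using Arg_bounded[of "z (\<sigma> i) / - w"] by (auto simp: x_def t_def abs_le_iff)
    have "- w * cis x = z (\<sigma> i)"
      using unit_eq_cis_Arg[of "z (\<sigma> i) / - w"] unit[OF \<open>\<sigma> i \<in> J\<close>] w by (auto simp: norm_divide x_def t_def)
    then have "w - z (\<sigma> i) = w - (- w * cis x)" by simp
    also have "\<dots> = w * (cis x + 1)" by (simp add: algebra_simps)
    finally have "w - z (\<sigma> i) = w * (cis x + 1)" .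
    then have "cmod (w - z (\<sigma> i)) = 2 * \<bar>cos (x / 2)\<bar>"
      using w by (simp add: norm_mult cmod_cis_plus_one)
    also have "\<bar>cos (x / 2)\<bar> = cos (\<bar>x\<bar> / 2)"
    proof -
      have "\<bar>cos (x / 2)\<bar> = \<bar>cos (\<bar>x\<bar> / 2)\<bar>" by (cases "x \<ge> 0") auto
      also have "\<dots> = cos (\<bar>x\<bar> / 2)" using x by (intro abs_of_nonneg cos_ge_zero) linarith+
      finally show ?thesis .
    qed
    finally have eq: "cmod (w - z (\<sigma> i)) = 2 * cos (\<bar>x\<bar> / 2)" .
    have low: "real (i div 2) * \<epsilon> / 2 \<le> \<bar>x\<bar> / 2"
      using s(2)[OF i] by (simp add: x_def)
    have pos: "real (i div 2) * \<epsilon> / 2 \<ge> 0" using eps by simp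
    show "cmod (w - z (\<sigma> i)) \<le> 2 * cos (real (i div 2) * \<epsilon> / 2)"
      unfolding eq using low pos x pi_gt_zero by (intro mult_left_mono cos_monotone_0_pi_le) linarith+
  qed simp
  finally show ?thesis .
qed

end

text \<open>
  Read off angles in \<open>[0, 2\<pi>)\<close> from the first node: the last one has angle at least \<open>n\<epsilon>\<close>, and it
  is still \<open>\<epsilon>\<close> away from the first node on the other side.
\<close>
lemma separated_nodes_fit:
  assumes n: "n \<ge> 1" and eps: "\<epsilon> > 0"
    and unit: "\<And>j. j \<le> n \<Longrightarrow> cmod (z j) = 1"
    and sep: "\<And>i j. i \<le> n \<Longrightarrow> j \<le> n \<Longrightarrow> i \<noteq> j \<Longrightarrow> \<epsilon> \<le> arc_dist (z i) (z j)"
  shows "(real n + 1) * \<epsilon> \<le> 2 * pi"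
proof -
  define t where "t = (\<lambda>j. Arg2pi (z j / z 0))"
  have z: "z 0 * cis (t j) = z j" if "j \<le> n" for j
  proof -
    have "cmod (z j / z 0) = 1" using unit[OF that] unit[of 0] by (simp add: norm_divide)
    then have "z j / z 0 = cis (t j)"
      using Arg2pi_eq[of "z j / z 0"] by (simp add: t_def cis_conv_exp)
    moreover have "z 0 \<noteq> 0" using unit[of 0] by auto
    ultimately show ?thesis by (simp add: field_simps)
  qed
  have "\<exists>j\<in>{..n}. 0 + real n * \<epsilon> \<le> t j"
  proof (rule separated_max_ge)
    fix i j assume ij: "i \<in> {..n}" "j \<in> {..n}" "i \<noteq> j"
    then have "arc_dist (z i) (z j) \<le> \<bar>t i - t j\<bar>"
      using z unit by (intro arc_dist_le_angle_diff[of "z 0"]) auto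
    then show "\<epsilon> \<le> \<bar>t i - t j\<bar>" using sep[of i j] ij by auto
  qed (auto simp: t_def Arg2pi_ge_0)
  then obtain j where j: "j \<le> n" "real n * \<epsilon> \<le> t j" by auto
  have "real n * \<epsilon> > 0" using n eps by simp
  moreover have "t 0 = 0"
  proof -
    have "z 0 / z 0 = 1" using unit[of 0] by (intro divide_self) auto
    then show ?thesis by (simp add: t_def Arg2pi_eq_0)
  qed
  ultimately have "j \<noteq> 0" using j by (metis leD)
  have "cis (t j - 2 * pi) = cis (t j)" by (simp add: cis_divide[symmetric])
  then have "arc_dist (z j) (z 0) \<le> \<bar>(t j - 2 * pi) - 0\<bar>"
    using z[OF j(1)] unit[of 0] by (intro arc_dist_le_angle_diff[of "z 0"]) auto
  moreover have "t j < 2 * pi" by (simp add: t_def Arg2pi_lt_2pi)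
  ultimately have "\<epsilon> \<le> 2 * pi - t j" using sep[of j 0] j \<open>j \<noteq> 0\<close> by auto
  then show ?thesis using j by (simp add: algebra_simps)
qed

section \<open>Parseval's identity for polynomials\<close>

lemma has_integral_cis_int:
  fixes m :: int and a :: real
  shows "((\<lambda>\<theta>. cis (of_int m * \<theta>)) has_integral (if m = 0 then of_real (2 * pi) else 0)) {a..a + 2 * pi}"
proof (cases "m = 0")
  case True
  have "((\<lambda>_. 1 :: complex) has_integral of_real (2 * pi)) {a..a + 2 * pi}"
    using has_integral_const_real[of "1::complex" a "a + 2 * pi"] by (simp add: scaleR_conv_of_real)
  then show ?thesis using True by simp
next
  case False
  define F where "F = (\<lambda>\<theta>. cis (of_int m * \<theta>) / (\<i> * of_int m))"
  have "((\<lambda>\<theta>. cis (of_int m * \<theta>)) has_integral F (a + 2 * pi) - F a) {a..a + 2 * pi}"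
  proof (rule fundamental_theorem_of_calculus)
    fix x assume "x \<in> {a..a + 2 * pi}"
    have "((\<lambda>\<theta>. cis (of_int m * \<theta>)) has_vector_derivative of_int m *\<^sub>R (\<i> * cis (of_int m * x)))
        (at x within {a..a + 2 * pi})"
      unfolding has_vector_derivative_def
      by (rule has_derivative_eq_rhs, rule derivative_intros, (rule derivative_intros)+)
        (auto simp: fun_eq_iff scaleR_conv_of_real)
    then have "(F has_vector_derivative of_int m *\<^sub>R (\<i> * cis (of_int m * x)) / (\<i> * of_int m))
        (at x within {a..a + 2 * pi})"
      unfolding F_def by (rule has_vector_derivative_divide)
    then show "(F has_vector_derivative cis (of_int m * x)) (at x within {a..a + 2 * pi})"
      using False by (simp add: scaleR_conv_of_real)
  qed simp
  moreover have "F (a + 2 * pi) = F a"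
  proof -
    have "cis (of_int m * (a + 2 * pi)) = cis (of_int m * a) * cis (2 * pi * of_int m)"
      by (simp add: cis_mult algebra_simps)
    also have "cis (2 * pi * of_int m) = 1" by (simp add: cis_multiple_2pi)
    finally show ?thesis by (simp add: F_def)
  qed
  ultimately show ?thesis using False by simp
qed

lemma poly_eq_sum_le:
  fixes p :: "'a::comm_semiring_1 poly"
  assumes "degree p \<le> n"
  shows "poly p x = (\<Sum>j\<le>n. coeff p j * x ^ j)"
proof -
  have "poly p x = (\<Sum>j\<le>degree p. coeff p j * x ^ j)" by (rule poly_altdef)
  also have "\<dots> = (\<Sum>j\<le>n. coeff p j * x ^ j)"
    using assms by (intro sum.mono_neutral_left) (auto simp: coeff_eq_0)
  finally show ?thesis .
qed

lemma has_integral_poly_circle: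
  fixes p :: "complex poly" and a :: real
  assumes "degree p \<le> n"
  shows "((\<lambda>\<theta>. (cmod (poly p (cis \<theta>)))\<^sup>2) has_integral 2 * pi * (\<Sum>j\<le>n. (cmod (coeff p j))\<^sup>2))
           {a..a + 2 * pi}"
proof -
  have expand: "complex_of_real ((cmod (poly p (cis \<theta>)))\<^sup>2)
      = (\<Sum>j\<le>n. \<Sum>k\<le>n. coeff p j * cnj (coeff p k) * cis (of_int (int j - int k) * \<theta>))" for \<theta>
  proof -
    have "cis \<theta> ^ j * cnj (cis \<theta> ^ k) = cis (of_int (int j - int k) * \<theta>)" for j k
      unfolding complex_cnj_power cis_cnj Complex.DeMoivre[of \<theta> j] Complex.DeMoivre[of "- \<theta>" k] cis_mult
      by (rule arg_cong[of _ _ cis]) (simp add: algebra_simps)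
    then show ?thesis
      unfolding complex_norm_square poly_eq_sum_le[OF assms] cnj_sum sum_product complex_cnj_mult
      by (intro sum.cong refl) (simp add: mult_ac)
  qed
  have "((\<lambda>\<theta>. \<Sum>j\<le>n. \<Sum>k\<le>n. coeff p j * cnj (coeff p k) * cis (of_int (int j - int k) * \<theta>))
      has_integral (\<Sum>j\<le>n. \<Sum>k\<le>n. coeff p j * cnj (coeff p k)
        * (if int j - int k = 0 then of_real (2 * pi) else 0))) {a..a + 2 * pi}"
    by (intro has_integral_sum has_integral_mult_right has_integral_cis_int) auto
  also have "(\<Sum>j\<le>n. \<Sum>k\<le>n. coeff p j * cnj (coeff p k)
        * (if int j - int k = 0 then of_real (2 * pi) else 0))
      = (\<Sum>j\<le>n. coeff p j * cnj (coeff p j) * of_real (2 * pi))"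
  proof (intro sum.cong refl)
    fix j assume j: "j \<in> {..n}"
    have "(\<Sum>k\<le>n. coeff p j * cnj (coeff p k) * (if int j - int k = 0 then of_real (2 * pi) else 0))
        = (\<Sum>k\<le>n. if k = j then coeff p j * cnj (coeff p k) * of_real (2 * pi) else 0)"
      by (intro sum.cong) auto
    then show "(\<Sum>k\<le>n. coeff p j * cnj (coeff p k) * (if int j - int k = 0 then of_real (2 * pi) else 0))
        = coeff p j * cnj (coeff p j) * of_real (2 * pi)" using j by (simp add: sum.delta)
  qed
  also have "\<dots> = complex_of_real (2 * pi * (\<Sum>j\<le>n. (cmod (coeff p j))\<^sup>2))"
    unfolding complex_norm_square[symmetric]
    by (simp add: sum_distrib_left sum_distrib_right mult_ac)
  finally have "((\<lambda>\<theta>. complex_of_real ((cmod (poly p (cis \<theta>)))\<^sup>2))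
      has_integral complex_of_real (2 * pi * (\<Sum>j\<le>n. (cmod (coeff p j))\<^sup>2))) {a..a + 2 * pi}"
    unfolding expand .
  from has_integral_linear[OF this bounded_linear_Re] show ?thesis by (simp add: o_def)
qed

lemma sum_coeff_squares_le:
  fixes p :: "complex poly"
  assumes "degree p \<le> n" "\<And>x. cmod x = 1 \<Longrightarrow> cmod (poly p x) \<le> B"
  shows "(\<Sum>j\<le>n. (cmod (coeff p j))\<^sup>2) \<le> B\<^sup>2"
proof -
  have "2 * pi * (\<Sum>j\<le>n. (cmod (coeff p j))\<^sup>2) \<le> B\<^sup>2 * (2 * pi)"
  proof (rule has_integral_le[OF has_integral_poly_circle[OF assms(1), of 0]])
    show "((\<lambda>_. B\<^sup>2) has_integral B\<^sup>2 * (2 * pi)) {0..0 + 2 * pi}"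
      using has_integral_const_real[of "B\<^sup>2" 0 "2 * pi"] by (simp add: mult.commute)
    show "(cmod (poly p (cis \<theta>)))\<^sup>2 \<le> B\<^sup>2" for \<theta>
      by (intro power_mono assms(2)) auto
  qed
  then show ?thesis by simp
qed

text \<open>Only an arc around \<open>\<alpha>\<close> of the circle of integration is kept.\<close>
lemma sum_coeff_squares_ge:
  fixes p :: "complex poly"
  assumes "degree p \<le> n" "0 \<le> w" "w \<le> pi" "0 \<le> B"
    and low: "\<And>\<psi>. \<bar>\<psi>\<bar> \<le> w \<Longrightarrow> B \<le> cmod (poly p (cis (\<alpha> + \<psi>)))"
  shows "w / pi * B\<^sup>2 \<le> (\<Sum>j\<le>n. (cmod (coeff p j))\<^sup>2)"
proof -
  let ?f = "\<lambda>\<theta>. (cmod (poly p (cis \<theta>)))\<^sup>2"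
  have I: "(?f has_integral 2 * pi * (\<Sum>j\<le>n. (cmod (coeff p j))\<^sup>2)) {\<alpha> - pi..(\<alpha> - pi) + 2 * pi}"
    by (rule has_integral_poly_circle[OF assms(1)])
  have sub: "{\<alpha> - w..\<alpha> + w} \<subseteq> {\<alpha> - pi..(\<alpha> - pi) + 2 * pi}" using assms by auto
  have int: "?f integrable_on {\<alpha> - w..\<alpha> + w}"
    using I sub by (meson has_integral_integrable integrable_on_subinterval)
  have "2 * w * B\<^sup>2 = integral {\<alpha> - w..\<alpha> + w} (\<lambda>_. B\<^sup>2)" using assms(2) by simp
  also have "\<dots> \<le> integral {\<alpha> - w..\<alpha> + w} ?f"
  proof (rule integral_le[OF integrable_const_ivl int])
    fix \<theta> assume "\<theta> \<in> {\<alpha> - w..\<alpha> + w}"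
    then show "B\<^sup>2 \<le> ?f \<theta>" using low[of "\<theta> - \<alpha>"] assms(4) by (intro power_mono) auto
  qed
  also have "\<dots> \<le> integral {\<alpha> - pi..(\<alpha> - pi) + 2 * pi} ?f"
    by (rule integral_subset_le[OF sub int]) (use I in \<open>auto simp: has_integral_integrable\<close>)
  also have "\<dots> = 2 * pi * (\<Sum>j\<le>n. (cmod (coeff p j))\<^sup>2)" using I by (rule integral_unique)
  finally show ?thesis by (simp add: field_simps)
qed

section \<open>Operator norms and the inverse of a Vandermonde matrix\<close>

context
  fixes N :: nat and A :: "complex mat"
  assumes A: "A \<in> carrier_mat N N"
begin

lemma norm_mult_vec_le_frobenius:
  assumes v: "v \<in> carrier_vec N"
  shows "l2_norm_vec (A *\<^sub>v v) \<le> sqrt (\<Sum>i<N. \<Sum>j<N. (cmod (A $$ (i, j)))\<^sup>2) * l2_norm_vec v"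
proof -
  have entry: "(cmod (vec_index (A *\<^sub>v v) i))\<^sup>2 \<le> (\<Sum>j<N. (cmod (A $$ (i, j)))\<^sup>2) * (l2_norm_vec v)\<^sup>2"
    if i: "i < N" for i
  proof -
    have "vec_index (A *\<^sub>v v) i = (\<Sum>j<N. A $$ (i, j) * vec_index v j)"
      using A v i by (simp add: scalar_prod_def lessThan_atLeast0)
    then have "cmod (vec_index (A *\<^sub>v v) i) \<le> (\<Sum>j<N. \<bar>cmod (A $$ (i, j))\<bar> * \<bar>cmod (vec_index v j)\<bar>)"
      by (auto intro!: sum_norm_le simp: norm_mult)
    also have "\<dots> \<le> L2_set (\<lambda>j. cmod (A $$ (i, j))) {..<N} * L2_set (\<lambda>j. cmod (vec_index v j)) {..<N}"
      by (rule L2_set_mult_ineq)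
    finally have "(cmod (vec_index (A *\<^sub>v v) i))\<^sup>2
        \<le> (L2_set (\<lambda>j. cmod (A $$ (i, j))) {..<N} * L2_set (\<lambda>j. cmod (vec_index v j)) {..<N})\<^sup>2"
      by (intro power_mono) auto
    then show ?thesis
      using v by (simp add: power_mult_distrib l2_norm_vec_def L2_set_def sum_nonneg)
  qed
  have "(l2_norm_vec (A *\<^sub>v v))\<^sup>2 = (\<Sum>i<N. (cmod (vec_index (A *\<^sub>v v) i))\<^sup>2)"
    using A by (simp add: l2_norm_vec_def L2_set_def sum_nonneg)
  also have "\<dots> \<le> (\<Sum>i<N. (\<Sum>j<N. (cmod (A $$ (i, j)))\<^sup>2) * (l2_norm_vec v)\<^sup>2)"
    by (intro sum_mono entry) auto
  also have "\<dots> = (sqrt (\<Sum>i<N. \<Sum>j<N. (cmod (A $$ (i, j)))\<^sup>2) * l2_norm_vec v)\<^sup>2"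
    by (simp add: power_mult_distrib sum_distrib_right sum_nonneg)
  finally show ?thesis
    by (rule power2_le_imp_le) (auto intro!: mult_nonneg_nonneg sum_nonneg simp: l2_norm_vec_def)
qed

lemma l2_norm_vec_zero: "l2_norm_vec (0\<^sub>v N) = 0"
  by (simp add: l2_norm_vec_def L2_set_def)

lemma l2_op_norm_le_frobenius: "l2_op_norm A \<le> sqrt (\<Sum>i<N. \<Sum>j<N. (cmod (A $$ (i, j)))\<^sup>2)"
  unfolding l2_op_norm_def
proof (rule cSUP_least)
  show "{v \<in> carrier_vec (dim_col A). l2_norm_vec v \<le> 1} \<noteq> {}"
    using A l2_norm_vec_zero by (auto intro!: exI[of _ "0\<^sub>v N"])
  fix v assume "v \<in> {v \<in> carrier_vec (dim_col A). l2_norm_vec v \<le> 1}"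
  then have v: "v \<in> carrier_vec N" "l2_norm_vec v \<le> 1" using A by auto
  have "l2_norm_vec (A *\<^sub>v v) \<le> sqrt (\<Sum>i<N. \<Sum>j<N. (cmod (A $$ (i, j)))\<^sup>2) * l2_norm_vec v"
    by (rule norm_mult_vec_le_frobenius[OF v(1)])
  also have "\<dots> \<le> sqrt (\<Sum>i<N. \<Sum>j<N. (cmod (A $$ (i, j)))\<^sup>2) * 1"
    using v(2) by (intro mult_left_mono) (auto intro!: sum_nonneg)
  finally show "l2_norm_vec (A *\<^sub>v v) \<le> sqrt (\<Sum>i<N. \<Sum>j<N. (cmod (A $$ (i, j)))\<^sup>2)" by simp
qed

lemma norm_mult_vec_le_l2_op_norm:
  assumes v: "v \<in> carrier_vec N" "l2_norm_vec v \<le> 1"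
  shows "l2_norm_vec (A *\<^sub>v v) \<le> l2_op_norm A"
  unfolding l2_op_norm_def
proof (rule cSUP_upper)
  show "v \<in> {v \<in> carrier_vec (dim_col A). l2_norm_vec v \<le> 1}" using A v by auto
  show "bdd_above ((\<lambda>v. l2_norm_vec (A *\<^sub>v v)) ` {v \<in> carrier_vec (dim_col A). l2_norm_vec v \<le> 1})"
  proof (rule bdd_aboveI2)
    fix v assume "v \<in> {v \<in> carrier_vec (dim_col A). l2_norm_vec v \<le> 1}"
    then have v: "v \<in> carrier_vec N" "l2_norm_vec v \<le> 1" using A by auto
    have "l2_norm_vec (A *\<^sub>v v) \<le> sqrt (\<Sum>i<N. \<Sum>j<N. (cmod (A $$ (i, j)))\<^sup>2) * l2_norm_vec v"
      by (rule norm_mult_vec_le_frobenius[OF v(1)])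
    also have "\<dots> \<le> sqrt (\<Sum>i<N. \<Sum>j<N. (cmod (A $$ (i, j)))\<^sup>2) * 1"
      using v(2) by (intro mult_left_mono) (auto intro!: sum_nonneg)
    finally show "l2_norm_vec (A *\<^sub>v v) \<le> sqrt (\<Sum>i<N. \<Sum>j<N. (cmod (A $$ (i, j)))\<^sup>2)" by simp
  qed
qed

lemma l2_op_norm_nonneg: "0 \<le> l2_op_norm A"
  using norm_mult_vec_le_l2_op_norm[of "0\<^sub>v N"] l2_norm_vec_zero
  by (metis L2_set_nonneg l2_norm_vec_def order_trans zero_carrier_vec zero_le_one)

text \<open>
  A matrix and its transpose have the same norm; the inequality follows by applying \<open>A\<close> to the
  normalised conjugate of the row combination and pairing the result with \<open>c\<close>.
\<close>
lemma row_combination_le_l2_op_norm: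
  "sqrt (\<Sum>j<N. (cmod (\<Sum>k<N. c k * A $$ (k, j)))\<^sup>2) \<le> l2_op_norm A * sqrt (\<Sum>k<N. (cmod (c k))\<^sup>2)"
proof -
  define g where "g = (\<lambda>j. \<Sum>k<N. c k * A $$ (k, j))"
  define G where "G = sqrt (\<Sum>j<N. (cmod (g j))\<^sup>2)"
  show ?thesis
  proof (cases "G = 0")
    case True
    then show ?thesis using l2_op_norm_nonneg by (auto simp: G_def g_def intro!: mult_nonneg_nonneg sum_nonneg)
  next
    case False
    have Gpos: "G > 0" using False by (auto simp: G_def less_le sum_nonneg)
    have G2: "(\<Sum>j<N. (cmod (g j))\<^sup>2) = G\<^sup>2" by (simp add: G_def sum_nonneg)
    define u where "u = vec N (\<lambda>j. cnj (g j) / of_real G)"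
    have u: "u \<in> carrier_vec N" by (simp add: u_def)
    have "(l2_norm_vec u)\<^sup>2 = (\<Sum>j<N. (cmod (g j))\<^sup>2 / G\<^sup>2)"
      using Gpos by (simp add: l2_norm_vec_def L2_set_def sum_nonneg u_def norm_divide power_divide)
    also have "\<dots> = 1" using G2 Gpos by (simp add: sum_divide_distrib[symmetric])
    finally have "l2_norm_vec u \<le> 1" by (auto simp: power2_eq_1_iff)
    then have Au: "l2_norm_vec (A *\<^sub>v u) \<le> l2_op_norm A" by (rule norm_mult_vec_le_l2_op_norm[OF u])
    have "(\<Sum>k<N. c k * vec_index (A *\<^sub>v u) k) = (\<Sum>k<N. \<Sum>j<N. c k * A $$ (k, j) * (cnj (g j) / of_real G))"
      using A by (intro sum.cong refl) (simp add: scalar_prod_def u_def lessThan_atLeast0 sum_distrib_left mult.assoc)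
    also have "\<dots> = (\<Sum>j<N. g j * (cnj (g j) / of_real G))"
    proof -
      have "(\<Sum>k<N. c k * A $$ (k, j) * y) = g j * y" for j y
        by (simp add: g_def sum_distrib_right)
      then show ?thesis by (subst sum.swap) (simp only:)
    qed
    also have "\<dots> = of_real ((\<Sum>j<N. (cmod (g j))\<^sup>2) / G)"
    proof -
      have "g j * (cnj (g j) / of_real G) = of_real ((cmod (g j))\<^sup>2 / G)" for j
        unfolding of_real_divide complex_norm_square by simp
      then show ?thesis by (simp only: sum_divide_distrib of_real_sum)
    qed
    also have "\<dots> = of_real G" unfolding G2 using Gpos by (simp add: power2_eq_square)
    finally have eq: "(\<Sum>k<N. c k * vec_index (A *\<^sub>v u) k) = of_real G" .
    have "G = cmod (\<Sum>k<N. c k * vec_index (A *\<^sub>v u) k)" using Gpos by (simp add: eq)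
    also have "\<dots> \<le> (\<Sum>k<N. \<bar>cmod (c k)\<bar> * \<bar>cmod (vec_index (A *\<^sub>v u) k)\<bar>)"
      by (rule sum_norm_le) (simp add: norm_mult)
    also have "\<dots> \<le> L2_set (\<lambda>k. cmod (c k)) {..<N} * L2_set (\<lambda>k. cmod (vec_index (A *\<^sub>v u) k)) {..<N}"
      by (rule L2_set_mult_ineq)
    also have "L2_set (\<lambda>k. cmod (vec_index (A *\<^sub>v u) k)) {..<N} = l2_norm_vec (A *\<^sub>v u)"
      using A by (simp add: l2_norm_vec_def)
    also have "L2_set (\<lambda>k. cmod (c k)) {..<N} * l2_norm_vec (A *\<^sub>v u)
        \<le> L2_set (\<lambda>k. cmod (c k)) {..<N} * l2_op_norm A"
      using Au by (intro mult_left_mono) auto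
    finally show ?thesis by (simp add: G_def g_def L2_set_def mult.commute)
  qed
qed

end

definition lagrange_basis :: "nat \<Rightarrow> (nat \<Rightarrow> complex) \<Rightarrow> nat \<Rightarrow> complex poly" where
  "lagrange_basis n z k = (\<Prod>j\<in>{..n} - {k}. Polynomial.smult (1 / (z k - z j)) [:- z j, 1:])"

lemma degree_lagrange_basis:
  assumes "k \<le> n" shows "degree (lagrange_basis n z k) \<le> n"
proof -
  have "degree (lagrange_basis n z k) \<le> (\<Sum>j\<in>{..n} - {k}. degree (Polynomial.smult (1 / (z k - z j)) [:- z j, 1:]))"
    unfolding lagrange_basis_def by (rule order_trans[OF degree_prod_sum_le]) auto
  also have "\<dots> \<le> (\<Sum>j\<in>{..n} - {k}. 1)" by (intro sum_mono) simp
  also have "\<dots> = n" using assms by simp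
  finally show ?thesis .
qed

lemma poly_lagrange_basis:
  "poly (lagrange_basis n z k) x = (\<Prod>j\<in>{..n} - {k}. (x - z j) / (z k - z j))"
  unfolding lagrange_basis_def by (simp add: poly_prod diff_divide_distrib)

lemma poly_lagrange_basis_node:
  assumes "inj_on z {..n}" "k \<le> n" "l \<le> n"
  shows "poly (lagrange_basis n z k) (z l) = (if l = k then 1 else 0)"
proof (cases "l = k")
  case True
  have "z k \<noteq> z j" if "j \<in> {..n} - {k}" for j using assms that by (auto dest: inj_onD)
  then show ?thesis unfolding poly_lagrange_basis True by (auto intro!: prod.neutral)
next
  case False
  then show ?thesis using assms unfolding poly_lagrange_basis by (auto intro!: prod_zero)
qed

context
  fixes n :: nat and z :: "nat \<Rightarrow> complex"
  assumes inj: "inj_on z {..n}"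
begin

text \<open>
  Multiplying row \<open>k\<close> of coefficients with column \<open>l\<close> of the Vandermonde matrix evaluates the
  \<open>k\<close>-th Lagrange polynomial at node \<open>l\<close>.
\<close>
lemma mat_inverse_vandermonde:
  "the (mat_inverse (vandermonde_mat n z)) = mat (n + 1) (n + 1) (\<lambda>(k, j). coeff (lagrange_basis n z k) j)"
proof -
  let ?V = "vandermonde_mat n z"
  let ?W = "mat (n + 1) (n + 1) (\<lambda>(k, j). coeff (lagrange_basis n z k) j)"
  have V: "?V \<in> carrier_mat (n + 1) (n + 1)" by (simp add: vandermonde_mat_def)
  have W: "?W \<in> carrier_mat (n + 1) (n + 1)" by simp
  have WV: "?W * ?V = 1\<^sub>m (n + 1)"
  proof (rule eq_matI)
    fix k l assume "k < dim_row (1\<^sub>m (n + 1) :: complex mat)" "l < dim_col (1\<^sub>m (n + 1) :: complex mat)"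
    then have kl: "k \<le> n" "l \<le> n" by auto
    have "(?W * ?V) $$ (k, l) = (\<Sum>j\<le>n. coeff (lagrange_basis n z k) j * z l ^ j)"
      using kl by (simp add: vandermonde_mat_def scalar_prod_def lessThan_atLeast0[symmetric] lessThan_Suc_atMost
          del: sum.lessThan_Suc sum.op_ivl_Suc)
    also have "\<dots> = poly (lagrange_basis n z k) (z l)"
      by (rule poly_eq_sum_le[OF degree_lagrange_basis[OF kl(1)], symmetric])
    also have "\<dots> = 1\<^sub>m (n + 1) $$ (k, l)" using kl poly_lagrange_basis_node[OF inj kl] by auto
    finally show "(?W * ?V) $$ (k, l) = 1\<^sub>m (n + 1) $$ (k, l)" .
  qed (auto simp: vandermonde_mat_def)
  have VW: "?V * ?W = 1\<^sub>m (n + 1)" by (rule mat_mult_left_right_inverse[OF W V WV])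
  then have "?V \<in> Units (ring_mat TYPE(complex) (n + 1) ())"
    using V W WV by (auto simp: Units_def ring_mat_def)
  then obtain B where B: "mat_inverse ?V = Some B"
    using mat_inverse(1)[OF V, where b = "()"] by (cases "mat_inverse ?V") auto
  then have "?V * B = 1\<^sub>m (n + 1)" "B \<in> carrier_mat (n + 1) (n + 1)"
    using mat_inverse(2)[OF V B] by auto
  then have "?W = ?W * (?V * B)" using W by simp
  also have "\<dots> = (?W * ?V) * B"
    using W V \<open>B \<in> carrier_mat (n + 1) (n + 1)\<close> by (metis assoc_mult_mat)
  also have "\<dots> = B" using WV \<open>B \<in> carrier_mat (n + 1) (n + 1)\<close> by simp
  finally show ?thesis using B by simp
qed

lemma norm_inv_vandermonde_le:
  "norm_inv_vandermonde n z \<le> sqrt (\<Sum>k\<le>n. \<Sum>j\<le>n. (cmod (coeff (lagrange_basis n z k) j))\<^sup>2)"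
proof -
  let ?W = "mat (n + 1) (n + 1) (\<lambda>(k, j). coeff (lagrange_basis n z k) j)"
  have "l2_op_norm ?W \<le> sqrt (\<Sum>k<n + 1. \<Sum>j<n + 1. (cmod (?W $$ (k, j)))\<^sup>2)"
    by (rule l2_op_norm_le_frobenius) simp
  also have "(\<Sum>k<n + 1. \<Sum>j<n + 1. (cmod (?W $$ (k, j)))\<^sup>2)
      = (\<Sum>k\<le>n. \<Sum>j\<le>n. (cmod (coeff (lagrange_basis n z k) j))\<^sup>2)"
    by (intro sum.cong) (auto simp del: sum.lessThan_Suc)
  finally show ?thesis by (simp add: norm_inv_vandermonde_def mat_inverse_vandermonde)
qed

lemma norm_inv_vandermonde_ge:
  "sqrt (\<Sum>j\<le>n. (cmod (coeff (\<Sum>k\<le>n. Polynomial.smult (c k) (lagrange_basis n z k)) j))\<^sup>2)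
     \<le> norm_inv_vandermonde n z * sqrt (\<Sum>k\<le>n. (cmod (c k))\<^sup>2)"
proof -
  let ?W = "mat (n + 1) (n + 1) (\<lambda>(k, j). coeff (lagrange_basis n z k) j)"
  have "sqrt (\<Sum>j<n + 1. (cmod (\<Sum>k<n + 1. c k * ?W $$ (k, j)))\<^sup>2)
      \<le> l2_op_norm ?W * sqrt (\<Sum>k<n + 1. (cmod (c k))\<^sup>2)"
    by (rule row_combination_le_l2_op_norm) simp
  also have "(\<Sum>j<n + 1. (cmod (\<Sum>k<n + 1. c k * ?W $$ (k, j)))\<^sup>2)
      = (\<Sum>j\<le>n. (cmod (coeff (\<Sum>k\<le>n. Polynomial.smult (c k) (lagrange_basis n z k)) j))\<^sup>2)"
  proof (intro sum.cong)
    fix j assume "j \<in> {..n}"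
    then have "(\<Sum>k<n + 1. c k * ?W $$ (k, j)) = coeff (\<Sum>k\<le>n. Polynomial.smult (c k) (lagrange_basis n z k)) j"
      unfolding coeff_sum by (intro sum.cong) auto
    then show "(cmod (\<Sum>k<n + 1. c k * ?W $$ (k, j)))\<^sup>2
        = (cmod (coeff (\<Sum>k\<le>n. Polynomial.smult (c k) (lagrange_basis n z k)) j))\<^sup>2" by simp
  qed auto
  also have "(\<Sum>k<n + 1. (cmod (c k))\<^sup>2) = (\<Sum>k\<le>n. (cmod (c k))\<^sup>2)" by (intro sum.cong) auto
  finally show ?thesis by (simp add: norm_inv_vandermonde_def mat_inverse_vandermonde)
qed

lemma norm_inv_vandermonde_pos: "0 < norm_inv_vandermonde n z"
proof -
  let ?c = "\<lambda>k. if k = 0 then 1 else 0 :: complex"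
  have "(\<Sum>k\<le>n. Polynomial.smult (?c k) (lagrange_basis n z k)) = (\<Sum>k\<le>n. if k = 0 then lagrange_basis n z k else 0)"
    by (intro sum.cong) auto
  then have L: "(\<Sum>k\<le>n. Polynomial.smult (?c k) (lagrange_basis n z k)) = lagrange_basis n z 0" by simp
  have "(\<Sum>k\<le>n. (cmod (?c k))\<^sup>2) = (\<Sum>k\<le>n. if k = 0 then 1 else 0)" by (intro sum.cong) auto
  then have c: "(\<Sum>k\<le>n. (cmod (?c k))\<^sup>2) = 1" by simp
  have "lagrange_basis n z 0 \<noteq> 0" using poly_lagrange_basis_node[OF inj, of 0 0] by auto
  then have "coeff (lagrange_basis n z 0) (degree (lagrange_basis n z 0)) \<noteq> 0" by simp
  then have "0 < (\<Sum>j\<le>n. (cmod (coeff (lagrange_basis n z 0) j))\<^sup>2)"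
    using degree_lagrange_basis[of 0 n z]
    by (intro sum_pos2[of _ "degree (lagrange_basis n z 0)"]) auto
  then show ?thesis using norm_inv_vandermonde_ge[of ?c] unfolding L c
    by (metis less_le_trans mult.right_neutral real_sqrt_gt_zero real_sqrt_one)
qed

end

section \<open>The bound for separated nodes\<close>

context
  fixes n :: nat and \<epsilon> :: real and z :: "nat \<Rightarrow> complex"
  assumes n: "n \<ge> 1" and eps: "\<epsilon> > 0"
    and unit: "\<And>j. j \<le> n \<Longrightarrow> cmod (z j) = 1"
    and sep: "\<And>i j. i \<le> n \<Longrightarrow> j \<le> n \<Longrightarrow> i \<noteq> j \<Longrightarrow> \<epsilon> \<le> arc_dist (z i) (z j)"
begin

lemma separated_nodes_short: "(real n + 1) * \<epsilon> \<le> 2 * pi"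
  using n eps unit sep by (rule separated_nodes_fit)

lemma separated_nodes_inj: "inj_on z {..n}"
proof (rule inj_onI, rule ccontr)
  fix i j assume ij: "i \<in> {..n}" "j \<in> {..n}" "z i = z j" "i \<noteq> j"
  then have "arc_dist (z i) (z j) = 0" using unit[of j] by (auto simp: arc_dist_def)
  then show False using sep[of i j] ij eps by auto
qed

lemma lagrange_basis_le:
  assumes k: "k \<le> n" and x: "cmod x = 1"
  shows "cmod (poly (lagrange_basis n z k) x) \<le> paired_cos_prod n \<epsilon> / paired_sin_prod n \<epsilon>"
proof -
  let ?J = "{..n} - {k}"
  note short = separated_nodes_short
  have J: "finite ?J" "card ?J = n" using k by auto
  have "cmod (poly (lagrange_basis n z k) x) = (\<Prod>j\<in>?J. cmod (x - z j)) / (\<Prod>j\<in>?J. cmod (z k - z j))"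
    unfolding poly_lagrange_basis by (simp add: prod_norm[symmetric] norm_divide prod_dividef)
  also have "\<dots> \<le> paired_cos_prod n \<epsilon> / paired_sin_prod n \<epsilon>"
  proof (rule frac_le)
    show "(\<Prod>j\<in>?J. cmod (x - z j)) \<le> paired_cos_prod n \<epsilon>"
      by (rule prod_dist_le_paired_cos_prod[OF J eps _ _ x]) (use unit sep in auto)
    show "paired_sin_prod n \<epsilon> \<le> (\<Prod>j\<in>?J. cmod (z k - z j))"
      by (rule paired_sin_prod_le[OF J eps]) (use unit sep k in auto)
    show "0 < paired_sin_prod n \<epsilon>" by (rule paired_sin_prod_pos[OF n eps short])
    show "0 \<le> paired_cos_prod n \<epsilon>"
      using paired_cos_prod_pos[OF n eps short] by simp
  qed
  finally show ?thesis .
qed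

lemma norm_inv_vandermonde_le_separated:
  "norm_inv_vandermonde n z \<le> sqrt (real n + 1) * (paired_cos_prod n \<epsilon> / paired_sin_prod n \<epsilon>)"
proof -
  let ?B = "paired_cos_prod n \<epsilon> / paired_sin_prod n \<epsilon>"
  note short = separated_nodes_short
  have "(\<Sum>k\<le>n. \<Sum>j\<le>n. (cmod (coeff (lagrange_basis n z k) j))\<^sup>2) \<le> (\<Sum>k\<le>n. ?B\<^sup>2)"
    by (intro sum_mono sum_coeff_squares_le degree_lagrange_basis lagrange_basis_le) auto
  also have "\<dots> = (real n + 1) * ?B\<^sup>2" by (simp add: add.commute)
  finally have "norm_inv_vandermonde n z \<le> sqrt ((real n + 1) * ?B\<^sup>2)"
    using norm_inv_vandermonde_le[OF separated_nodes_inj] by (meson order_trans real_sqrt_le_mono)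
  also have "?B > 0" using paired_cos_prod_pos[OF n eps short] paired_sin_prod_pos[OF n eps short] by simp
  then have "sqrt ((real n + 1) * ?B\<^sup>2) = sqrt (real n + 1) * ?B"
    by (simp only: real_sqrt_mult real_sqrt_abs abs_of_pos)
  finally show ?thesis .
qed

lemma ln_norm_inv_vandermonde_le_separated:
  "ln (norm_inv_vandermonde n z) \<le> real n * main_term n \<epsilon> - 1 / 2 * ln (real n)
     + 35 * (1 + \<bar>ln (real n * \<epsilon> * (2 * pi - real n * \<epsilon>))\<bar>)"
proof -
  note short = separated_nodes_short
  let ?B = "paired_cos_prod n \<epsilon> / paired_sin_prod n \<epsilon>"
  have B: "?B > 0" using paired_cos_prod_pos[OF n eps short] paired_sin_prod_pos[OF n eps short] by simp
  have "ln (norm_inv_vandermonde n z) \<le> ln (sqrt (real n + 1) * ?B)"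
    by (rule ln_mono[OF norm_inv_vandermonde_le_separated norm_inv_vandermonde_pos[OF separated_nodes_inj]])
  also have "\<dots> = ln (real n + 1) / 2 + ln ?B"
    using B by (subst ln_mult_pos) (auto simp: ln_sqrt)
  also have "ln (real n + 1) \<le> ln (2 * real n)" using n by simp
  also have "ln (2 * real n) = ln 2 + ln (real n)" using n by (subst ln_mult_pos) auto
  finally have up: "ln (norm_inv_vandermonde n z) \<le> (ln 2 + ln (real n)) / 2 + ln ?B" by simp
  have "x \<le> m - 1 / 2 * l + 35 * (1 + \<bar>e\<bar>)"
    if "x \<le> (ln 2 + l) / 2 + y" "y \<le> m - l + 6 - 2 * c" "- c \<le> 14 + \<bar>e\<bar>" for x y m l c e :: real
    using that ln_2_less_1 by argo
  from this[OF up ln_paired_ratio_le[OF n eps short] minus_ln_cos_le[OF n eps short]]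
  show ?thesis .
qed

end

section \<open>Gaussian binomial coefficients at a unit complex number\<close>

text \<open>
  With \<open>q = cis \<epsilon>\<close>, the numbers \<open>2 sin (k\<epsilon>/2)\<close> are the moduli of \<open>q\<^sup>k - 1\<close>. So \<open>sin_prod\<close> is a
  \<open>q\<close>-factorial, and \<open>q_binomial\<close> a Gaussian binomial coefficient, normalised to be real. It is positive
  as long as \<open>n\<epsilon> < 2\<pi>\<close>.
\<close>
definition sin_prod :: "real \<Rightarrow> nat \<Rightarrow> real" where
  "sin_prod \<epsilon> m = (\<Prod>i<m. 2 * sin (real (i + 1) * \<epsilon> / 2))"

lemma sin_prod_0: "sin_prod \<epsilon> 0 = 1"
  by (simp add: sin_prod_def)

lemma sin_prod_Suc: "sin_prod \<epsilon> (Suc m) = sin_prod \<epsilon> m * (2 * sin (real (m + 1) * \<epsilon> / 2))"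
  by (simp add: sin_prod_def)

lemma paired_sin_prod_eq: "paired_sin_prod n \<epsilon> = sin_prod \<epsilon> (n div 2) * sin_prod \<epsilon> (n - n div 2)"
proof (induction n)
  case (Suc n)
  have step: "paired_sin_prod (Suc n) \<epsilon> = paired_sin_prod n \<epsilon> * (2 * sin (real (n div 2 + 1) * \<epsilon> / 2))"
    by (simp add: paired_sin_prod_def)
  show ?case
  proof (cases "even n")
    case True
    then have "Suc n div 2 = n div 2" "Suc n - n div 2 = Suc (n - n div 2)" "n - n div 2 = n div 2" by auto
    then show ?thesis unfolding step Suc by (simp only: sin_prod_Suc mult.assoc)
  next
    case False
    then have "Suc n div 2 = Suc (n div 2)" "Suc n - Suc (n div 2) = n - n div 2" by presburger+
    then show ?thesis unfolding step Suc by (simp only: sin_prod_Suc mult_ac)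
  qed
qed (simp add: paired_sin_prod_def sin_prod_def)

definition q_binomial :: "real \<Rightarrow> nat \<Rightarrow> nat \<Rightarrow> real" where
  "q_binomial \<epsilon> n j = (if j \<le> n then sin_prod \<epsilon> n / (sin_prod \<epsilon> j * sin_prod \<epsilon> (n - j)) else 0)"

definition q_energy :: "real \<Rightarrow> nat \<Rightarrow> real" where
  "q_energy \<epsilon> n = (\<Sum>j\<le>n. (q_binomial \<epsilon> n j)\<^sup>2)"

text \<open>
  For \<open>n + 1\<close> nodes the estimates use \<open>nodal_poly \<epsilon> n\<close>, which leaves the last node out: the
  \<open>q\<close>-binomials of order \<open>n + 1\<close> degenerate when the nodes close up to the roots of unity.
\<close>
definition nodal_poly :: "real \<Rightarrow> nat \<Rightarrow> complex poly" where
  "nodal_poly \<epsilon> m = (\<Prod>l<m. [:- cis (real l * \<epsilon>), 1:])"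

lemma sin_le_sin_symmetric:
  fixes x y :: real
  assumes "0 \<le> x" "x \<le> y" "y \<le> pi - x"
  shows "sin x \<le> sin y"
proof (cases "y \<le> pi / 2")
  case True
  then show ?thesis using assms by (intro sin_monotone_2pi_le) auto
next
  case False
  then have "sin x \<le> sin (pi - y)" using assms by (intro sin_monotone_2pi_le) auto
  then show ?thesis by simp
qed

lemma cis_mult_sin_add: "cis a * of_real (sin (a + b)) = of_real (sin b) + cis (a + b) * of_real (sin a)"
proof -
  have "cos a * sin (a + b) = sin b + cos (a + b) * sin a"
  proof -
    have "sin b = sin (a + b - a)" by simp
    also have "\<dots> = sin (a + b) * cos a - cos (a + b) * sin a" by (rule sin_diff)
    finally show ?thesis by simp
  qed
  then show ?thesis by (simp add: complex_eq_iff mult.commute)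
qed

text \<open>
  Dividing by a linear factor turns the coefficients \<open>b\<close> into partial sums of \<open>\<Sum>j. b\<^sub>j w\<^sup>j\<close> for the unit
  complex number \<open>w = \<zeta> v\<close>. As in Abel summation, \<open>(1 - w)\<close> times such a sum is bounded by the
  variation of \<open>b\<close>; the sum is taken from the left below the peak \<open>c\<close> and from the right above it, so
  that the variation is the value at the cut.
\<close>
lemma unimodal_quotient_coeff_le:
  fixes R :: "complex poly" and b :: "nat \<Rightarrow> real"
  assumes \<zeta>: "cmod \<zeta> = 1" and u: "cmod u = 1" and v: "cmod v = 1"
    and prod: "\<And>j. coeff ([:- \<zeta>, 1:] * R) j = u * v ^ j * of_real (b j)"
    and nonneg: "\<And>j. 0 \<le> b j"
    and up: "\<And>j. j < c \<Longrightarrow> b j \<le> b (Suc j)"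
    and down: "\<And>j. c \<le> j \<Longrightarrow> b (Suc j) \<le> b j"
  shows "cmod (1 - \<zeta> * v) * cmod (coeff R j) \<le> 2 * b j"
proof -
  define w where "w = \<zeta> * v"
  have w: "cmod w = 1" using \<zeta> v by (simp add: w_def norm_mult)
  have nz: "u \<noteq> 0" "v \<noteq> 0" using u v by auto
  \<comment> \<open>\<open>1 - w\<close> times a partial sum without its phase; the recursion \<open>rec\<close> keeps track of its distance from \<open>b\<close>.\<close>
  define \<tau> where "\<tau> = (\<lambda>j. if j = 0 then 0 else (1 - w) * (coeff R (j - 1) / (u * v ^ j)))"
  have rec: "\<tau> j - of_real (b j) = w * (\<tau> (Suc j) - of_real (b j))" for j
  proof -
    have "(1 - w) * of_real (b j) = \<tau> j - w * \<tau> (Suc j)"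
    proof (cases j)
      case 0
      have "u * of_real (b 0) = - \<zeta> * coeff R 0" using prod[of 0] by simp
      then have "of_real (b 0) = - \<zeta> * coeff R 0 / u" using nz by (simp add: field_simps)
      then show ?thesis using nz 0 by (simp add: \<tau>_def w_def)
    next
      case (Suc i)
      have "u * v ^ j * of_real (b j) = coeff R i - \<zeta> * coeff R j" using prod[of j] Suc by simp
      then have "of_real (b j) = (coeff R i - \<zeta> * coeff R j) / (u * v ^ j)"
        using nz by (simp add: field_simps)
      then have "(1 - w) * of_real (b j)
          = (1 - w) * (coeff R i / (u * v ^ j)) - (1 - w) * (\<zeta> * coeff R j / (u * v ^ j))"
        by (simp add: diff_divide_distrib right_diff_distrib)
      moreover have "\<zeta> * coeff R j / (u * v ^ j) = w * (coeff R j / (u * v ^ Suc j))"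
        using nz by (simp add: w_def)
      moreover have "\<tau> j = (1 - w) * (coeff R i / (u * v ^ j))"
        "\<tau> (Suc j) = (1 - w) * (coeff R j / (u * v ^ Suc j))" using Suc by (simp_all add: \<tau>_def)
      ultimately show ?thesis by (simp only: mult.left_commute)
    qed
    then show ?thesis by (simp add: algebra_simps)
  qed
  then have shift: "cmod (\<tau> j - of_real (b j)) = cmod (\<tau> (Suc j) - of_real (b j))" for j
    using w by (metis mult_1 norm_mult)
  have tri: "cmod (x - of_real s) \<le> cmod (x - of_real t) + \<bar>t - s\<bar>" for x :: complex and s t :: real
  proof -
    have "x - of_real s = (x - of_real t) + of_real (t - s)" by simp
    then show ?thesis by (metis norm_triangle_ineq norm_of_real)
  qed
  have asc: "j \<le> c \<Longrightarrow> cmod (\<tau> (Suc j) - of_real (b j)) \<le> b j" for j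
  proof (induction j)
    case 0
    then show ?case using shift[of 0] nonneg[of 0] by (simp add: \<tau>_def)
  next
    case (Suc j)
    have "cmod (\<tau> (Suc j) - of_real (b (Suc j))) \<le> cmod (\<tau> (Suc j) - of_real (b j)) + \<bar>b j - b (Suc j)\<bar>"
      by (rule tri)
    then show ?case using shift[of "Suc j"] Suc up[of j] by simp
  qed
  have desc: "\<lbrakk>c \<le> j; degree R < j + m\<rbrakk> \<Longrightarrow> cmod (\<tau> (Suc j) - of_real (b j)) \<le> b j" for j m
  proof (induction m arbitrary: j)
    case 0
    then show ?case using nonneg[of j] by (simp add: \<tau>_def coeff_eq_0)
  next
    case (Suc m)
    have "cmod (\<tau> (Suc (Suc j)) - of_real (b (Suc j))) \<le> b (Suc j)"
      using Suc.prems by (intro Suc.IH) auto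
    then have "cmod (\<tau> (Suc j) - of_real (b (Suc j))) \<le> b (Suc j)" using shift[of "Suc j"] by simp
    moreover have "cmod (\<tau> (Suc j) - of_real (b j)) \<le> cmod (\<tau> (Suc j) - of_real (b (Suc j))) + \<bar>b (Suc j) - b j\<bar>"
      by (rule tri)
    ultimately show ?case using down[OF Suc.prems(1)] by simp
  qed
  have "cmod (\<tau> (Suc j) - of_real (b j)) \<le> b j"
    using asc[of j] desc[of j "Suc (degree R)"] by (cases "j \<le> c") auto
  moreover have "cmod (\<tau> (Suc j)) \<le> cmod (\<tau> (Suc j) - of_real (b j)) + \<bar>b j\<bar>"
    using tri[of "\<tau> (Suc j)" 0 "b j"] by simp
  ultimately have "cmod (\<tau> (Suc j)) \<le> 2 * b j" using nonneg[of j] by simp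
  moreover have "cmod (\<tau> (Suc j)) = cmod (1 - w) * cmod (coeff R j)"
    using u v by (simp add: \<tau>_def norm_mult norm_divide norm_power)
  ultimately show ?thesis by (simp add: w_def)
qed

context
  fixes n :: nat and \<epsilon> :: real
  assumes n: "n \<ge> 1" and eps: "\<epsilon> > 0" and short: "(real n + 1) * \<epsilon> \<le> 2 * pi"
begin

lemma half_angle_le: "k \<le> n + 1 \<Longrightarrow> real k * \<epsilon> / 2 \<le> pi"
proof -
  assume "k \<le> n + 1"
  then have "real k * \<epsilon> \<le> (real n + 1) * \<epsilon>" using eps by (intro mult_right_mono) auto
  then show ?thesis using short by simp
qed

lemma half_angle_sin_pos: "1 \<le> k \<Longrightarrow> k \<le> n \<Longrightarrow> 0 < sin (real k * \<epsilon> / 2)"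
proof -
  assume k: "1 \<le> k" "k \<le> n"
  have "real k * \<epsilon> / 2 < real (k + 1) * \<epsilon> / 2" using eps by (simp add: field_simps)
  also have "\<dots> \<le> pi" using k by (intro half_angle_le) simp
  finally show ?thesis using k eps by (intro sin_gt_zero) auto
qed

lemma sin_prod_pos: "m \<le> n \<Longrightarrow> 0 < sin_prod \<epsilon> m"
proof -
  assume m: "m \<le> n"
  have "0 < 2 * sin (real (i + 1) * \<epsilon> / 2)" if "i \<in> {..<m}" for i
    using half_angle_sin_pos[of "i + 1"] that m by simp
  then show ?thesis unfolding sin_prod_def by (rule prod_pos)
qed

text \<open>The \<open>q\<close>-Pascal rule, with half-angles in place of powers of \<open>q\<close>.\<close>
lemma q_pascal:
  assumes "i < m" "m < n"
  shows "cis (real (m - i) * \<epsilon> / 2) * of_real (q_binomial \<epsilon> (Suc m) (Suc i))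
    = of_real (q_binomial \<epsilon> m i) + cis (real (m + 1) * \<epsilon> / 2) * of_real (q_binomial \<epsilon> m (Suc i))"
proof -
  define s where "s = (\<lambda>k. 2 * sin (real k * \<epsilon> / 2))"
  define S where "S = sin_prod \<epsilon>"
  have S_Suc: "S (Suc k) = S k * s (Suc k)" for k by (simp add: S_def s_def sin_prod_Suc)
  obtain r where m: "m = Suc (i + r)" using assms(1) less_iff_Suc_add by auto
  have pos: "S i > 0" "S r > 0" "S m > 0" "s (Suc i) > 0" "s (Suc r) > 0"
    using assms m sin_prod_pos[of i] sin_prod_pos[of r] sin_prod_pos[of m]
      half_angle_sin_pos[of "Suc i"] half_angle_sin_pos[of "Suc r"] by (simp_all add: S_def s_def del: of_nat_Suc)
  have arg: "real (m - i) * \<epsilon> / 2 + real (Suc i) * \<epsilon> / 2 = real (m + 1) * \<epsilon> / 2"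
    using assms(1) by (simp add: m algebra_simps add_divide_distrib)
  have "cis (real (m - i) * \<epsilon> / 2) * of_real (s (m + 1))
      = of_real (s (Suc i)) + cis (real (m + 1) * \<epsilon> / 2) * of_real (s (Suc r))"
    using cis_mult_sin_add[of "real (m - i) * \<epsilon> / 2" "real (Suc i) * \<epsilon> / 2"] m
    unfolding arg s_def by (simp add: algebra_simps)
  moreover define c where "c = S m / (S i * s (Suc i) * (S r * s (Suc r)))"
  moreover have "q_binomial \<epsilon> (Suc m) (Suc i) = c * s (m + 1)"
    by (simp add: q_binomial_def m S_def[symmetric] S_Suc c_def)
  moreover have "q_binomial \<epsilon> m i = c * s (Suc i)" "q_binomial \<epsilon> m (Suc i) = c * s (Suc r)"
    using pos by (simp_all add: q_binomial_def m S_def[symmetric] S_Suc c_def)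
  ultimately show ?thesis
    by (metis (no_types, lifting) distrib_left mult.left_commute of_real_mult)
qed

text \<open>The \<open>q\<close>-binomial theorem, by induction with the \<open>q\<close>-Pascal rule.\<close>
lemma coeff_nodal_poly:
  "m \<le> n \<Longrightarrow> coeff (nodal_poly \<epsilon> m) j
     = (- 1) ^ (m - j) * cis ((real m - 1) * real (m - j) * \<epsilon> / 2) * of_real (q_binomial \<epsilon> m j)"
proof (induction m arbitrary: j)
  case 0
  then show ?case by (simp add: nodal_poly_def q_binomial_def sin_prod_def coeff_1 coeff_eq_0)
next
  case (Suc m)
  then have IH: "coeff (nodal_poly \<epsilon> m) j
     = (- 1) ^ (m - j) * cis ((real m - 1) * real (m - j) * \<epsilon> / 2) * of_real (q_binomial \<epsilon> m j)" for j by simp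
  have qb0: "q_binomial \<epsilon> k 0 = 1" "q_binomial \<epsilon> k k = 1" if "k \<le> n" for k
    using sin_prod_pos[OF that] by (simp_all add: q_binomial_def sin_prod_0)
  have step: "nodal_poly \<epsilon> (Suc m) = [:- cis (real m * \<epsilon>), 1:] * nodal_poly \<epsilon> m"
    by (simp add: nodal_poly_def mult.commute)
  show ?case
  proof (cases j)
    case 0
    have "coeff (nodal_poly \<epsilon> (Suc m)) 0 = - cis (real m * \<epsilon>) * coeff (nodal_poly \<epsilon> m) 0"
      unfolding step by simp
    also have "\<dots> = (- 1) ^ Suc m * (cis (real m * \<epsilon>) * cis ((real m - 1) * real m * \<epsilon> / 2))"
      using Suc.prems by (simp add: IH qb0)
    also have "cis (real m * \<epsilon>) * cis ((real m - 1) * real m * \<epsilon> / 2)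
        = cis ((real (Suc m) - 1) * real (Suc m) * \<epsilon> / 2)"
      unfolding cis_mult by (rule arg_cong[of _ _ cis]) (simp add: field_simps)
    finally show ?thesis using 0 qb0[OF Suc.prems] by simp
  next
    case (Suc i)
    have c: "coeff (nodal_poly \<epsilon> (Suc m)) j
        = coeff (nodal_poly \<epsilon> m) i - cis (real m * \<epsilon>) * coeff (nodal_poly \<epsilon> m) j"
      unfolding step Suc by simp
    consider "i > m" | "i = m" | "i < m" by linarith
    then show ?thesis
    proof cases
      case 1
      then show ?thesis unfolding c IH using Suc by (simp add: q_binomial_def)
    next
      case 2
      then show ?thesis unfolding c IH using Suc qb0 Suc.prems \<open>Suc m \<le> n\<close> by (simp add: q_binomial_def[of _ m "Suc m"])
    next
      case 3
      define A where "A = (- 1) ^ (m - i) * cis ((real m - 1) * real (m - i) * \<epsilon> / 2)"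
      have mi: "m - i = Suc (m - Suc i)" using 3 by simp
      have e1: "cis ((real (Suc m) - 1) * real (Suc m - j) * \<epsilon> / 2)
          = cis ((real m - 1) * real (m - i) * \<epsilon> / 2) * cis (real (m - i) * \<epsilon> / 2)"
        unfolding cis_mult using Suc by (intro arg_cong[of _ _ cis]) (simp add: field_simps)
      have e2: "cis (real m * \<epsilon>) * cis ((real m - 1) * real (m - Suc i) * \<epsilon> / 2)
          = cis ((real m - 1) * real (m - i) * \<epsilon> / 2) * cis (real (m + 1) * \<epsilon> / 2)"
        unfolding cis_mult mi by (rule arg_cong[of _ _ cis]) (simp add: field_simps)
      have "cis (real m * \<epsilon>) * coeff (nodal_poly \<epsilon> m) j
          = (- 1) ^ (m - Suc i) * (cis (real m * \<epsilon>) * cis ((real m - 1) * real (m - Suc i) * \<epsilon> / 2))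
             * of_real (q_binomial \<epsilon> m (Suc i))"
        unfolding IH Suc by (simp add: mult_ac)
      also have "\<dots> = - A * cis (real (m + 1) * \<epsilon> / 2) * of_real (q_binomial \<epsilon> m (Suc i))"
        unfolding e2 A_def mi by (simp add: mult_ac)
      finally have "coeff (nodal_poly \<epsilon> (Suc m)) j
          = A * (of_real (q_binomial \<epsilon> m i) + cis (real (m + 1) * \<epsilon> / 2) * of_real (q_binomial \<epsilon> m (Suc i)))"
        unfolding c IH[of i] A_def by (simp add: algebra_simps)
      also have "\<dots> = A * (cis (real (m - i) * \<epsilon> / 2) * of_real (q_binomial \<epsilon> (Suc m) (Suc i)))"
        using q_pascal[OF 3] Suc.prems by simp
      also have "\<dots> = (A * cis (real (m - i) * \<epsilon> / 2)) * of_real (q_binomial \<epsilon> (Suc m) j)"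
        by (simp only: Suc mult.assoc)
      also have "A * cis (real (m - i) * \<epsilon> / 2)
          = (- 1) ^ (Suc m - j) * cis ((real (Suc m) - 1) * real (Suc m - j) * \<epsilon> / 2)"
        unfolding e1 A_def by (simp only: Suc diff_Suc_Suc mult.assoc)
      finally show ?thesis .
    qed
  qed
qed

lemma q_binomial_pos: "j \<le> n \<Longrightarrow> 0 < q_binomial \<epsilon> n j"
  using sin_prod_pos[of j] sin_prod_pos[of "n - j"] sin_prod_pos[of n] by (simp add: q_binomial_def)

lemma q_binomial_nonneg: "0 \<le> q_binomial \<epsilon> n j"
  using q_binomial_pos[of j] by (cases "j \<le> n") (auto simp: q_binomial_def)

lemma q_binomial_symmetric: "j \<le> n \<Longrightarrow> q_binomial \<epsilon> n (n - j) = q_binomial \<epsilon> n j"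
  by (simp add: q_binomial_def mult.commute)

lemma q_binomial_ratio:
  assumes "j < n"
  shows "q_binomial \<epsilon> n (Suc j) * sin (real (Suc j) * \<epsilon> / 2) = q_binomial \<epsilon> n j * sin (real (n - j) * \<epsilon> / 2)"
proof -
  obtain r where r: "n = Suc (j + r)" using assms less_iff_Suc_add by auto
  have "sin_prod \<epsilon> j > 0" "sin_prod \<epsilon> r > 0" "sin (real (Suc j) * \<epsilon> / 2) > 0" "sin (real (Suc r) * \<epsilon> / 2) > 0"
    using r sin_prod_pos[of j] sin_prod_pos[of r] half_angle_sin_pos[of "Suc j"] half_angle_sin_pos[of "Suc r"] by auto
  moreover have "n - j = Suc r" "n - Suc j = r" using r by auto
  ultimately show ?thesis
    using assms by (simp add: q_binomial_def sin_prod_Suc del: of_nat_Suc)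
qed

text \<open>
  The quotient of neighbours is \<open>sin ((n - j)\<epsilon>/2) / sin ((j + 1)\<epsilon>/2)\<close>. Past the middle the upper angle
  is the smaller one, and the two angles sum to at most \<open>\<pi>\<close> since all \<open>n + 1\<close> nodes fit on the circle.
\<close>
lemma q_binomial_decreasing:
  assumes "n div 2 \<le> j"
  shows "q_binomial \<epsilon> n (Suc j) \<le> q_binomial \<epsilon> n j"
proof (cases "j < n")
  case True
  have le: "n - j \<le> Suc j" using assms by linarith
  have "sin (real (n - j) * \<epsilon> / 2) \<le> sin (real (Suc j) * \<epsilon> / 2)"
  proof (rule sin_le_sin_symmetric)
    have "real (n - j) * \<epsilon> / 2 + real (Suc j) * \<epsilon> / 2 = real (n + 1) * \<epsilon> / 2"
      using True by (simp add: of_nat_diff algebra_simps add_divide_distrib diff_divide_distrib)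
    also have "\<dots> \<le> pi" by (rule half_angle_le) simp
    finally show "real (Suc j) * \<epsilon> / 2 \<le> pi - real (n - j) * \<epsilon> / 2" by simp
    show "real (n - j) * \<epsilon> / 2 \<le> real (Suc j) * \<epsilon> / 2"
      using le eps by (intro divide_right_mono mult_right_mono) auto
  qed (use eps in simp)
  then have "q_binomial \<epsilon> n (Suc j) * sin (real (Suc j) * \<epsilon> / 2) \<le> q_binomial \<epsilon> n j * sin (real (Suc j) * \<epsilon> / 2)"
    unfolding q_binomial_ratio[OF True] by (intro mult_left_mono q_binomial_nonneg)
  moreover have "0 < sin (real (Suc j) * \<epsilon> / 2)" using True by (intro half_angle_sin_pos) auto
  ultimately show ?thesis by (simp del: of_nat_Suc)
next
  case False
  then show ?thesis using q_binomial_nonneg[of j] by (simp add: q_binomial_def[of _ n "Suc j"])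
qed

lemma q_binomial_increasing:
  assumes "j < n div 2"
  shows "q_binomial \<epsilon> n j \<le> q_binomial \<epsilon> n (Suc j)"
proof -
  have "q_binomial \<epsilon> n (Suc (n - Suc j)) \<le> q_binomial \<epsilon> n (n - Suc j)" using assms by (intro q_binomial_decreasing) linarith
  moreover have "Suc (n - Suc j) = n - j" using assms by linarith
  ultimately show ?thesis using q_binomial_symmetric[of j] q_binomial_symmetric[of "Suc j"] assms by simp
qed

lemma q_binomial_le_middle:
  assumes "j \<le> n" shows "q_binomial \<epsilon> n j \<le> q_binomial \<epsilon> n (n div 2)"
proof -
  have upper: "q_binomial \<epsilon> n i \<le> q_binomial \<epsilon> n (n div 2)" if "n div 2 \<le> i" for i
    using that by (induction i rule: dec_induct) (auto intro: order_trans[OF q_binomial_decreasing])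
  show ?thesis
  proof (cases "n div 2 \<le> j")
    case False
    then have "n div 2 \<le> n - j" by linarith
    then show ?thesis using upper[of "n - j"] q_binomial_symmetric[OF assms] by simp
  qed (rule upper)
qed

text \<open>
  Past the middle the quotient of neighbours is at least \<open>(n - j) / (j + 1)\<close>, because \<open>sin x / x\<close> decreases. So
  \<open>q\<close>-binomials fall off from the middle more slowly than binomial coefficients, whatever \<open>\<epsilon>\<close> is.
\<close>
lemma q_binomial_ge_binomial:
  assumes "j \<le> n"
  shows "real (n choose j) * q_binomial \<epsilon> n (n div 2) \<le> real (n choose (n div 2)) * q_binomial \<epsilon> n j"
proof -
  have upper: "i \<le> n \<Longrightarrow> real (n choose i) * q_binomial \<epsilon> n (n div 2) \<le> real (n choose (n div 2)) * q_binomial \<epsilon> n i"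
    if "n div 2 \<le> i" for i
    using that
  proof (induction i rule: dec_induct)
    case (step i)
    then have i: "i < n" by simp
    define s where "s = sin (real (Suc i) * \<epsilon> / 2)"
    define s' where "s' = sin (real (n - i) * \<epsilon> / 2)"
    have s: "s > 0" using i unfolding s_def by (intro half_angle_sin_pos) auto
    have "real (n - i) * \<epsilon> / 2 * s \<le> real (Suc i) * \<epsilon> / 2 * s'"
      unfolding s_def s'_def
    proof (rule sin_ratio_antitone)
      have "n - i \<le> Suc i" using step by linarith
      then show "real (n - i) * \<epsilon> / 2 \<le> real (Suc i) * \<epsilon> / 2"
        using eps by (intro divide_right_mono mult_right_mono) auto
      show "real (Suc i) * \<epsilon> / 2 \<le> pi" using i by (intro half_angle_le) simp
    qed (use eps in simp)
    then have "real (n - i) * s * (\<epsilon> / 2) \<le> real (Suc i) * s' * (\<epsilon> / 2)" by (simp only: mult_ac times_divide_eq_right times_divide_eq_left)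
    then have ratio: "real (n - i) * s \<le> real (Suc i) * s'" using eps by simp
    have ch: "real (Suc i) * real (n choose Suc i) = real (n - i) * real (n choose i)"
      using binomial_absorb_comp[of n i] binomial_absorption[of i "n - 1"] i
      by (metis Suc_times_binomial_add binomial_absorption mult.commute of_nat_mult times_binomial_minus1_eq
          choose_reduce_nat)
    have "(real (Suc i) * real (n choose Suc i) * q_binomial \<epsilon> n (n div 2)) * s
        = (real (n choose i) * q_binomial \<epsilon> n (n div 2)) * (real (n - i) * s)"
      unfolding ch by (simp only: mult_ac)
    also have "\<dots> \<le> (real (n choose (n div 2)) * q_binomial \<epsilon> n i) * (real (Suc i) * s')"
    proof (rule mult_mono[OF _ ratio])
      show "real (n choose i) * q_binomial \<epsilon> n (n div 2) \<le> real (n choose (n div 2)) * q_binomial \<epsilon> n i"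
        using step.IH i by simp
      show "0 \<le> real (n choose (n div 2)) * q_binomial \<epsilon> n i"
        by (intro mult_nonneg_nonneg q_binomial_nonneg) simp
      show "0 \<le> real (n - i) * s" using s by simp
    qed
    also have "\<dots> = real (Suc i) * real (n choose (n div 2)) * (q_binomial \<epsilon> n i * s')" by (simp only: mult_ac)
    also have "q_binomial \<epsilon> n i * s' = q_binomial \<epsilon> n (Suc i) * s" using q_binomial_ratio[OF i] by (simp only: s_def s'_def)
    finally have "(real (Suc i) * s) * (real (n choose Suc i) * q_binomial \<epsilon> n (n div 2))
        \<le> (real (Suc i) * s) * (real (n choose (n div 2)) * q_binomial \<epsilon> n (Suc i))" by (simp only: mult_ac)
    moreover have "real (Suc i) * s > 0" using s by simp
    ultimately show ?case by (simp only: mult_le_cancel_left_pos)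
  qed simp
  show ?thesis
  proof (cases "n div 2 \<le> j")
    case False
    then have "n div 2 \<le> n - j" by linarith
    then show ?thesis using upper[of "n - j"] q_binomial_symmetric[OF assms] binomial_symmetric[OF assms] by simp
  qed (use upper assms in blast)
qed

lemma q_energy_ge: "exp (-14) * sqrt (real n) * (q_binomial \<epsilon> n (n div 2))\<^sup>2 \<le> q_energy \<epsilon> n"
proof -
  define c where "c = real (n choose (n div 2))"
  have c: "c > 0" by (simp add: c_def zero_less_binomial)
  have "exp (-14) * sqrt (real n) * (q_binomial \<epsilon> n (n div 2))\<^sup>2
      \<le> real ((2 * n) choose n) / c\<^sup>2 * (q_binomial \<epsilon> n (n div 2))\<^sup>2"
    unfolding c_def by (intro mult_right_mono sum_binomial_squares_lower n) auto
  also have "\<dots> = (\<Sum>j\<le>n. (real (n choose j) * q_binomial \<epsilon> n (n div 2) / c)\<^sup>2)"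
    unfolding choose_square_sum[symmetric]
    by (simp add: sum_distrib_right sum_divide_distrib power_mult_distrib power_divide)
  also have "\<dots> \<le> q_energy \<epsilon> n"
    unfolding q_energy_def
  proof (intro sum_mono power_mono)
    fix j assume "j \<in> {..n}"
    then show "real (n choose j) * q_binomial \<epsilon> n (n div 2) / c \<le> q_binomial \<epsilon> n j"
      using q_binomial_ge_binomial[of j] c by (simp add: c_def pos_divide_le_eq mult.commute)
    show "0 \<le> real (n choose j) * q_binomial \<epsilon> n (n div 2) / c" using c q_binomial_nonneg by simp
  qed
  finally show ?thesis .
qed

end

section \<open>The upper bound for equispaced nodes\<close>

lemma abs_Arg_cis_ge:
  assumes "0 \<le> \<epsilon>" "\<epsilon> \<le> \<bar>x\<bar>" "\<bar>x\<bar> \<le> 2 * pi - \<epsilon>"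
  shows "\<epsilon> \<le> \<bar>Arg (cis x)\<bar>"
proof (rule ccontr)
  define y where "y = Arg (cis x)"
  assume "\<not> \<epsilon> \<le> \<bar>Arg (cis x)\<bar>"
  then have y: "\<bar>y\<bar> < \<epsilon>" by (simp add: y_def)
  have "\<epsilon> \<le> pi" using assms by linarith
  then have less: "cos \<epsilon> < cos \<bar>y\<bar>" using y by (intro cos_monotone_0_pi) auto
  have "cis y = cis x" using unit_eq_cis_Arg[of "cis x"] by (simp add: y_def)
  then have eq: "cos y = cos x" by (metis cis.simps(1))
  have "cos \<bar>x\<bar> \<le> cos \<epsilon>"
  proof (cases "\<bar>x\<bar> \<le> pi")
    case True
    then show ?thesis using assms by (intro cos_monotone_0_pi_le) auto
  next
    case False
    then have "cos (2 * pi - \<bar>x\<bar>) \<le> cos \<epsilon>" using assms by (intro cos_monotone_0_pi_le) auto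
    then show ?thesis by (simp add: cos_diff)
  qed
  then show False using less eq by (simp only: cos_abs_real)
qed

lemma cis_diff_eq: "cis a - cis b = cis ((a + b) / 2) * (2 * \<i> * of_real (sin ((a - b) / 2)))"
proof -
  have "cis a = cis ((a + b) / 2) * cis ((a - b) / 2)"
    unfolding cis_mult by (rule arg_cong[of _ _ cis]) (simp add: field_simps)
  moreover have "cis b = cis ((a + b) / 2) * cis (- ((a - b) / 2))"
    unfolding cis_mult by (rule arg_cong[of _ _ cis]) (simp add: field_simps)
  moreover have "cis x - cis (- x) = 2 * \<i> * of_real (sin x)" for x
    by (simp add: complex_eq_iff)
  ultimately show ?thesis by (metis right_diff_distrib)
qed

lemma sum_coeff_squares_linear_factor_le:
  fixes R :: "complex poly"
  assumes "cmod a = 1" "n \<ge> 1"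
  shows "(\<Sum>j\<le>n. (cmod (coeff ([:- a, 1:] * R) j))\<^sup>2) \<le> 4 * (\<Sum>j\<le>n. (cmod (coeff R j))\<^sup>2)"
proof -
  obtain m where m: "n = Suc m" using assms(2) by (cases n) auto
  define r where "r = (\<lambda>j. case j of 0 \<Rightarrow> 0 | Suc i \<Rightarrow> coeff R i)"
  have coeff: "coeff ([:- a, 1:] * R) j = r j - a * coeff R j" for j
    by (cases j) (simp_all add: r_def)
  have sq: "(cmod (x - y))\<^sup>2 \<le> 2 * (cmod x)\<^sup>2 + 2 * (cmod y)\<^sup>2" for x y
  proof -
    have "(cmod (x - y))\<^sup>2 \<le> (cmod x + cmod y)\<^sup>2"
      by (intro power_mono norm_triangle_ineq4) auto
    also have "\<dots> \<le> 2 * (cmod x)\<^sup>2 + 2 * (cmod y)\<^sup>2"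
      using sum_squares_bound[of "cmod x" "cmod y"] by (simp add: power2_sum)
    finally show ?thesis .
  qed
  have "(\<Sum>j\<le>n. (cmod (coeff ([:- a, 1:] * R) j))\<^sup>2)
      \<le> (\<Sum>j\<le>n. 2 * (cmod (r j))\<^sup>2 + 2 * (cmod (coeff R j))\<^sup>2)"
  proof (rule sum_mono)
    fix j
    show "(cmod (coeff ([:- a, 1:] * R) j))\<^sup>2 \<le> 2 * (cmod (r j))\<^sup>2 + 2 * (cmod (coeff R j))\<^sup>2"
      unfolding coeff using sq[of "r j" "a * coeff R j"] assms(1) by (simp add: norm_mult)
  qed
  also have "\<dots> = 2 * (\<Sum>j\<le>n. (cmod (r j))\<^sup>2) + 2 * (\<Sum>j\<le>n. (cmod (coeff R j))\<^sup>2)"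
    by (simp add: sum.distrib sum_distrib_left)
  also have "(\<Sum>j\<le>n. (cmod (r j))\<^sup>2) = (\<Sum>j\<le>m. (cmod (coeff R j))\<^sup>2)"
    unfolding m sum.atMost_Suc_shift by (simp add: r_def)
  also have "\<dots> \<le> (\<Sum>j\<le>n. (cmod (coeff R j))\<^sup>2)" by (simp add: m)
  finally show ?thesis by simp
qed

definition equispaced :: "real \<Rightarrow> nat \<Rightarrow> complex" where
  "equispaced \<epsilon> j = cis (real j * \<epsilon>)"

lemma nodal_poly_equispaced: "nodal_poly \<epsilon> m = (\<Prod>l<m. [:- equispaced \<epsilon> l, 1:])"
  by (simp add: nodal_poly_def equispaced_def)

lemma cmod_equispaced [simp]: "cmod (equispaced \<epsilon> j) = 1"
  by (simp add: equispaced_def)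

text \<open>Each factor depends on \<open>\<bar>k - j\<bar>\<close> up to a sign, which the \<open>n - k\<close> nodes after \<open>k\<close> flip.\<close>
lemma prod_signed_sin:
  assumes "k \<le> n"
  shows "(\<Prod>j\<in>{..n} - {k}. 2 * sin ((real k - real j) * \<epsilon> / 2))
    = (- 1) ^ (n - k) * (sin_prod \<epsilon> k * sin_prod \<epsilon> (n - k))"
proof -
  let ?f = "\<lambda>j. 2 * sin ((real k - real j) * \<epsilon> / 2)"
  have "{..n} - {k} = {..<k} \<union> {k<..n}" "{..<k} \<inter> {k<..n} = {}" using assms by auto
  then have "prod ?f ({..n} - {k}) = prod ?f {..<k} * prod ?f {k<..n}"
    by (simp add: prod.union_disjoint)
  also have "prod ?f {..<k} = sin_prod \<epsilon> k"
  proof -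
    have "sin_prod \<epsilon> k = (\<Prod>i<k. 2 * sin (real ((k - Suc i) + 1) * \<epsilon> / 2))"
      unfolding sin_prod_def by (rule prod.nat_diff_reindex[symmetric])
    also have "\<dots> = prod ?f {..<k}"
    proof (rule prod.cong)
      fix i assume "i \<in> {..<k}"
      then have "real ((k - Suc i) + 1) = real k - real i" by (simp add: of_nat_diff)
      then show "2 * sin (real ((k - Suc i) + 1) * \<epsilon> / 2) = ?f i" by (simp only:)
    qed simp
    finally show ?thesis by simp
  qed
  also have "prod ?f {k<..n} = (\<Prod>i<n - k. - (2 * sin (real (i + 1) * \<epsilon> / 2)))"
  proof (rule prod.reindex_bij_witness[of _ "\<lambda>i. k + 1 + i" "\<lambda>j. j - (k + 1)"])
    fix j assume j: "j \<in> {k<..n}"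
    have "real (j - (k + 1) + 1) = - (real k - real j)" using j by (simp add: of_nat_diff)
    then have "real (j - (k + 1) + 1) * \<epsilon> / 2 = - ((real k - real j) * \<epsilon> / 2)" by (simp only: minus_mult_left minus_divide_left)
    then show "- (2 * sin (real (j - (k + 1) + 1) * \<epsilon> / 2)) = ?f j"
      by (simp only: sin_minus mult_minus_right minus_minus)
  qed auto
  also have "\<dots> = (- 1) ^ (n - k) * sin_prod \<epsilon> (n - k)"
    by (simp add: sin_prod_def prod_uminus)
  finally show ?thesis by simp
qed

context
  fixes n :: nat and \<epsilon> :: real
  assumes n: "n \<ge> 1" and eps: "\<epsilon> > 0" and short: "(real n + 1) * \<epsilon> \<le> 2 * pi"
begin

lemma equispaced_separated:
  assumes "i \<le> n" "j \<le> n" "i \<noteq> j"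
  shows "\<epsilon> \<le> arc_dist (equispaced \<epsilon> i) (equispaced \<epsilon> j)"
proof -
  define d where "d = \<bar>real i - real j\<bar>"
  have d: "1 \<le> d" "d \<le> real n" using assms by (auto simp: d_def abs_le_iff)
  have abs: "\<bar>real i * \<epsilon> - real j * \<epsilon>\<bar> = d * \<epsilon>"
    using eps unfolding d_def by (simp add: abs_mult flip: left_diff_distrib)
  have "1 * \<epsilon> \<le> d * \<epsilon>" "d * \<epsilon> \<le> real n * \<epsilon>" using d eps by (intro mult_right_mono; simp)+
  moreover have "real n * \<epsilon> \<le> 2 * pi - \<epsilon>" using short by (simp add: algebra_simps)
  ultimately have "\<epsilon> \<le> \<bar>Arg (cis (real i * \<epsilon> - real j * \<epsilon>))\<bar>"
    using eps abs by (intro abs_Arg_cis_ge) linarith+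
  then show ?thesis by (simp add: arc_dist_def equispaced_def cis_divide)
qed

lemma equispaced_inj: "inj_on (equispaced \<epsilon>) {..n}"
  using n eps cmod_equispaced equispaced_separated by (rule separated_nodes_inj)

lemma q_binomial_eq: "k \<le> n \<Longrightarrow> q_binomial \<epsilon> n k / sin_prod \<epsilon> n = 1 / (sin_prod \<epsilon> k * sin_prod \<epsilon> (n - k))"
  using sin_prod_pos[OF n eps short, of n] by (simp add: q_binomial_def)

lemma prod_equispaced_dist:
  assumes "k \<le> n"
  shows "(\<Prod>j\<in>{..n} - {k}. cmod (equispaced \<epsilon> k - equispaced \<epsilon> j)) = sin_prod \<epsilon> k * sin_prod \<epsilon> (n - k)"
proof -
  have "cmod (equispaced \<epsilon> k - equispaced \<epsilon> j) = \<bar>2 * sin ((real k - real j) * \<epsilon> / 2)\<bar>" for j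
    unfolding equispaced_def cis_diff_eq by (simp add: norm_mult left_diff_distrib)
  then have "(\<Prod>j\<in>{..n} - {k}. cmod (equispaced \<epsilon> k - equispaced \<epsilon> j))
      = \<bar>\<Prod>j\<in>{..n} - {k}. 2 * sin ((real k - real j) * \<epsilon> / 2)\<bar>"
    by (simp only: abs_prod)
  also have "\<dots> = \<bar>sin_prod \<epsilon> k * sin_prod \<epsilon> (n - k)\<bar>"
    unfolding prod_signed_sin[OF assms] by (simp add: abs_mult power_abs)
  finally show ?thesis
    using sin_prod_pos[OF n eps short, of k] sin_prod_pos[OF n eps short, of "n - k"] assms
    by (simp add: abs_mult)
qed

text \<open>
  In this form the phases are powers of one number, so a single rotation of the variable aligns all
  coefficients.
\<close>
lemma coeff_nodal_poly_geometric:
  "coeff (nodal_poly \<epsilon> n) j = ((- 1) ^ n * cis ((real n - 1) * real n * \<epsilon> / 2))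
     * (- cis (- ((real n - 1) * \<epsilon> / 2))) ^ j * of_real (q_binomial \<epsilon> n j)"
proof (cases "j \<le> n")
  case True
  have "(- 1 :: complex) ^ n = (- 1) ^ j * (- 1) ^ (n - j)" using True by (simp flip: power_add)
  then have "(- 1 :: complex) ^ n * (- 1) ^ j = (- 1) ^ (n - j) * ((- 1) ^ j * (- 1) ^ j)"
    by (simp only: mult_ac)
  also have "(- 1 :: complex) ^ j * (- 1) ^ j = 1" by (simp flip: power_mult_distrib)
  finally have sign: "(- 1 :: complex) ^ n * (- 1) ^ j = (- 1) ^ (n - j)" by simp
  have "cis ((real n - 1) * real n * \<epsilon> / 2) * cis (- ((real n - 1) * \<epsilon> / 2)) ^ j
      = cis ((real n - 1) * real (n - j) * \<epsilon> / 2)"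
    unfolding Complex.DeMoivre cis_mult using True
    by (intro arg_cong[of _ _ cis]) (simp add: of_nat_diff field_simps)
  then have "((- 1) ^ n * cis ((real n - 1) * real n * \<epsilon> / 2)) * (- cis (- ((real n - 1) * \<epsilon> / 2))) ^ j
      = ((- 1) ^ n * (- 1) ^ j) * cis ((real n - 1) * real (n - j) * \<epsilon> / 2)"
    by (simp add: power_minus[of "cis _"])
  then show ?thesis
    unfolding coeff_nodal_poly[OF n eps short order_refl] sign by simp
next
  case False
  then show ?thesis
    unfolding coeff_nodal_poly[OF n eps short order_refl] by (simp add: q_binomial_def)
qed

text \<open>
  At the antipode of the centre of the nodes the phases of all terms agree, so the sum of
  the \<open>q\<close>-binomials is a product of \<open>n\<close> distances.
\<close>
lemma sum_q_binomial_le: "(\<Sum>j\<le>n. q_binomial \<epsilon> n j) \<le> paired_cos_prod n \<epsilon>"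
proof -
  define v where "v = - cis (- ((real n - 1) * \<epsilon> / 2))"
  define u where "u = (- 1) ^ n * cis ((real n - 1) * real n * \<epsilon> / 2)"
  define x where "x = - cis ((real n - 1) * \<epsilon> / 2)"
  have vx: "v * x = 1" by (simp add: v_def x_def cis_mult)
  have ux: "cmod u = 1" "cmod x = 1" by (simp_all add: u_def x_def norm_mult norm_power)
  have "degree (nodal_poly \<epsilon> n) \<le> (\<Sum>l<n. degree [:- cis (real l * \<epsilon>), 1:])"
    unfolding nodal_poly_def by (rule order_trans[OF degree_prod_sum_le]) auto
  then have deg: "degree (nodal_poly \<epsilon> n) \<le> n" by simp
  have "poly (nodal_poly \<epsilon> n) x = (\<Sum>j\<le>n. u * of_real (q_binomial \<epsilon> n j))"
    unfolding poly_eq_sum_le[OF deg] coeff_nodal_poly_geometric u_def[symmetric] v_def[symmetric]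
  proof (intro sum.cong refl)
    fix j
    have "u * v ^ j * of_real (q_binomial \<epsilon> n j) * x ^ j = u * (v * x) ^ j * of_real (q_binomial \<epsilon> n j)"
      by (simp add: power_mult_distrib mult_ac)
    then show "u * v ^ j * of_real (q_binomial \<epsilon> n j) * x ^ j = u * of_real (q_binomial \<epsilon> n j)"
      by (simp add: vx)
  qed
  also have "\<dots> = u * of_real (\<Sum>j\<le>n. q_binomial \<epsilon> n j)" by (simp add: sum_distrib_left)
  finally have "cmod (poly (nodal_poly \<epsilon> n) x) = \<bar>\<Sum>j\<le>n. q_binomial \<epsilon> n j\<bar>"
    using ux by (simp add: norm_mult del: of_real_sum)
  then have "(\<Sum>j\<le>n. q_binomial \<epsilon> n j) \<le> cmod (poly (nodal_poly \<epsilon> n) x)" by simp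
  also have "\<dots> = (\<Prod>l\<in>{..<n}. cmod (x - equispaced \<epsilon> l))"
    by (simp add: nodal_poly_equispaced poly_prod prod_norm[symmetric])
  also have "\<dots> \<le> paired_cos_prod n \<epsilon>"
    by (rule prod_dist_le_paired_cos_prod[OF _ _ eps _ _ ux(2)]) (auto intro: equispaced_separated)
  finally show ?thesis .
qed

lemma q_energy_le: "q_energy \<epsilon> n \<le> q_binomial \<epsilon> n (n div 2) * paired_cos_prod n \<epsilon>"
proof -
  note nonneg = q_binomial_nonneg[OF n eps short]
  have "q_energy \<epsilon> n \<le> (\<Sum>j\<le>n. q_binomial \<epsilon> n (n div 2) * q_binomial \<epsilon> n j)"
    unfolding q_energy_def power2_eq_square
    by (intro sum_mono mult_right_mono q_binomial_le_middle[OF n eps short] nonneg) auto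
  also have "\<dots> = q_binomial \<epsilon> n (n div 2) * (\<Sum>j\<le>n. q_binomial \<epsilon> n j)" by (simp add: sum_distrib_left)
  also have "\<dots> \<le> q_binomial \<epsilon> n (n div 2) * paired_cos_prod n \<epsilon>"
    by (intro mult_left_mono sum_q_binomial_le nonneg)
  finally show ?thesis .
qed

lemma middle_q_binomial_eq: "q_binomial \<epsilon> n (n div 2) / sin_prod \<epsilon> n = 1 / paired_sin_prod n \<epsilon>"
  unfolding paired_sin_prod_eq by (rule q_binomial_eq) simp

text \<open>
  The factor \<open>1 - w\<close> of the division is the distance of a node from the antipode of the centre,
  and the arc of nodes stays away from it by \<open>2 cos (n\<epsilon>/4)\<close>.
\<close>
lemma coeff_deflated_nodal_poly_le:
  assumes k: "k < n"
  shows "cmod (coeff (\<Prod>l\<in>{..<n} - {k}. [:- equispaced \<epsilon> l, 1:]) j)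
    \<le> q_binomial \<epsilon> n j / cos (real n * \<epsilon> / 4)"
proof -
  define R where "R = (\<Prod>l\<in>{..<n} - {k}. [:- equispaced \<epsilon> l, 1:])"
  define v where "v = - cis (- ((real n - 1) * \<epsilon> / 2))"
  define u where "u = (- 1) ^ n * cis ((real n - 1) * real n * \<epsilon> / 2)"
  define X where "X = real n * \<epsilon> / 4"
  have cosX: "cos X > 0" using half_arc_bounds(3)[OF n eps short] by (simp add: X_def)
  have R: "[:- equispaced \<epsilon> k, 1:] * R = nodal_poly \<epsilon> n"
    unfolding nodal_poly_equispaced R_def using k by (intro prod.remove[symmetric]) auto
  have "cmod (1 - equispaced \<epsilon> k * v) * cmod (coeff R j) \<le> 2 * q_binomial \<epsilon> n j"
  proof (rule unimodal_quotient_coeff_le[where c = "n div 2"])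
    show "coeff ([:- equispaced \<epsilon> k, 1:] * R) j = u * v ^ j * of_real (q_binomial \<epsilon> n j)" for j
      unfolding R coeff_nodal_poly_geometric u_def v_def ..
  qed (use q_binomial_increasing[OF n eps short] q_binomial_decreasing[OF n eps short]
      q_binomial_nonneg[OF n eps short] in \<open>auto simp: u_def v_def norm_mult norm_power\<close>)
  moreover have "2 * cos X \<le> cmod (1 - equispaced \<epsilon> k * v)"
  proof -
    define y where "y = real k * \<epsilon> - (real n - 1) * \<epsilon> / 2"
    have "equispaced \<epsilon> k * v = - cis y"
      by (simp add: equispaced_def v_def cis_mult y_def)
    then have "cmod (1 - equispaced \<epsilon> k * v) = 2 * \<bar>cos (y / 2)\<bar>"
      using cmod_cis_plus_one[of y] by (simp add: add.commute)
    moreover have "cos X \<le> cos \<bar>y / 2\<bar>"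
    proof (rule cos_monotone_0_pi_le)
      have "\<bar>2 * real k - (real n - 1)\<bar> * (\<epsilon> / 4) \<le> real n * (\<epsilon> / 4)"
        using k eps by (intro mult_right_mono) (auto simp: abs_le_iff)
      moreover have half: "y / 2 = (2 * real k - (real n - 1)) * (\<epsilon> / 4)" by (simp add: y_def field_simps)
      have "\<bar>y / 2\<bar> = \<bar>2 * real k - (real n - 1)\<bar> * (\<epsilon> / 4)"
        unfolding half abs_mult using eps by simp
      ultimately show "\<bar>y / 2\<bar> \<le> X" by (simp add: X_def)
      show "X \<le> pi" using half_arc_bounds(2)[OF n eps short] pi_gt_zero unfolding X_def by linarith
    qed simp
    ultimately show ?thesis by (simp only: cos_abs_real)
  qed
  ultimately have "2 * cos X * cmod (coeff R j) \<le> 2 * q_binomial \<epsilon> n j"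
    by (meson mult_right_mono norm_ge_zero order_trans)
  then have "cmod (coeff R j) \<le> q_binomial \<epsilon> n j / cos X"
    using cosX by (simp add: pos_le_divide_eq mult.commute)
  then show ?thesis unfolding R_def X_def .
qed

text \<open>
  Up to its leading coefficient, \<open>L\<^sub>k\<close> is \<open>nodal_poly \<epsilon> n\<close> with the zero at node \<open>k\<close> moved to node
  \<open>n\<close>; dividing costs \<open>1 / cos (n\<epsilon>/4)\<close> and multiplying a factor \<open>2\<close>.
\<close>
lemma lagrange_basis_coeff_squares_le:
  assumes k: "k \<le> n"
  shows "(\<Sum>j\<le>n. (cmod (coeff (lagrange_basis n (equispaced \<epsilon>) k) j))\<^sup>2)
    \<le> (2 * q_binomial \<epsilon> n k / (cos (real n * \<epsilon> / 4) * sin_prod \<epsilon> n))\<^sup>2 * q_energy \<epsilon> n"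
proof -
  define c where "c = cos (real n * \<epsilon> / 4)"
  have c: "0 < c" "c \<le> 1" using half_arc_bounds(3,4)[OF n eps short] by (simp_all add: c_def)
  define P where "P = (\<Prod>l\<in>{..n} - {k}. [:- equispaced \<epsilon> l, 1:])"
  define d where "d = q_binomial \<epsilon> n k / sin_prod \<epsilon> n"
  have "lagrange_basis n (equispaced \<epsilon>) k
      = Polynomial.smult (\<Prod>l\<in>{..n} - {k}. 1 / (equispaced \<epsilon> k - equispaced \<epsilon> l)) P"
    unfolding lagrange_basis_def P_def by (rule prod_smult)
  moreover have "cmod (\<Prod>l\<in>{..n} - {k}. 1 / (equispaced \<epsilon> k - equispaced \<epsilon> l)) = d"
    unfolding d_def q_binomial_eq[OF k] prod_equispaced_dist[OF k, symmetric]
    by (simp add: prod_norm[symmetric] norm_divide prod_dividef)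
  ultimately have "(\<Sum>j\<le>n. (cmod (coeff (lagrange_basis n (equispaced \<epsilon>) k) j))\<^sup>2)
      = d\<^sup>2 * (\<Sum>j\<le>n. (cmod (coeff P j))\<^sup>2)"
    by (simp add: norm_mult power_mult_distrib sum_distrib_left)
  also have "(\<Sum>j\<le>n. (cmod (coeff P j))\<^sup>2) \<le> 4 * (q_energy \<epsilon> n / c\<^sup>2)"
  proof (cases "k = n")
    case True
    then have "{..n} - {k} = {..<n}" by auto
    then have "P = nodal_poly \<epsilon> n" by (simp add: P_def nodal_poly_equispaced)
    then have "(\<Sum>j\<le>n. (cmod (coeff P j))\<^sup>2) = q_energy \<epsilon> n"
      by (simp add: coeff_nodal_poly_geometric q_energy_def norm_mult norm_power)
    moreover have "q_energy \<epsilon> n \<ge> 0" by (simp add: q_energy_def sum_nonneg)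
    moreover have "1 \<le> 4 / c\<^sup>2" using c power_le_one[of c 2] by (simp add: pos_le_divide_eq)
    ultimately show ?thesis
      using mult_left_mono[of 1 "4 / c\<^sup>2" "q_energy \<epsilon> n"] by (simp add: mult.commute)
  next
    case False
    then have kn: "k < n" using k by simp
    define R where "R = (\<Prod>l\<in>{..<n} - {k}. [:- equispaced \<epsilon> l, 1:])"
    have "{..n} - {k} = insert n ({..<n} - {k})" using kn by auto
    then have "P = [:- equispaced \<epsilon> n, 1:] * R" by (simp add: P_def R_def)
    then have "(\<Sum>j\<le>n. (cmod (coeff P j))\<^sup>2) \<le> 4 * (\<Sum>j\<le>n. (cmod (coeff R j))\<^sup>2)"
      using n by (simp only:) (intro sum_coeff_squares_linear_factor_le; simp)
    also have "(\<Sum>j\<le>n. (cmod (coeff R j))\<^sup>2) \<le> (\<Sum>j\<le>n. (q_binomial \<epsilon> n j / c)\<^sup>2)"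
      unfolding R_def c_def by (intro sum_mono power_mono coeff_deflated_nodal_poly_le[OF kn]) auto
    also have "\<dots> = q_energy \<epsilon> n / c\<^sup>2"
      by (simp add: q_energy_def power_divide sum_divide_distrib)
    finally show ?thesis by simp
  qed
  finally have "(\<Sum>j\<le>n. (cmod (coeff (lagrange_basis n (equispaced \<epsilon>) k) j))\<^sup>2)
      \<le> d\<^sup>2 * (4 * (q_energy \<epsilon> n / c\<^sup>2))" by (simp add: mult_left_mono)
  also have "\<dots> = (2 * q_binomial \<epsilon> n k / (c * sin_prod \<epsilon> n))\<^sup>2 * q_energy \<epsilon> n"
    by (simp add: d_def power_divide power_mult_distrib mult_ac)
  finally show ?thesis by (simp add: c_def)
qed

lemma norm_inv_equispaced_le:
  "norm_inv_vandermonde n (equispaced \<epsilon>)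
     \<le> 2 / cos (real n * \<epsilon> / 4) * (paired_cos_prod n \<epsilon> / paired_sin_prod n \<epsilon>)"
proof -
  define c where "c = cos (real n * \<epsilon> / 4)"
  have c: "0 < c" using half_arc_bounds(3)[OF n eps short] by (simp add: c_def)
  have S: "sin_prod \<epsilon> n > 0" by (rule sin_prod_pos[OF n eps short]) simp
  have E: "q_energy \<epsilon> n \<ge> 0" by (simp add: q_energy_def sum_nonneg)
  have "(\<Sum>k\<le>n. \<Sum>j\<le>n. (cmod (coeff (lagrange_basis n (equispaced \<epsilon>) k) j))\<^sup>2)
      \<le> (\<Sum>k\<le>n. (2 * q_binomial \<epsilon> n k / (c * sin_prod \<epsilon> n))\<^sup>2 * q_energy \<epsilon> n)"
    unfolding c_def by (intro sum_mono lagrange_basis_coeff_squares_le) auto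
  also have "\<dots> = (2 / (c * sin_prod \<epsilon> n) * q_energy \<epsilon> n)\<^sup>2"
    by (simp add: q_energy_def power_divide power_mult_distrib sum_distrib_left sum_distrib_right
        sum_divide_distrib power2_eq_square mult_ac)
  finally have "norm_inv_vandermonde n (equispaced \<epsilon>) \<le> sqrt ((2 / (c * sin_prod \<epsilon> n) * q_energy \<epsilon> n)\<^sup>2)"
    using norm_inv_vandermonde_le[OF equispaced_inj] by (meson order_trans real_sqrt_le_mono)
  also have "\<dots> = 2 / (c * sin_prod \<epsilon> n) * q_energy \<epsilon> n" using c S E by simp
  also have "\<dots> \<le> 2 / (c * sin_prod \<epsilon> n) * (q_binomial \<epsilon> n (n div 2) * paired_cos_prod n \<epsilon>)"
    using c S by (intro mult_left_mono q_energy_le) auto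
  also have "\<dots> = 2 / c * paired_cos_prod n \<epsilon> * (q_binomial \<epsilon> n (n div 2) / sin_prod \<epsilon> n)" by simp
  also have "\<dots> = 2 / c * (paired_cos_prod n \<epsilon> / paired_sin_prod n \<epsilon>)"
    unfolding middle_q_binomial_eq by simp
  finally show ?thesis by (simp only: c_def)
qed

section \<open>The lower bound for equispaced nodes\<close>

text \<open>
  A chord is \<open>2\<i> sin\<close> of half the angle difference times the phase of the mean angle. The phase of
  \<open>L\<^sub>k(cis a)\<close> is therefore a function of \<open>a\<close> times a function of \<open>k\<close>, as long as the sines in the
  product do not change sign.
\<close>
lemma lagrange_basis_equispaced:
  assumes k: "k \<le> n"
  shows "poly (lagrange_basis n (equispaced \<epsilon>) k) (cis a)
    = cis ((a - real k * \<epsilon>) / 2) ^ n * (- 1) ^ (n - k)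
      * of_real ((\<Prod>j\<in>{..n} - {k}. 2 * sin ((a - real j * \<epsilon>) / 2)) * (q_binomial \<epsilon> n k / sin_prod \<epsilon> n))"
proof -
  let ?J = "{..n} - {k}"
  let ?s = "\<lambda>j. 2 * sin ((a - real j * \<epsilon>) / 2)"
  let ?t = "\<lambda>j. 2 * sin ((real k - real j) * \<epsilon> / 2)"
  have "(cis a - equispaced \<epsilon> j) / (equispaced \<epsilon> k - equispaced \<epsilon> j)
      = cis ((a - real k * \<epsilon>) / 2) * of_real (?s j / ?t j)" for j
  proof -
    have "cis ((a + real j * \<epsilon>) / 2) = cis ((a - real k * \<epsilon>) / 2) * cis ((real k * \<epsilon> + real j * \<epsilon>) / 2)"
      unfolding cis_mult by (rule arg_cong[of _ _ cis]) (simp add: field_simps)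
    then show ?thesis
      unfolding equispaced_def cis_diff_eq by (simp add: left_diff_distrib)
  qed
  then have "poly (lagrange_basis n (equispaced \<epsilon>) k) (cis a)
      = (\<Prod>j\<in>?J. cis ((a - real k * \<epsilon>) / 2) * of_real (?s j / ?t j))"
    unfolding poly_lagrange_basis by (simp only:)
  also have "\<dots> = cis ((a - real k * \<epsilon>) / 2) ^ n * of_real (prod ?s ?J / prod ?t ?J)"
    using k unfolding prod.distrib prod_constant of_real_prod[symmetric] prod_dividef by simp
  also have "prod ?s ?J / prod ?t ?J
      = (- 1) ^ (n - k) * (prod ?s ?J * (1 / (sin_prod \<epsilon> k * sin_prod \<epsilon> (n - k))))"
    unfolding prod_signed_sin[OF k] by (simp add: minus_one_power_iff)
  finally show ?thesis unfolding q_binomial_eq[OF k] by (simp add: mult.assoc)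
qed

text \<open>
  Half the distance between the node \<open>j\<close> and the point at angle \<open>\<psi>\<close> from the antipode of the
  centre of the nodes.
\<close>
definition arc_factor :: "real \<Rightarrow> nat \<Rightarrow> real" where
  "arc_factor \<psi> j = cos ((\<psi> - (real j - real n / 2) * \<epsilon>) / 2)"

context
  fixes \<psi> :: real
  assumes window: "\<bar>\<psi>\<bar> \<le> cos (real n * \<epsilon> / 4) / sqrt (real n)"
begin

lemma window_bound: "\<bar>\<psi>\<bar> / 2 + real n * \<epsilon> / 4 < pi / 2"
proof -
  define X where "X = real n * \<epsilon> / 4"
  have X: "0 < X" "X < pi / 2" "0 < cos X" using half_arc_bounds[OF n eps short] by (simp_all only: X_def)
  have "cos X / sqrt (real n) \<le> cos X / 1" using n X by (intro divide_left_mono) auto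
  then have a: "\<bar>\<psi>\<bar> \<le> cos X" using window by (simp add: X_def)
  have "cos X = sin (pi / 2 - X)" by (simp add: sin_diff)
  also have "\<dots> \<le> pi / 2 - X" using X by (intro sin_x_le_x) simp
  finally have "\<bar>\<psi>\<bar> / 2 + X < pi / 2" using a X by linarith
  then show "\<bar>\<psi>\<bar> / 2 + real n * \<epsilon> / 4 < pi / 2" by (simp only: X_def)
qed

lemma arc_factor_pos: "j \<le> n \<Longrightarrow> 0 < arc_factor \<psi> j"
proof -
  assume j: "j \<le> n"
  have "\<bar>real j - real n / 2\<bar> * (\<epsilon> / 2) \<le> real n / 2 * (\<epsilon> / 2)"
  proof (intro mult_right_mono)
    have "real j \<le> real n" using j by simp
    then show "\<bar>real j - real n / 2\<bar> \<le> real n / 2" unfolding abs_le_iff by linarith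
  qed (use eps in simp)
  moreover have "\<bar>(real j - real n / 2) * \<epsilon> / 2\<bar> = \<bar>real j - real n / 2\<bar> * (\<epsilon> / 2)"
    using eps by (simp add: abs_mult)
  moreover have "real n / 2 * (\<epsilon> / 2) = real n * \<epsilon> / 4" by simp
  ultimately have "\<bar>(real j - real n / 2) * \<epsilon> / 2\<bar> \<le> real n * \<epsilon> / 4" by linarith
  moreover have "(\<psi> - (real j - real n / 2) * \<epsilon>) / 2 = \<psi> / 2 - (real j - real n / 2) * \<epsilon> / 2"
    by (rule diff_divide_distrib)
  ultimately have "\<bar>(\<psi> - (real j - real n / 2) * \<epsilon>) / 2\<bar> < pi / 2"
    using window_bound by linarith
  then show ?thesis unfolding arc_factor_def by (intro cos_gt_zero_pi) linarith+
qed

text \<open>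
  Nodes \<open>j\<close> and \<open>n - j\<close> are symmetric about the centre, at angles \<open>\<plusminus>2x\<close>, and
  \<open>cos (\<psi>/2 - x) cos (\<psi>/2 + x) = cos\<^sup>2 x - sin\<^sup>2 (\<psi>/2)\<close>. On the window the relative loss is at most \<open>1/(4n)\<close>
  for each pair, so that the product over all pairs loses at most a constant factor.
\<close>
lemma prod_arc_factor_ge: "centred_cos_prod n \<epsilon> / 2 \<le> (\<Prod>j\<le>n. 2 * arc_factor \<psi> j)"
proof -
  define x where "x = (\<lambda>j. (real j - real n / 2) * \<epsilon> / 2)"
  define X where "X = real n * \<epsilon> / 4"
  have X: "0 < cos X" using half_arc_bounds[OF n eps short] by (simp_all only: X_def)
  have cosx: "cos X \<le> cos (x j)" if "j \<le> n" for j
    using centred_cos_pos[OF n eps short that] by (simp only: x_def X_def)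
  have pair: "(1 - 1 / (4 * real n)) * (2 * cos (x j))\<^sup>2
      \<le> (2 * arc_factor \<psi> j) * (2 * arc_factor \<psi> (n - j))" if j: "j \<le> n" for j
  proof -
    have "arc_factor \<psi> j = cos (\<psi> / 2 - x j)"
      by (simp add: arc_factor_def x_def diff_divide_distrib)
    moreover have "arc_factor \<psi> (n - j) = cos (\<psi> / 2 + x j)"
      unfolding arc_factor_def x_def using j
      by (intro arg_cong[of _ _ cos]) (simp add: of_nat_diff field_simps)
    ultimately have eq: "arc_factor \<psi> j * arc_factor \<psi> (n - j) = (cos (x j))\<^sup>2 - (sin (\<psi> / 2))\<^sup>2"
    proof -
      assume e: "arc_factor \<psi> j = cos (\<psi> / 2 - x j)" "arc_factor \<psi> (n - j) = cos (\<psi> / 2 + x j)"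
      have "cos (a - b) * cos (a + b) = (cos b)\<^sup>2 - (sin a)\<^sup>2" for a b :: real
      proof -
        have "cos (a - b) * cos (a + b) = (cos a)\<^sup>2 * (cos b)\<^sup>2 - (sin a)\<^sup>2 * (sin b)\<^sup>2"
          by (simp add: cos_add cos_diff power2_eq_square algebra_simps)
        also have "\<dots> = (cos b)\<^sup>2 - (sin a)\<^sup>2"
          by (simp add: sin_squared_eq algebra_simps)
        finally show ?thesis .
      qed
      then show ?thesis by (simp only: e)
    qed
    have "(sin (\<psi> / 2))\<^sup>2 \<le> (\<psi> / 2)\<^sup>2"
      using abs_sin_x_le_abs_x by (rule abs_le_square_iff[THEN iffD1])
    also have "\<dots> \<le> (cos X / sqrt (real n) / 2)\<^sup>2"
      using window X by (intro power2_mono) (simp add: X_def abs_divide)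
    also have "\<dots> = 1 / (4 * real n) * (cos X)\<^sup>2"
      by (simp add: power_divide)
    also have "\<dots> \<le> 1 / (4 * real n) * (cos (x j))\<^sup>2"
      using cosx[OF j] X by (intro mult_left_mono power_mono) auto
    finally have "(1 - 1 / (4 * real n)) * (cos (x j))\<^sup>2 \<le> arc_factor \<psi> j * arc_factor \<psi> (n - j)"
      unfolding eq by (simp add: left_diff_distrib)
    then show ?thesis by (simp add: power_mult_distrib)
  qed
  let ?p = "\<Prod>j\<le>n. 2 * arc_factor \<psi> j"
  have "(1 / 2) * (centred_cos_prod n \<epsilon>)\<^sup>2 \<le> (1 - 1 / (4 * real n)) ^ (n + 1) * (centred_cos_prod n \<epsilon>)\<^sup>2"
  proof (rule mult_right_mono)
    have "1 / 2 \<le> 1 + real (n + 1) * (- 1 / (4 * real n))" using n by (simp add: field_simps)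
    also have "\<dots> \<le> (1 + (- 1 / (4 * real n))) ^ (n + 1)"
      using n by (intro Bernoulli_inequality) (simp add: field_simps)
    finally show "1 / 2 \<le> (1 - 1 / (4 * real n)) ^ (n + 1)" by simp
  qed simp
  also have "\<dots> = (\<Prod>j\<le>n. (1 - 1 / (4 * real n)) * (2 * cos (x j))\<^sup>2)"
  proof -
    have "(\<Prod>j\<le>n. b * (f j)\<^sup>2) = b ^ (n + 1) * (prod f {..n})\<^sup>2" for b and f :: "nat \<Rightarrow> real"
      by (simp add: prod.distrib prod_power_distrib)
    from this[of "1 - 1 / (4 * real n)" "\<lambda>j. 2 * cos (x j)"]
    show ?thesis unfolding centred_cos_prod_def x_def by (rule sym)
  qed
  also have "\<dots> \<le> (\<Prod>j\<le>n. (2 * arc_factor \<psi> j) * (2 * arc_factor \<psi> (n - j)))"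
  proof (intro prod_mono conjI)
    fix j assume "j \<in> {..n}"
    then show "(1 - 1 / (4 * real n)) * (2 * cos (x j))\<^sup>2 \<le> (2 * arc_factor \<psi> j) * (2 * arc_factor \<psi> (n - j))"
      by (intro pair) simp
    show "0 \<le> (1 - 1 / (4 * real n)) * (2 * cos (x j))\<^sup>2"
      using n by (intro mult_nonneg_nonneg) (auto simp: field_simps)
  qed
  also have "\<dots> = ?p * (\<Prod>j\<le>n. 2 * arc_factor \<psi> (n - j))" by (rule prod.distrib)
  also have "(\<Prod>j\<le>n. 2 * arc_factor \<psi> (n - j)) = ?p"
    by (rule prod.reindex_bij_witness[of _ "\<lambda>j. n - j" "\<lambda>j. n - j"]) auto
  also have "?p * ?p = ?p\<^sup>2" by (simp add: power2_eq_square)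
  finally have sq: "(1 / 2) * (centred_cos_prod n \<epsilon>)\<^sup>2 \<le> ?p\<^sup>2" .
  have "(centred_cos_prod n \<epsilon> / 2)\<^sup>2 \<le> (1 / 2) * (centred_cos_prod n \<epsilon>)\<^sup>2"
    by (simp add: power_divide)
  then have "(centred_cos_prod n \<epsilon> / 2)\<^sup>2 \<le> ?p\<^sup>2" using sq by linarith
  then show ?thesis
    by (rule power2_le_imp_le) (use arc_factor_pos in \<open>force intro!: prod_nonneg intro: less_imp_le\<close>)
qed

lemma prod_arc_factor_remove_ge:
  assumes k: "k \<le> n"
  shows "centred_cos_prod n \<epsilon> / 4 \<le> (\<Prod>j\<in>{..n} - {k}. 2 * arc_factor \<psi> j)"
proof -
  let ?q = "\<Prod>j\<in>{..n} - {k}. 2 * arc_factor \<psi> j"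
  have "(\<Prod>j\<le>n. 2 * arc_factor \<psi> j) = (2 * arc_factor \<psi> k) * ?q"
    using k by (intro prod.remove) auto
  also have "\<dots> \<le> 2 * ?q"
  proof (rule mult_right_mono)
    show "0 \<le> ?q" using arc_factor_pos by (intro prod_nonneg) (force intro: less_imp_le)
  qed (simp add: arc_factor_def)
  finally show ?thesis using prod_arc_factor_ge by simp
qed

end

text \<open>
  The phases cancel those in \<open>lagrange_basis_equispaced\<close> that depend on \<open>k\<close>. The weights \<open>q_binomial\<close> are
  roughly proportional to the sizes of the \<open>L\<^sub>k\<close>, which is the best choice for a vector of given norm.
\<close>
definition coherent_coeff :: "nat \<Rightarrow> complex" where
  "coherent_coeff k = cis (real k * \<epsilon> / 2) ^ n * (- 1) ^ (n - k) * of_real (q_binomial \<epsilon> n k)"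

definition coherent_poly :: "complex poly" where
  "coherent_poly = (\<Sum>k\<le>n. Polynomial.smult (coherent_coeff k) (lagrange_basis n (equispaced \<epsilon>) k))"

lemma coherent_poly_ge:
  assumes window: "\<bar>\<psi>\<bar> \<le> cos (real n * \<epsilon> / 4) / sqrt (real n)"
  shows "q_energy \<epsilon> n / sin_prod \<epsilon> n * (centred_cos_prod n \<epsilon> / 4)
    \<le> cmod (poly coherent_poly (cis (pi + real n * \<epsilon> / 2 + \<psi>)))"
proof -
  define a where "a = pi + real n * \<epsilon> / 2 + \<psi>"
  have S: "sin_prod \<epsilon> n > 0" by (rule sin_prod_pos[OF n eps short]) simp
  define g where "g = (\<lambda>k. (\<Prod>j\<in>{..n} - {k}. 2 * arc_factor \<psi> j) * ((q_binomial \<epsilon> n k)\<^sup>2 / sin_prod \<epsilon> n))"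
  have summand: "coherent_coeff k * poly (lagrange_basis n (equispaced \<epsilon>) k) (cis a) = cis (a / 2) ^ n * of_real (g k)"
    if k: "k \<le> n" for k
  proof -
    have "sin ((a - real j * \<epsilon>) / 2) = arc_factor \<psi> j" for j
    proof -
      have "(a - real j * \<epsilon>) / 2 = pi / 2 + (\<psi> - (real j - real n / 2) * \<epsilon>) / 2"
        by (simp add: a_def field_simps)
      then show ?thesis unfolding arc_factor_def
        by (simp only: sin_add sin_pi_half cos_pi_half mult_1_left mult_zero_left add_0_right)
    qed
    then have L: "poly (lagrange_basis n (equispaced \<epsilon>) k) (cis a)
        = cis ((a - real k * \<epsilon>) / 2) ^ n * (- 1) ^ (n - k)
          * of_real ((\<Prod>j\<in>{..n} - {k}. 2 * arc_factor \<psi> j) * (q_binomial \<epsilon> n k / sin_prod \<epsilon> n))"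
      using lagrange_basis_equispaced[OF k, of a] by simp
    have phase: "cis (real k * \<epsilon> / 2) ^ n * cis ((a - real k * \<epsilon>) / 2) ^ n = cis (a / 2) ^ n"
      unfolding power_mult_distrib[symmetric] cis_mult
      by (intro arg_cong[of _ _ "\<lambda>t. cis t ^ n"]) (simp add: field_simps)
    have sign: "(- 1 :: complex) ^ (n - k) * (- 1) ^ (n - k) = 1"
      by (simp flip: power_mult_distrib)
    have "coherent_coeff k * poly (lagrange_basis n (equispaced \<epsilon>) k) (cis a)
        = (cis (real k * \<epsilon> / 2) ^ n * cis ((a - real k * \<epsilon>) / 2) ^ n) * ((- 1) ^ (n - k) * (- 1) ^ (n - k))
          * of_real (g k)"
      unfolding L coherent_coeff_def g_def power2_eq_square by simp
    then show ?thesis unfolding phase sign by simp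
  qed
  have "poly coherent_poly (cis a) = (\<Sum>k\<le>n. cis (a / 2) ^ n * of_real (g k))"
    unfolding coherent_poly_def by (simp add: poly_sum summand)
  also have "\<dots> = cis (a / 2) ^ n * of_real (\<Sum>k\<le>n. g k)" by (simp add: sum_distrib_left)
  finally have "cmod (poly coherent_poly (cis a)) = \<bar>\<Sum>k\<le>n. g k\<bar>"
    by (simp add: norm_mult norm_power del: of_real_sum)
  moreover have "(\<Sum>k\<le>n. centred_cos_prod n \<epsilon> / 4 * ((q_binomial \<epsilon> n k)\<^sup>2 / sin_prod \<epsilon> n)) \<le> (\<Sum>k\<le>n. g k)"
    unfolding g_def using S by (intro sum_mono mult_right_mono prod_arc_factor_remove_ge[OF window]) auto
  moreover have "(\<Sum>k\<le>n. centred_cos_prod n \<epsilon> / 4 * ((q_binomial \<epsilon> n k)\<^sup>2 / sin_prod \<epsilon> n))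
      = q_energy \<epsilon> n / sin_prod \<epsilon> n * (centred_cos_prod n \<epsilon> / 4)"
    unfolding q_energy_def sum_distrib_left[symmetric] sum_divide_distrib[symmetric]
    by (simp add: mult_ac)
  ultimately show ?thesis unfolding a_def[symmetric] by linarith
qed

text \<open>
  Parseval on a window of width of order \<open>cos (n\<epsilon>/4) / \<surd>n\<close> loses a factor of order \<open>n\<^bsup>1/4\<^esup>\<close>, and
  \<open>q_energy_ge\<close> gains it back.
\<close>
lemma norm_inv_equispaced_ge:
  "exp (-7) / 4 * sqrt (cos (real n * \<epsilon> / 4) / pi) * (centred_cos_prod n \<epsilon> / paired_sin_prod n \<epsilon>)
     \<le> norm_inv_vandermonde n (equispaced \<epsilon>)"
proof -
  define c where "c = cos (real n * \<epsilon> / 4)"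
  have c: "0 < c" "c \<le> 1" using half_arc_bounds(3,4)[OF n eps short] by (simp_all add: c_def)
  define s where "s = sqrt (real n)"
  have s: "s \<ge> 1" using n by (simp add: s_def)
  define E where "E = q_energy \<epsilon> n"
  define S where "S = sin_prod \<epsilon> n"
  define M where "M = centred_cos_prod n \<epsilon>"
  define m where "m = q_binomial \<epsilon> n (n div 2)"
  have S: "S > 0" unfolding S_def by (rule sin_prod_pos[OF n eps short]) simp
  have M: "M > 0" unfolding M_def by (rule centred_cos_prod_pos[OF n eps short])
  have m: "m > 0" unfolding m_def by (rule q_binomial_pos[OF n eps short]) simp
  have E_ge: "exp (-14) * s * m\<^sup>2 \<le> E"
    unfolding s_def m_def E_def by (rule q_energy_ge[OF n eps short])
  moreover have "exp (-14) * s * m\<^sup>2 > 0" using s m by simp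
  ultimately have E: "E > 0" by linarith
  define B where "B = E / S * (M / 4)"
  have B: "B > 0" using E S M by (simp add: B_def)
  have "degree coherent_poly \<le> n"
    unfolding coherent_poly_def
    by (intro degree_sum_le) (auto intro: order_trans[OF degree_smult_le] degree_lagrange_basis)
  then have low: "c / s / pi * B\<^sup>2 \<le> (\<Sum>j\<le>n. (cmod (coeff coherent_poly j))\<^sup>2)"
  proof (rule sum_coeff_squares_ge)
    have "c / s \<le> 1" using c s by (simp add: pos_divide_le_eq)
    then show "c / s \<le> pi" using pi_gt3 by linarith
    show "B \<le> cmod (poly coherent_poly (cis (pi + real n * \<epsilon> / 2 + \<psi>)))" if "\<bar>\<psi>\<bar> \<le> c / s" for \<psi>
      unfolding B_def E_def S_def M_def by (rule coherent_poly_ge) (use that in \<open>simp only: c_def s_def\<close>)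
  qed (use c s B in auto)
  have "(\<Sum>k\<le>n. (cmod (coherent_coeff k))\<^sup>2) = E"
    by (simp add: coherent_coeff_def norm_mult norm_power E_def q_energy_def)
  then have "sqrt (\<Sum>j\<le>n. (cmod (coeff coherent_poly j))\<^sup>2)
      \<le> norm_inv_vandermonde n (equispaced \<epsilon>) * sqrt E"
    using norm_inv_vandermonde_ge[OF equispaced_inj, of coherent_coeff]
    unfolding coherent_poly_def[symmetric] by simp
  then have "sqrt (c / s / pi * B\<^sup>2) \<le> norm_inv_vandermonde n (equispaced \<epsilon>) * sqrt E"
    using low by (meson order_trans real_sqrt_le_mono)
  moreover have "sqrt (c / s / pi * B\<^sup>2) = (sqrt (c / s / pi) * sqrt E * (M / (4 * S))) * sqrt E"
  proof -
    have "sqrt (c / s / pi * B\<^sup>2) = sqrt (c / s / pi) * B"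
      using B by (simp only: real_sqrt_mult real_sqrt_abs abs_of_pos)
    moreover have "B = (sqrt E * sqrt E) * (M / (4 * S))" using E by (simp add: B_def)
    ultimately show ?thesis by (simp only: mult_ac)
  qed
  ultimately have "(sqrt (c / s / pi) * sqrt E * (M / (4 * S))) * sqrt E
      \<le> norm_inv_vandermonde n (equispaced \<epsilon>) * sqrt E" by (simp only:)
  then have main: "sqrt (c / s / pi) * sqrt E * (M / (4 * S)) \<le> norm_inv_vandermonde n (equispaced \<epsilon>)"
    by (rule mult_right_le_imp_le) (use E in simp)
  have "sqrt (c / s / pi) * sqrt (exp (-14) * s * m\<^sup>2) = sqrt (c / s / pi * (exp (-14) * s * m\<^sup>2))"
    by (rule real_sqrt_mult[symmetric])
  also have "c / s / pi * (exp (-14) * s * m\<^sup>2) = c / pi * (exp (-7) * m)\<^sup>2"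
  proof -
    have "exp (-14 :: real) = (exp (-7))\<^sup>2" by (simp flip: exp_double)
    then show ?thesis using s by (simp add: power_mult_distrib)
  qed
  also have "sqrt \<dots> = sqrt (c / pi) * (exp (-7) * m)"
    using m by (simp only: real_sqrt_mult real_sqrt_abs abs_of_pos exp_gt_zero mult_pos_pos)
  finally have "sqrt (c / pi) * (exp (-7) * m) = sqrt (c / s / pi) * sqrt (exp (-14) * s * m\<^sup>2)"
    by (rule sym)
  also have "\<dots> \<le> sqrt (c / s / pi) * sqrt E"
    using c s by (intro mult_left_mono real_sqrt_le_mono E_ge) simp
  finally have "sqrt (c / pi) * (exp (-7) * m) \<le> sqrt (c / s / pi) * sqrt E" .
  then have "sqrt (c / pi) * (exp (-7) * m) * (M / (4 * S)) \<le> sqrt (c / s / pi) * sqrt E * (M / (4 * S))"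
    using M S by (intro mult_right_mono) auto
  moreover have "sqrt (c / pi) * (exp (-7) * m) * (M / (4 * S))
      = exp (-7) / 4 * sqrt (c / pi) * (M * (m / S))" by simp
  moreover have "m / S = 1 / paired_sin_prod n \<epsilon>" unfolding m_def S_def by (rule middle_q_binomial_eq)
  ultimately show ?thesis using main by (simp add: c_def M_def)
qed

lemma ln_norm_inv_equispaced:
  "\<bar>ln (norm_inv_vandermonde n (equispaced \<epsilon>)) - (real n * main_term n \<epsilon> - ln (real n))\<bar>
     \<le> 60 * (1 + \<bar>ln (real n * \<epsilon> * (2 * pi - real n * \<epsilon>))\<bar>)"
proof -
  define c where "c = cos (real n * \<epsilon> / 4)"
  have c: "0 < c" using half_arc_bounds(3)[OF n eps short] by (simp add: c_def)
  define U where "U = paired_cos_prod n \<epsilon> / paired_sin_prod n \<epsilon>"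
  define V where "V = centred_cos_prod n \<epsilon> / paired_sin_prod n \<epsilon>"
  have UV: "U > 0" "V > 0"
    using paired_cos_prod_pos[OF n eps short] paired_sin_prod_pos[OF n eps short]
      centred_cos_prod_pos[OF n eps short] by (simp_all add: U_def V_def)
  have "ln (norm_inv_vandermonde n (equispaced \<epsilon>)) \<le> ln (2 / c * U)"
    unfolding c_def U_def
    by (rule ln_mono[OF norm_inv_equispaced_le norm_inv_vandermonde_pos[OF equispaced_inj]])
  also have "\<dots> = ln 2 - ln c + ln U" using c UV by (simp add: ln_mult_pos ln_divide_pos)
  finally have up: "ln (norm_inv_vandermonde n (equispaced \<epsilon>)) \<le> ln 2 - ln c + ln U" .
  have "0 < exp (-7) / 4 * sqrt (c / pi) * V" using c UV by (intro mult_pos_pos) auto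
  then have "ln (exp (-7) / 4 * sqrt (c / pi) * V) \<le> ln (norm_inv_vandermonde n (equispaced \<epsilon>))"
    unfolding c_def V_def
    by (rule ln_mono[OF norm_inv_equispaced_ge])
  moreover have "ln (exp (-7) / 4 * sqrt (c / pi) * V) = - 7 - 2 * ln 2 + (ln c - ln pi) / 2 + ln V"
  proof -
    have "ln (4 :: real) = ln (2 * 2)" by simp
    also have "\<dots> = 2 * ln 2" by (subst ln_mult_pos) auto
    finally have "ln (4 :: real) = 2 * ln 2" .
    moreover have "ln (exp (-7) / 4 * sqrt (c / pi) * V) = ln (exp (-7) / 4 * sqrt (c / pi)) + ln V"
      using c UV by (intro ln_mult_pos) auto
    moreover have "ln (exp (-7) / 4 * sqrt (c / pi)) = ln (exp (-7) / 4) + ln (sqrt (c / pi))"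
      using c by (intro ln_mult_pos) auto
    moreover have "ln (exp (-7) / (4 :: real)) = - 7 - ln 4" by (subst ln_divide_pos) auto
    moreover have "ln (sqrt (c / pi)) = (ln c - ln pi) / 2" using c by (simp add: ln_sqrt ln_divide_pos)
    ultimately show ?thesis by simp
  qed
  ultimately have lo: "- 7 - 2 * ln 2 + (ln c - ln pi) / 2 + ln V \<le> ln (norm_inv_vandermonde n (equispaced \<epsilon>))"
    by simp
  have "ln pi \<le> pi - 1" by (rule ln_le_minus_one) simp
  then have lnpi: "ln pi \<le> 3" using pi_less_4 by linarith
  \<comment> \<open>\<open>- k\<close> enters three times in the upper bound and \<open>5/2\<close> times in the lower one.\<close>
  have "\<bar>x - (m - l)\<bar> \<le> 60 * (1 + \<bar>e\<bar>)"
    if "x \<le> ln 2 - k + y" "- 7 - 2 * ln 2 + (k - ln pi) / 2 + y' \<le> x"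
      "y \<le> m - l + 6 - 2 * k" "m - l - 6 + 2 * k \<le> y'" "- k \<le> 14 + \<bar>e\<bar>" for x y y' m l k e :: real
    using that ln_2_less_1 lnpi by (simp add: abs_le_iff) argo
  from this[OF up lo ln_paired_ratio_le[OF n eps short, folded c_def U_def]
      ln_centred_ratio_ge[OF n eps short, folded c_def V_def] minus_ln_cos_le[OF n eps short, folded c_def]]
  show ?thesis .
qed

end

section \<open>The estimate\<close>

lemma norm_inv_vandermonde_cong:
  assumes "\<And>j. j \<le> n \<Longrightarrow> z j = z' j"
  shows "norm_inv_vandermonde n z = norm_inv_vandermonde n z'"
proof -
  have "vandermonde_mat n z = vandermonde_mat n z'"
    unfolding vandermonde_mat_def by (rule cong_mat) (use assms in auto)
  then show ?thesis by (simp add: norm_inv_vandermonde_def)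
qed

theorem theorem1p1:
  shows "\<exists>C K :: real. C \<in> {1/2..1} \<and> K > 0 \<and>
    (\<forall>(n::nat) (\<epsilon>::real) (z :: nat \<Rightarrow> complex).
       n \<ge> 1 \<longrightarrow> \<epsilon> > 0 \<longrightarrow>
       (\<forall>j\<le>n. z j \<in> sphere 0 1) \<longrightarrow>
       (\<forall>j\<le>n. \<forall>k\<le>n. j \<noteq> k \<longrightarrow> arc_dist (z j) (z k) \<ge> \<epsilon>) \<longrightarrow>
       ln (norm_inv_vandermonde n z) / real n
         \<le> main_term n \<epsilon> - C * ln (real n) / real n + K * error_term n \<epsilon>) \<and>
    (\<forall>(n::nat) (\<epsilon>::real) (z :: nat \<Rightarrow> complex).
       n \<ge> 1 \<longrightarrow> \<epsilon> > 0 \<longrightarrow>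
       (real n + 1) * \<epsilon> \<le> 2 * pi \<longrightarrow>
       (\<forall>j\<le>n. z j = exp (\<i> * of_nat j * of_real \<epsilon>)) \<longrightarrow>
       \<bar>ln (norm_inv_vandermonde n z) / real n - (main_term n \<epsilon> - ln (real n) / real n)\<bar>
         \<le> K * error_term n \<epsilon>)"
proof (rule exI[of _ "1 / 2"], rule exI[of _ 60], intro conjI allI impI)
  fix n :: nat and \<epsilon> :: real and z :: "nat \<Rightarrow> complex"
  assume n: "n \<ge> 1" and eps: "\<epsilon> > 0" and unit: "\<forall>j\<le>n. z j \<in> sphere 0 1"
    and sep: "\<forall>j\<le>n. \<forall>k\<le>n. j \<noteq> k \<longrightarrow> arc_dist (z j) (z k) \<ge> \<epsilon>"
  let ?e = "1 + \<bar>ln (real n * \<epsilon> * (2 * pi - real n * \<epsilon>))\<bar>"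
  have "ln (norm_inv_vandermonde n z) \<le> real n * main_term n \<epsilon> - 1 / 2 * ln (real n) + 35 * ?e"
    by (rule ln_norm_inv_vandermonde_le_separated[OF n eps]) (use unit sep in auto)
  also have "\<dots> \<le> real n * main_term n \<epsilon> - 1 / 2 * ln (real n) + 60 * ?e" by simp
  finally have "ln (norm_inv_vandermonde n z) / real n
      \<le> (real n * main_term n \<epsilon> - 1 / 2 * ln (real n) + 60 * ?e) / real n"
    by (rule divide_right_mono) simp
  also have "\<dots> = main_term n \<epsilon> - 1 / 2 * ln (real n) / real n + 60 * error_term n \<epsilon>"
    using n by (simp add: error_term_def add_divide_distrib diff_divide_distrib)
  finally show "ln (norm_inv_vandermonde n z) / real n
      \<le> main_term n \<epsilon> - 1 / 2 * ln (real n) / real n + 60 * error_term n \<epsilon>" .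
next
  fix n :: nat and \<epsilon> :: real and z :: "nat \<Rightarrow> complex"
  assume n: "n \<ge> 1" and eps: "\<epsilon> > 0" and short: "(real n + 1) * \<epsilon> \<le> 2 * pi"
    and z: "\<forall>j\<le>n. z j = exp (\<i> * of_nat j * of_real \<epsilon>)"
  let ?e = "1 + \<bar>ln (real n * \<epsilon> * (2 * pi - real n * \<epsilon>))\<bar>"
  have "norm_inv_vandermonde n z = norm_inv_vandermonde n (equispaced \<epsilon>)"
    by (rule norm_inv_vandermonde_cong) (simp add: z equispaced_def cis_conv_exp mult.assoc)
  then have "\<bar>ln (norm_inv_vandermonde n z) - (real n * main_term n \<epsilon> - ln (real n))\<bar> \<le> 60 * ?e"
    using ln_norm_inv_equispaced[OF n eps short] by simp
  then have "\<bar>ln (norm_inv_vandermonde n z) - (real n * main_term n \<epsilon> - ln (real n))\<bar> / real n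
      \<le> 60 * ?e / real n"
    by (rule divide_right_mono) simp
  also have "\<bar>ln (norm_inv_vandermonde n z) - (real n * main_term n \<epsilon> - ln (real n))\<bar> / real n
      = \<bar>(ln (norm_inv_vandermonde n z) - (real n * main_term n \<epsilon> - ln (real n))) / real n\<bar>"
    by simp
  also have "(ln (norm_inv_vandermonde n z) - (real n * main_term n \<epsilon> - ln (real n))) / real n
      = ln (norm_inv_vandermonde n z) / real n - (main_term n \<epsilon> - ln (real n) / real n)"
    using n by (simp add: diff_divide_distrib)
  finally show "\<bar>ln (norm_inv_vandermonde n z) / real n - (main_term n \<epsilon> - ln (real n) / real n)\<bar>
      \<le> 60 * error_term n \<epsilon>"
    by (simp add: error_term_def)
qed auto

end
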